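(* Let $n\ge 1$, let $D$ be a strictly linearly convex domain in $\mathbb{C}^{n}$, and let $a\in D$. Let $f$ be an analytic function in $D$ with Taylor expansion $$f(z)=\sum_{k\in\mathbb{Z}_{+}^{n}}c_{k}\,(z-a)^{k}$$ at $z=a$. For $s\in\{1,\ldots,n\}$ and $i\in\mathbb{N}$ define the weighted Hankel-type determinants $$H_{i}^{(s)}(f,a):=\det\left(\frac{c_{k(\alpha)+k(\beta)}}{\lambda^{(s)}_{k(\alpha)+k(\beta)}}\right)_{\alpha,\beta=1}^{i},\qquad \lambda_{k}^{(s)}:=\frac{(|k|+s-1)!}{k!\,(s-1)!}\quad (k\in\mathbb{Z}_{+}^{n}).$$ Then for each $s=1,2,\ldots,n$, $$\limsup_{i\to\infty}\left|H_{i}^{(s)}(f,a)\right|^{1/(2l_{\sigma(i)})}\le d\big((D-a)^{\ast}\big),$$ where $d$ denotes the transfinite diameter in $\mathbb{C}^n$, $D-a:=\{z-a: z\in D\}$, and $(D-a)^{\ast}$ is the conjugate set of $D-a$.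
   Context: Multi-indices: for $k=(k_1,\ldots,k_n)\in\mathbb{Z}_{+}^{n}$ (nonnegative integers), $|k|=k_1+\cdots+k_n$, $k!=k_1!\cdots k_n!$, $z^k=z_1^{k_1}\cdots z_n^{k_n}$. Enumeration of monomials: $i\mapsto k(i)=(k_1(i),\ldots,k_n(i))$, $i\in\mathbb{N}=\{1,2,\ldots\}$, is an enumeration of all of $\mathbb{Z}_{+}^{n}$ (each multi-index occurring exactly once) such that the degrees $\sigma(i):=k_1(i)+\cdots+k_n(i)$ are non-decreasing. Put $e_i(z):=z^{k(i)}$. Let $m_\sigma$ be the number of monomials in $n$ variables of degree $\le\sigma$, and $l_\sigma:=\sum_{q=1}^{\sigma}q\,(m_q-m_{q-1})$. Transfinite diameter: for a compact set $K\subset\mathbb{C}^{n}$, $$d(K):=\limsup_{\sigma\to\infty}\left(\max\left\{\left|\det\big(e_i(\zeta_j)\big)_{i,j=1}^{m_\sigma}\right| : (\zeta_j)\in K^{m_\sigma}\right\}\right)^{1/l_\sigma}.$$ Function spaces: for a domain $D\subset\mathbb{C}^n$, $A(D)$ is the space of all analytic functions in $D$ with the topology of locally uniform convergence; for a compact set $K\subset\mathbb{C}^n$, $A(K)$ is the space of germs of analytic functions on $K$ with the standard inductive limit topology. $A(E)^{\ast}$ denotes the dual space of continuous linear functionals. Conjugate set and linear convexity: let $E$ be a domain or a compact set in $\mathbb{C}^n$. With $w\cdot z:=\sum_{\nu=1}^{n}w_\nu z_\nu$, the conjugate of $E$ is $$E^{\ast}:=\{w\in\mathbb{C}^{n}: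 w\cdot z\ne 1\ \text{for all } z\in E\}.$$ $E$ is linearly convex if $E^{\ast\ast}:=(E^{\ast})^{\ast}=E$. If $E$ is linearly convex, then for $w\in E^{\ast}$ the function $u_w(z):=(1-w\cdot z)^{-1}$, $z\in E$, belongs to $A(E)$, and the Fantappiè transform $\mathcal{F}:A(E)^{\ast}\to A(E^{\ast})$ is the linear operator $\mathcal{F}(F)(w):=F(u_w)$. A linearly convex set $E$ is called strictly linearly convex if $\mathcal{F}:A(E)^{\ast}\to A(E^{\ast})$ is an isomorphism. *)

theory Defs
  imports "HOL-Analysis.Analysis" "Jordan_Normal_Form.Determinant"
begin

(* Here $ always denotes the components of vectors in complex ^ 'n. *)
no_notation Matrix.vec_index (infixl \<open>$\<close> 100)

section \<open>Multi-indices and monomials\<close>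

type_synonym 'n multiindex = "'n \<Rightarrow> nat"

definition mdeg :: "'n::finite multiindex \<Rightarrow> nat" where
  "mdeg k = (\<Sum>\<nu>\<in>UNIV. k \<nu>)"

definition mfact :: "'n::finite multiindex \<Rightarrow> nat" where
  "mfact k = (\<Prod>\<nu>\<in>UNIV. fact (k \<nu>))"

definition mpow :: "complex ^ 'n \<Rightarrow> 'n::finite multiindex \<Rightarrow> complex" where
  "mpow z k = (\<Prod>\<nu>\<in>UNIV. (z $ \<nu>) ^ k \<nu>)"

definition madd :: "'n multiindex \<Rightarrow> 'n multiindex \<Rightarrow> 'n multiindex" where
  "madd k l = (\<lambda>\<nu>. k \<nu> + l \<nu>)"

(* The index set is {1,2,...}; the value k 0 is irrelevant. *)
definition graded_enumeration :: "(nat \<Rightarrow> 'n::finite multiindex) \<Rightarrow> bool" where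
  "graded_enumeration k \<longleftrightarrow>
     bij_betw k {1..} UNIV \<and> mono_on {1..} (\<lambda>i. mdeg (k i))"

definition num_monomials :: "'n::finite itself \<Rightarrow> nat \<Rightarrow> nat" where
  "num_monomials _ \<sigma> = card {k :: 'n multiindex. mdeg k \<le> \<sigma>}"

definition total_degree :: "'n::finite itself \<Rightarrow> nat \<Rightarrow> nat" where
  "total_degree n \<sigma> = (\<Sum>q = 1..\<sigma>. q * (num_monomials n q - num_monomials n (q - 1)))"

section \<open>Transfinite diameter\<close>

(* Matrices in Jordan_Normal_Form are indexed from 0.  For compact K the supremum over
   K^m is attained, so it is the maximum. *)
definition vandermonde_max ::
    "(nat \<Rightarrow> 'n::finite multiindex) \<Rightarrow> (complex ^ 'n) set \<Rightarrow> nat \<Rightarrow> real" where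
  "vandermonde_max k K m =
     (SUP \<zeta> \<in> {1..m} \<rightarrow> K.
        cmod (Determinant.det (Matrix.mat m m (\<lambda>(i, j). mpow (\<zeta> (j + 1)) (k (i + 1))))))"

definition transfinite_diameter ::
    "(nat \<Rightarrow> 'n::finite multiindex) \<Rightarrow> (complex ^ 'n) set \<Rightarrow> ereal" where
  "transfinite_diameter k K =
     limsup (\<lambda>\<sigma>. ereal (vandermonde_max k K (num_monomials TYPE('n) \<sigma>)
                          powr (1 / real (total_degree TYPE('n) \<sigma>))))"

section \<open>Analytic functions of several variables\<close>

definition has_taylor_expansion ::
    "(complex ^ 'n \<Rightarrow> complex) \<Rightarrow> ('n::finite multiindex \<Rightarrow> complex) \<Rightarrow> complex ^ 'n \<Rightarrow> bool" where
  "has_taylor_expansion f c a \<longleftrightarrow>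
     (\<exists>r>0. \<forall>z. (\<forall>\<nu>. cmod (z $ \<nu> - a $ \<nu>) < r) \<longrightarrow>
        ((\<lambda>k. c k * mpow (z - a) k) has_sum f z) UNIV)"

definition analytic_in :: "(complex ^ 'n::finite \<Rightarrow> complex) \<Rightarrow> (complex ^ 'n) set \<Rightarrow> bool" where
  "analytic_in f D \<longleftrightarrow> (\<forall>a\<in>D. \<exists>c. has_taylor_expansion f c a)"

section \<open>The spaces A(D) and A(K)\<close>

(* Functions on D are represented by total functions vanishing outside D. *)
definition hol_space :: "(complex ^ 'n::finite) set \<Rightarrow> (complex ^ 'n \<Rightarrow> complex) set" where
  "hol_space D = {f. analytic_in f D \<and> (\<forall>z. z \<notin> D \<longrightarrow> f z = 0)}"

definition sup_norm_on :: "'a set \<Rightarrow> ('a \<Rightarrow> complex) \<Rightarrow> real" where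
  "sup_norm_on S f = (SUP z\<in>S. cmod (f z))"

(* Locally uniform convergence on an open set D is uniform convergence on compact subsets. *)
definition hol_topology :: "(complex ^ 'n::finite) set \<Rightarrow> (complex ^ 'n \<Rightarrow> complex) topology" where
  "hol_topology D = topology_generated_by
     {{g \<in> hol_space D. sup_norm_on L (\<lambda>z. g z - f z) < \<epsilon>} | f L \<epsilon>.
        f \<in> hol_space D \<and> compact L \<and> L \<noteq> {} \<and> L \<subseteq> D \<and> \<epsilon> > 0}"

definition analytic_near :: "(complex ^ 'n::finite \<Rightarrow> complex) \<Rightarrow> (complex ^ 'n) set \<Rightarrow> bool" where
  "analytic_near f K \<longleftrightarrow> (\<exists>U. open U \<and> K \<subseteq> U \<and> analytic_in f U)"

definition germ :: "(complex ^ 'n::finite) set \<Rightarrow> (complex ^ 'n \<Rightarrow> complex) \<Rightarrow>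
    (complex ^ 'n \<Rightarrow> complex) set" where
  "germ K f = {g. \<exists>U. open U \<and> K \<subseteq> U \<and> (\<forall>z\<in>U. g z = f z)}"

(* A seminorm on the space of germs on K, given by its values on representatives, whose
   composition with each canonical map from A(U), U an open neighbourhood of K, is
   continuous. *)
definition germ_seminorm ::
    "(complex ^ 'n::finite) set \<Rightarrow> ((complex ^ 'n \<Rightarrow> complex) \<Rightarrow> real) \<Rightarrow> bool" where
  "germ_seminorm K p \<longleftrightarrow>
     (\<forall>f g. analytic_near f K \<and> analytic_near g K \<longrightarrow>
        p (\<lambda>z. f z + g z) \<le> p f + p g \<and> (germ K f = germ K g \<longrightarrow> p f = p g)) \<and>
     (\<forall>f c. analytic_near f K \<longrightarrow> p (\<lambda>z. c * f z) = cmod c * p f) \<and>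
     (\<forall>U. open U \<and> K \<subseteq> U \<longrightarrow> continuous_map (hol_topology U) euclideanreal p)"

(* The locally convex inductive limit of the spaces A(U), U an open neighbourhood of K: the
   finest locally convex topology on germs for which all canonical maps are continuous. *)
definition germ_topology ::
    "(complex ^ 'n::finite) set \<Rightarrow> (complex ^ 'n \<Rightarrow> complex) set topology" where
  "germ_topology K = topology_generated_by
     {{germ K g | g. analytic_near g K \<and> p (\<lambda>z. g z - f z) < \<epsilon>} | f p \<epsilon>.
        analytic_near f K \<and> germ_seminorm K p \<and> \<epsilon> > 0}"

section \<open>The dual space of A(D) with the strong topology\<close>

(* Functionals are represented by total functions vanishing outside A(D). *)
definition hol_dual ::
    "(complex ^ 'n::finite) set \<Rightarrow> ((complex ^ 'n \<Rightarrow> complex) \<Rightarrow> complex) set" where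
  "hol_dual D = {F.
     (\<forall>f\<in>hol_space D. \<forall>g\<in>hol_space D. F (\<lambda>z. f z + g z) = F f + F g) \<and>
     (\<forall>f\<in>hol_space D. \<forall>c. F (\<lambda>z. c * f z) = c * F f) \<and>
     continuous_map (hol_topology D) euclidean F \<and>
     (\<forall>f. f \<notin> hol_space D \<longrightarrow> F f = 0)}"

definition hol_bounded ::
    "(complex ^ 'n::finite) set \<Rightarrow> (complex ^ 'n \<Rightarrow> complex) set \<Rightarrow> bool" where
  "hol_bounded D B \<longleftrightarrow> B \<subseteq> hol_space D \<and>
     (\<forall>L. compact L \<and> L \<subseteq> D \<longrightarrow> (\<exists>M. \<forall>f\<in>B. \<forall>z\<in>L. cmod (f z) \<le> M))"

definition strong_dual_topology ::
    "(complex ^ 'n::finite) set \<Rightarrow> ((complex ^ 'n \<Rightarrow> complex) \<Rightarrow> complex) topology" where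
  "strong_dual_topology D = topology_generated_by
     {{G \<in> hol_dual D. sup_norm_on B (\<lambda>f. G f - F f) < \<epsilon>} | F B \<epsilon>.
        F \<in> hol_dual D \<and> hol_bounded D B \<and> B \<noteq> {} \<and> \<epsilon> > 0}"

section \<open>Linear convexity and the Fantappie transform\<close>

definition cdot :: "complex ^ 'n::finite \<Rightarrow> complex ^ 'n \<Rightarrow> complex" where
  "cdot w z = (\<Sum>\<nu>\<in>UNIV. w $ \<nu> * z $ \<nu>)"

definition conjugate_set :: "(complex ^ 'n::finite) set \<Rightarrow> (complex ^ 'n) set" where
  "conjugate_set E = {w. \<forall>z\<in>E. cdot w z \<noteq> 1}"

definition linearly_convex :: "(complex ^ 'n::finite) set \<Rightarrow> bool" where
  "linearly_convex E \<longleftrightarrow> conjugate_set (conjugate_set E) = E"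

definition fantappie_kernel :: "complex ^ 'n::finite \<Rightarrow> complex ^ 'n \<Rightarrow> complex" where
  "fantappie_kernel w z = 1 / (1 - cdot w z)"

(* If D is a linearly convex domain, then 0 is in D, so conjugate_set D is compact and
   A(conjugate_set D) is a space of germs.  The transform w |-> F(u_w) thus has to be read
   for all w near conjugate_set D, although u_w belongs to A(D) only for w in conjugate_set D.
   Every continuous F is bounded by a multiple of the sup norm on some compact L in D.  For w
   close to conjugate_set D the function u_w is a uniform limit on L of functions in A(D) (of
   the partial sums of its Taylor series in w), and F(u_w) is the value at u_w of the unique
   extension of F by continuity.  It does not depend on L once w is close enough to
   conjugate_set D; hence the functions h below form exactly one germ. *)
definition fantappie_transform ::
    "(complex ^ 'n::finite) set \<Rightarrow> ((complex ^ 'n \<Rightarrow> complex) \<Rightarrow> complex) \<Rightarrow>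
     (complex ^ 'n \<Rightarrow> complex) set" where
  "fantappie_transform D F = {h. \<exists>L C U.
     compact L \<and> L \<noteq> {} \<and> L \<subseteq> D \<and>
     (\<forall>f\<in>hol_space D. cmod (F f) \<le> C * sup_norm_on L f) \<and>
     open U \<and> conjugate_set D \<subseteq> U \<and> U \<subseteq> conjugate_set L \<and> analytic_in h U \<and>
     (\<forall>w\<in>U. \<forall>\<epsilon>>0. \<exists>f\<in>hol_space D.
        sup_norm_on L (\<lambda>z. f z - fantappie_kernel w z) < \<epsilon> \<and> cmod (F f - h w) < \<epsilon>)}"

(* Isomorphism of locally convex spaces; linearity of the transform is automatic. *)
definition strictly_linearly_convex_domain :: "(complex ^ 'n::finite) set \<Rightarrow> bool" where
  "strictly_linearly_convex_domain D \<longleftrightarrow>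
     open D \<and> connected D \<and> D \<noteq> {} \<and> linearly_convex D \<and>
     homeomorphic_map (strong_dual_topology D) (germ_topology (conjugate_set D))
       (fantappie_transform D)"

section \<open>Weighted Hankel determinants\<close>

definition fantappie_weight :: "nat \<Rightarrow> 'n::finite multiindex \<Rightarrow> real" where
  "fantappie_weight s k = fact (mdeg k + s - 1) / (real (mfact k) * fact (s - 1))"

definition hankel_det ::
    "(nat \<Rightarrow> 'n::finite multiindex) \<Rightarrow> nat \<Rightarrow> ('n multiindex \<Rightarrow> complex) \<Rightarrow> nat \<Rightarrow> complex" where
  "hankel_det k s c i = Determinant.det (Matrix.mat i i (\<lambda>(\<alpha>, \<beta>).
     c (madd (k (\<alpha> + 1)) (k (\<beta> + 1))) /
     complex_of_real (fantappie_weight s (madd (k (\<alpha> + 1)) (k (\<beta> + 1))))))"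

end

theory Submission
  imports Defs
    "HOL-Complex_Analysis.Cauchy_Integral_Formula"
    "HOL-Real_Asymp.Real_Asymp"
begin

text \<open>
  Write \<open>K\<close> for the conjugate set of \<open>D - a\<close>, \<open>\<gamma>\<^sub>k\<close> for the Taylor coefficient of \<open>f\<close> at \<open>a\<close> divided by the
  weight of order \<open>s\<close>, and \<open>\<Phi>\<close> for the linear functional on polynomials with \<open>\<Phi>(w\<^sup>k) = \<gamma>\<^sub>k\<close>, so that
  the Hankel determinant is that of the matrix with entries \<open>\<Phi>(e\<^sub>i e\<^sub>j)\<close>.

  The analytic core is that \<open>\<Phi>\<close> is an analytic functional carried by \<open>K\<close>: for every open
  \<open>U \<supseteq> K\<close> one has \<open>|\<Phi>(P)| \<le> C sup\<^sub>U |P|\<close> (\<open>weighted_taylor_functional_bound\<close>).  For \<open>s = 1\<close> the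
  polynomial \<open>P = \<Sum> p\<^sub>k w\<^sup>k\<close> gives the functional \<open>\<Sum> p\<^sub>k \<gamma>\<^sub>k\<close> of \<open>f\<close> on \<open>A(D)\<close>, whose Fantappie transform is
  \<open>P(v / (1 - v \<cdot> a)) / (1 - v \<cdot> a)\<close>; continuity of the inverse transform bounds its values on a
  bounded set of functions by a sup norm of that germ, hence by \<open>sup\<^sub>U |P|\<close>
  (\<open>taylor_functional_bound_on_bounded\<close>).  An exhaustion argument makes this bound uniform over all
  functions bounded by one on a single compact subset of \<open>D\<close>
  (\<open>taylor_functional_bound_equicontinuous\<close>).  For \<open>s = m + 1 \<ge> 2\<close>, which needs at least two
  variables, \<open>\<Phi>(P)\<close> is the functional of order one at the polynomial \<open>Q\<close> obtained from \<open>P\<close> by dividing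
  its part of degree \<open>j\<close> by the binomial coefficient of \<open>j + m\<close> over \<open>m\<close>.  Now \<open>Q(w)\<close> is the order one
  functional that belongs to the function \<open>(y \<cdot> h)\<^sup>m / (1 - w \<cdot> h)\<close> of \<open>h = z - a\<close>, taken at the
  polynomial \<open>(b \<cdot> v)\<^sup>m P(v)\<close> in \<open>v\<close>, where \<open>b\<close> is orthogonal to the point \<open>w\<close> and \<open>b \<cdot> y = 1\<close>; so \<open>Q\<close> is bounded
  near \<open>K\<close> by \<open>sup\<^sub>U |P|\<close> (\<open>weighted_polynomial_bound\<close>).

  Replacing each monomial by a monic polynomial \<open>q\<^sub>i\<close> with the same leading term does not change the
  Hankel determinant, whose entries become \<open>\<Phi>(q\<^sub>i q\<^sub>j)\<close>.  It is therefore at most \<open>i! C\<^sup>i\<close> times the square of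
  the product of the norms of the \<open>q\<^sub>j\<close> on \<open>U\<close> (\<open>norm_hankel_det_le\<close>).

  It remains to find monic polynomials with small norms near \<open>K\<close>.  The Vandermonde maxima of \<open>K\<close> are at
  least the products of the Chebyshev constants (\<open>vandermonde_max_ge\<close>), so for every \<open>d\<close> above the
  transfinite diameter there is one degree \<open>p\<close> at which the geometric mean of the Chebyshev constants,
  taken to the power \<open>1 / p\<close>, is less than \<open>d\<close> (\<open>chebyshev_mean_less\<close>).  By continuity the finitely
  many polynomials of degree \<open>p\<close> involved keep this property on a neighbourhood \<open>U\<close> of \<open>K\<close>.  The minimal norms on \<open>U\<close> are
  submultiplicative in the leading monomial, and the averages of their logarithms over the monomials of
  one degree are subadditive in the degree, because splitting a uniformly distributed multi-index
  hypergeometrically gives uniformly distributed parts (\<open>degree_average_subadditive\<close>).  So the degree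
  \<open>p\<close> controls all others (\<open>monic_polys_near\<close>), and since the number of monomials times its logarithm
  and the contribution of the last degree are negligible against \<open>total_degree\<close>, the bound follows.
\<close>

section \<open>Multi-indices\<close>

lemma mdeg_madd: "mdeg (madd k l) = mdeg k + mdeg l"
  by (simp add: mdeg_def madd_def sum.distrib)

lemma mdeg_ge: "k \<nu> \<le> mdeg (k :: 'n::finite multiindex)"
  unfolding mdeg_def by (rule member_le_sum) auto

lemma finite_mdeg_le: "finite {k :: 'n::finite multiindex. mdeg k \<le> q}"
proof (rule finite_subset)
  show "{k :: 'n multiindex. mdeg k \<le> q} \<subseteq> Pi\<^sub>E UNIV (\<lambda>_. {..q})"
    using mdeg_ge order_trans by (fastforce simp: PiE_UNIV_domain)
  show "finite (Pi\<^sub>E (UNIV :: 'n set) (\<lambda>_. {..q}))"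
    by (intro finite_PiE) auto
qed

lemma finite_mdeg_eq [simp]: "finite {k :: 'n::finite multiindex. mdeg k = q}"
  by (rule finite_subset[OF _ finite_mdeg_le[of q]]) auto

lemma mpow_madd: "mpow z (madd k l) = mpow z k * mpow z l"
  by (simp add: mpow_def madd_def power_add prod.distrib)

lemma mpow_zero [simp]: "mpow z (\<lambda>_. 0) = 1"
  by (simp add: mpow_def)

lemma mpow_scale: "mpow (c *s z) k = c ^ mdeg k * mpow z k"
  by (simp add: mpow_def mdeg_def power_mult_distrib prod.distrib power_sum)

lemma mdeg_0_iff: "mdeg k = 0 \<longleftrightarrow> k = (\<lambda>_. 0)"
  by (auto simp: mdeg_def)

lemma norm_mpow_le:
  assumes "\<And>\<nu>. cmod (z $ \<nu>) \<le> R"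
  shows "cmod (mpow z k) \<le> R ^ mdeg k"
proof -
  have "cmod (mpow z k) = (\<Prod>\<nu>\<in>UNIV. cmod (z $ \<nu>) ^ k \<nu>)"
    by (simp add: mpow_def norm_power flip: prod_norm)
  also have "\<dots> \<le> (\<Prod>\<nu>\<in>UNIV. R ^ k \<nu>)"
    by (intro prod_mono) (auto intro: power_mono assms)
  finally show ?thesis by (simp add: mdeg_def power_sum)
qed

section \<open>Counting multi-indices\<close>

lemma bij_betw_count_mdeg:
  "bij_betw count (multisets_of_size (UNIV :: 'n::finite set) q) {k. mdeg k = q}"
proof -
  have size: "size X = mdeg (count X)" for X :: "'n multiset"
    unfolding mdeg_def size_multiset_overloaded_eq
    by (rule sum.mono_neutral_left) (auto simp: not_in_iff)
  show ?thesis
  proof (rule bij_betwI[where g = Abs_multiset])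
    show "Abs_multiset \<in> {k. mdeg k = q} \<rightarrow> multisets_of_size (UNIV :: 'n set) q"
      by (auto simp: multisets_of_size_def size)
  qed (auto simp: multisets_of_size_def size count_inverse)
qed

lemma fps_nth_prod_multiindex:
  fixes F :: "'n::finite \<Rightarrow> 'a::comm_ring_1 fps"
  shows "fps_nth (\<Prod>\<nu>\<in>UNIV. F \<nu>) q = (\<Sum>k | mdeg k = q. \<Prod>\<nu>\<in>UNIV. fps_nth (F \<nu>) (k \<nu>))"
  by (simp add: fps_prod_nth' sum.reindex_bij_betw[OF bij_betw_count_mdeg, symmetric])

lemma card_mdeg_eq:
  "card {k :: 'n::finite multiindex. mdeg k = q} = (q + CARD('n) - 1) choose q"
  using bij_betw_same_card[OF bij_betw_count_mdeg[where ?'n = 'n, of q]]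
  by (simp add: card_multisets_of_size add.commute)

text \<open>The multinomial theorem, by comparing coefficients in the product of the exponential series
  of the \<open>x \<nu>\<close>.\<close>

lemma sum_power_multinomial:
  fixes x :: "'n::finite \<Rightarrow> complex"
  shows "(\<Sum>\<nu>\<in>UNIV. x \<nu>) ^ j = (\<Sum>k | mdeg k = j. fact j / of_nat (mfact k) * (\<Prod>\<nu>\<in>UNIV. x \<nu> ^ k \<nu>))"
proof -
  have exp_sum: "(\<Prod>\<nu>\<in>A. fps_exp (x \<nu>)) = fps_exp (\<Sum>\<nu>\<in>A. x \<nu>)" for A
    by (induction A rule: infinite_finite_induct) (auto simp: fps_exp_add_mult)
  have "(\<Sum>\<nu>\<in>UNIV. x \<nu>) ^ j / fact j = fps_nth (\<Prod>\<nu>\<in>UNIV. fps_exp (x \<nu>)) j"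
    by (simp add: exp_sum)
  also have "\<dots> = (\<Sum>k | mdeg k = j. \<Prod>\<nu>\<in>UNIV. x \<nu> ^ k \<nu> / fact (k \<nu>))"
    by (simp add: fps_nth_prod_multiindex)
  finally have "(\<Sum>\<nu>\<in>UNIV. x \<nu>) ^ j = fact j * (\<Sum>k | mdeg k = j. \<Prod>\<nu>\<in>UNIV. x \<nu> ^ k \<nu> / fact (k \<nu>))"
    by (simp add: field_simps)
  then show ?thesis
    by (simp add: sum_distrib_left mfact_def prod_dividef)
qed

lemma mfact_pos: "mfact k > 0"
  by (simp add: mfact_def)

lemma fantappie_weight_1: "fantappie_weight 1 k = fact (mdeg k) / real (mfact k)"
  by (simp add: fantappie_weight_def)

lemma fantappie_weight_pos: "fantappie_weight s k > 0"
  by (simp add: fantappie_weight_def mfact_pos)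

lemma cdot_power:
  "cdot w z ^ j = (\<Sum>k | mdeg k = j. complex_of_real (fantappie_weight 1 k) * (mpow w k * mpow z k))"
  by (simp add: cdot_def sum_power_multinomial fantappie_weight_1[unfolded One_nat_def] mpow_def
      power_mult_distrib prod.distrib)

text \<open>Two Vandermonde identities: the coefficients of \<open>\<Prod>\<nu>. (1 + X) ^ k \<nu>\<close> and of
  \<open>\<Prod>\<nu>. (1 - X) ^ -(\<kappa> \<nu> + 1)\<close>.\<close>

lemma sum_prod_choose_lower:
  fixes k :: "'n::finite multiindex"
  assumes "mdeg k = p + q"
  shows "(\<Sum>\<kappa> | mdeg \<kappa> = p. \<Prod>\<nu>\<in>UNIV. real (k \<nu> choose \<kappa> \<nu>)) = real ((p + q) choose p)"
proof -
  have binom_nth: "fps_nth ((1 + fps_X :: real fps) ^ m) j = real (m choose j)" for m j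
    by (simp add: fps_binomial_of_nat[symmetric] fps_binomial_nth flip: binomial_gbinomial)
  have "fps_nth (\<Prod>\<nu>\<in>UNIV. (1 + fps_X :: real fps) ^ k \<nu>) p = fps_nth ((1 + fps_X :: real fps) ^ (p + q)) p"
    using assms by (simp add: mdeg_def flip: power_sum)
  then show ?thesis
    by (simp add: fps_nth_prod_multiindex binom_nth)
qed

lemma sum_prod_choose_upper:
  fixes \<kappa> :: "'n::finite multiindex"
  assumes "mdeg \<kappa> = p"
  shows "(\<Sum>l | mdeg l = q. \<Prod>\<nu>\<in>UNIV. real ((\<kappa> \<nu> + l \<nu>) choose \<kappa> \<nu>)) = real ((p + q + CARD('n) - 1) choose q)"
proof -
  \<comment> \<open>\<open>G m\<close> is the series of \<open>(1 - X) ^ -(m + 1)\<close>.\<close>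
  define G :: "nat \<Rightarrow> real fps" where "G m = Abs_fps (\<lambda>j. real ((m + j) choose m))" for m
  have G_Suc: "G (Suc m) = G m * G 0" for m
  proof (rule fps_ext)
    fix j
    have "(\<Sum>i\<le>j. (m + i) choose m) = Suc (m + j) choose j"
      using sum_choose_lower[of m j] by (simp add: binomial_symmetric[of m])
    also have "\<dots> = (Suc m + j) choose Suc m"
      using binomial_symmetric[of j "Suc (m + j)"] by simp
    finally have "(\<Sum>i\<le>j. (m + i) choose m) = (Suc m + j) choose Suc m" .
    then show "fps_nth (G (Suc m)) j = fps_nth (G m * G 0) j"
      unfolding fps_mult_nth G_def atLeast0AtMost by (simp flip: of_nat_sum)
  qed
  have G_power: "G m = G 0 ^ Suc m" for m
    by (induction m) (use G_Suc in auto)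
  have "mdeg \<kappa> + CARD('n) = (\<Sum>\<nu>\<in>UNIV. Suc (\<kappa> \<nu>))"
    using sum.distrib[of \<kappa> "\<lambda>_. 1" UNIV] by (simp add: mdeg_def)
  then have exponent: "(\<Sum>\<nu>\<in>UNIV. Suc (\<kappa> \<nu>)) = Suc (p + CARD('n) - 1)"
    using assms finite_UNIV_card_ge_0[where ?'a = 'n, OF finite_class.finite_UNIV] by linarith
  have "(\<Prod>\<nu>\<in>UNIV. G (\<kappa> \<nu>)) = (\<Prod>\<nu>\<in>UNIV. G 0 ^ Suc (\<kappa> \<nu>))"
    by (rule prod.cong[OF refl], rule G_power)
  also have "\<dots> = G 0 ^ (\<Sum>\<nu>\<in>UNIV. Suc (\<kappa> \<nu>))"
    by (simp only: power_sum)
  also have "\<dots> = G (p + CARD('n) - 1)"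
    unfolding exponent by (rule G_power[symmetric])
  finally have "fps_nth (\<Prod>\<nu>\<in>UNIV. G (\<kappa> \<nu>)) q = fps_nth (G (p + CARD('n) - 1)) q"
    by simp
  moreover have "(p + CARD('n) - 1 + q) choose (p + CARD('n) - 1) = (p + q + CARD('n) - 1) choose q"
  proof -
    have "p + q + CARD('n) - 1 = p + CARD('n) - 1 + q"
      using finite_UNIV_card_ge_0[where ?'a = 'n, OF finite_class.finite_UNIV] by linarith
    then show ?thesis
      using binomial_symmetric[of q "p + CARD('n) - 1 + q"] by (simp only: add_diff_cancel_right' le_add2)
  qed
  ultimately show ?thesis
    by (simp add: fps_nth_prod_multiindex G_def)
qed

section \<open>Taylor expansions in several variables\<close>

lemma norm_le_sum_components: "norm x \<le> (\<Sum>\<nu>\<in>UNIV. norm (x $ \<nu>))"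
  unfolding norm_vec_def by (rule L2_set_le_sum) auto

lemma polydisc_subset_open:
  fixes V :: "(complex ^ 'n::finite) set"
  assumes "open V" "a \<in> V"
  obtains r where "r > 0" "\<And>z. (\<And>\<nu>. cmod (z $ \<nu> - a $ \<nu>) < r) \<Longrightarrow> z \<in> V"
proof -
  obtain e where e: "e > 0" "ball a e \<subseteq> V"
    using assms by (meson openE)
  define r where "r = e / of_nat CARD('n)"
  have "z \<in> V" if z: "\<And>\<nu>. cmod (z $ \<nu> - a $ \<nu>) < r" for z
  proof -
    have "norm (z - a) \<le> (\<Sum>\<nu>\<in>UNIV. cmod ((z - a) $ \<nu>))"
      by (rule norm_le_sum_components)
    also have "\<dots> < (\<Sum>\<nu>\<in>(UNIV :: 'n set). r)"
      by (rule sum_strict_mono) (use z in auto)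
    also have "\<dots> = e"
      by (simp add: r_def)
    finally show ?thesis
      using e by (auto simp: dist_norm norm_minus_commute)
  qed
  moreover have "r > 0"
    using e by (simp add: r_def)
  ultimately show ?thesis
    using that by blast
qed

lemma has_taylor_expansion_cong:
  fixes f :: "complex ^ 'n::finite \<Rightarrow> complex"
  assumes f: "has_taylor_expansion f c a" and V: "open V" "a \<in> V" and eq: "\<And>z. z \<in> V \<Longrightarrow> g z = f z"
  shows "has_taylor_expansion g c a"
proof -
  obtain r where r: "r > 0" "\<And>z. (\<And>\<nu>. cmod (z $ \<nu> - a $ \<nu>) < r) \<Longrightarrow>
      ((\<lambda>k. c k * mpow (z - a) k) has_sum f z) UNIV"
    using f unfolding has_taylor_expansion_def by blast
  obtain r' where r': "r' > 0" "\<And>z. (\<And>\<nu>. cmod (z $ \<nu> - a $ \<nu>) < r') \<Longrightarrow> z \<in> V"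
    using polydisc_subset_open[OF V] by blast
  show ?thesis
    unfolding has_taylor_expansion_def
    by (rule exI[of _ "min r r'"]) (use r r' eq in auto)
qed

lemma has_taylor_expansion_finite:
  assumes "finite S"
  shows "has_taylor_expansion (\<lambda>z. \<Sum>k\<in>S. c k * mpow (z - a) k) (\<lambda>k. if k \<in> S then c k else 0) a"
  unfolding has_taylor_expansion_def
  by (intro exI[of _ 1]) (auto intro!: has_sum_finite_neutralI[OF assms])

lemma has_taylor_expansion_add:
  assumes "has_taylor_expansion f c a" "has_taylor_expansion g d a"
  shows "has_taylor_expansion (\<lambda>z. f z + g z) (\<lambda>k. c k + d k) a"
proof -
  obtain r r' where "r > 0" "\<And>z. (\<And>\<nu>. cmod (z $ \<nu> - a $ \<nu>) < r) \<Longrightarrow>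
      ((\<lambda>k. c k * mpow (z - a) k) has_sum f z) UNIV"
    and "r' > 0" "\<And>z. (\<And>\<nu>. cmod (z $ \<nu> - a $ \<nu>) < r') \<Longrightarrow>
      ((\<lambda>k. d k * mpow (z - a) k) has_sum g z) UNIV"
    using assms unfolding has_taylor_expansion_def by blast
  then show ?thesis
    unfolding has_taylor_expansion_def
    by (intro exI[of _ "min r r'"]) (auto simp: distrib_right intro!: has_sum_add)
qed

lemma has_taylor_expansion_cmult:
  assumes "has_taylor_expansion f c a"
  shows "has_taylor_expansion (\<lambda>z. x * f z) (\<lambda>k. x * c k) a"
  using assms unfolding has_taylor_expansion_def
  by (force simp: mult.assoc intro!: has_sum_cmult_right)

lemma has_sum_product_complex:
  fixes F :: "'a \<Rightarrow> complex" and G :: "'b \<Rightarrow> complex"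
  assumes F: "(F has_sum s) A" and G: "(G has_sum t) B"
  shows "((\<lambda>(k, l). F k * G l) has_sum (s * t)) (A \<times> B)"
proof -
  have absF: "(\<lambda>k. cmod (F k)) summable_on A" and absG: "(\<lambda>l. cmod (G l)) summable_on B"
    using F G summable_on_iff_abs_summable_on_complex has_sum_imp_summable by blast+
  have "(\<lambda>x. cmod ((\<lambda>(k, l). F k * G l) x)) summable_on (A \<times> B)"
    unfolding Infinite_Sum.abs_summable_on_Sigma_iff
    using absF absG
    by (auto simp: norm_mult infsum_cmult_right' abs_mult abs_of_nonneg infsum_nonneg intro!:
        summable_on_cmult_right summable_on_cmult_left)
  then have "(\<lambda>(k, l). F k * G l) summable_on (A \<times> B)"
    by (rule Infinite_Sum.abs_summable_summable)
  then show ?thesis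
    by (rule has_sum_SigmaI[rotated 2])
       (auto intro!: has_sum_cmult_right has_sum_cmult_left G F)
qed

lemma finite_madd_fibre: "finite {(k, l). madd k l = (m :: 'n::finite multiindex)}"
proof (rule finite_subset)
  show "{(k, l). madd k l = m} \<subseteq> {k. mdeg k \<le> mdeg m} \<times> {k. mdeg k \<le> mdeg m}"
    by (auto simp: mdeg_madd)
qed (auto intro: finite_mdeg_le)

lemma has_taylor_expansion_mult:
  fixes f :: "complex ^ 'n::finite \<Rightarrow> complex"
  assumes "has_taylor_expansion f c a" "has_taylor_expansion g d a"
  shows "has_taylor_expansion (\<lambda>z. f z * g z) (\<lambda>m. \<Sum>(k, l) | madd k l = m. c k * d l) a"
proof -
  obtain r r' where r: "r > 0" "\<And>z. (\<And>\<nu>. cmod (z $ \<nu> - a $ \<nu>) < r) \<Longrightarrow>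
      ((\<lambda>k. c k * mpow (z - a) k) has_sum f z) UNIV"
    and r': "r' > 0" "\<And>z. (\<And>\<nu>. cmod (z $ \<nu> - a $ \<nu>) < r') \<Longrightarrow>
      ((\<lambda>k. d k * mpow (z - a) k) has_sum g z) UNIV"
    using assms unfolding has_taylor_expansion_def by blast
  have "((\<lambda>m. (\<Sum>(k, l) | madd k l = m. c k * d l) * mpow (z - a) m) has_sum (f z * g z)) UNIV"
    if z: "\<And>\<nu>. cmod (z $ \<nu> - a $ \<nu>) < min r r'" for z
  proof -
    let ?P = "\<lambda>(k, l). (c k * mpow (z - a) k) * (d l * mpow (z - a) l)"
    have "(?P has_sum (f z * g z)) (UNIV \<times> UNIV)"
      by (rule has_sum_product_complex) (use r r' z in auto)
    then have *: "((\<lambda>(m, x). ?P x) has_sum (f z * g z)) (SIGMA m:UNIV. {(k, l). madd k l = m})"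
      by (subst has_sum_reindex_bij_witness[of _ "\<lambda>x. (madd (fst x) (snd x), x)" snd "UNIV \<times> UNIV"
          ?P _ "f z * g z"]) auto
    show ?thesis
    proof (rule has_sum_Sigma'[OF *])
      fix m
      have "(\<Sum>x | (case x of (k, l) \<Rightarrow> madd k l = m). ?P x) =
          (\<Sum>(k, l) | madd k l = m. c k * d l) * mpow (z - a) m"
        by (subst sum_distrib_right, rule sum.cong) (auto simp: mpow_madd)
      then show "((\<lambda>x. case (m, x) of (m, x) \<Rightarrow> ?P x) has_sum
          (\<Sum>(k, l) | madd k l = m. c k * d l) * mpow (z - a) m) {(k, l). madd k l = m}"
        by (simp add: has_sum_finite_iff[OF finite_madd_fibre])
    qed
  qed
  then show ?thesis
    unfolding has_taylor_expansion_def using r(1) r'(1) by (intro exI[of _ "min r r'"]) auto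
qed

lemma bij_betw_mdeg_Sigma:
  "bij_betw snd (SIGMA j:UNIV. {k :: 'n::finite multiindex. mdeg k = j}) UNIV"
  by (rule bij_betw_byWitness[where f' = "\<lambda>k. (mdeg k, k)"]) auto

lemma has_sum_imp_sums_mdeg:
  fixes F :: "'n::finite multiindex \<Rightarrow> complex"
  assumes "(F has_sum s) UNIV"
  shows "(\<lambda>j. \<Sum>k | mdeg k = j. F k) sums s"
proof -
  have "((\<lambda>(j, k). F k) has_sum s) (SIGMA j:UNIV. {k. mdeg k = j})"
    using assms has_sum_reindex_bij_betw[OF bij_betw_mdeg_Sigma, of F s]
    by (simp add: case_prod_unfold)
  then have "((\<lambda>j. \<Sum>k | mdeg k = j. F k) has_sum s) UNIV"
    by (rule has_sum_Sigma') (auto simp: has_sum_finite_iff)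
  then show ?thesis
    by (rule has_sum_imp_sums)
qed

lemma sums_mdeg_imp_has_sum:
  fixes F :: "'n::finite multiindex \<Rightarrow> complex"
  assumes sums: "(\<lambda>j. \<Sum>k | mdeg k = j. F k) sums s"
    and summable: "summable (\<lambda>j. \<Sum>k | mdeg k = j. cmod (F k))"
  shows "(F has_sum s) UNIV"
proof -
  have "(\<lambda>x. cmod ((\<lambda>(j, k). F k) x)) summable_on (SIGMA j:UNIV. {k. mdeg k = j})"
    unfolding Infinite_Sum.abs_summable_on_Sigma_iff
    using summable by (auto simp: sum_nonneg summable_on_UNIV_nonneg_real_iff)
  then have "(\<lambda>x. F (snd x)) summable_on (SIGMA j:UNIV. {k. mdeg k = j})"
    by (auto dest!: Infinite_Sum.abs_summable_summable simp: case_prod_unfold)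
  then have "F summable_on UNIV"
    by (simp add: summable_on_reindex_bij_betw[OF bij_betw_mdeg_Sigma, of F])
  then obtain t where t: "(F has_sum t) UNIV"
    using has_sum_infsum by blast
  then show ?thesis
    using has_sum_imp_sums_mdeg[OF t] sums sums_unique2 by blast
qed

text \<open>The expansion is the geometric series, with the powers of \<open>w \<cdot> (z - a)\<close> expanded by the
  multinomial theorem.\<close>

lemma has_taylor_expansion_inverse_affine:
  fixes w a :: "complex ^ 'n::finite"
  assumes b: "b - cdot w a \<noteq> 0"
  shows "has_taylor_expansion (\<lambda>z. 1 / (b - cdot w z))
    (\<lambda>k. complex_of_real (fantappie_weight 1 k) * mpow w k / (b - cdot w a) ^ (mdeg k + 1)) a"
proof -
  define \<beta> where "\<beta> = b - cdot w a"
  define W where "W = (\<Sum>\<nu>\<in>UNIV. cmod (w $ \<nu>))"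
  define r where "r = cmod \<beta> / (1 + W)"
  have W: "W \<ge> 0" by (simp add: W_def sum_nonneg)
  have \<beta>: "\<beta> \<noteq> 0" using b by (simp add: \<beta>_def)
  have r: "r > 0" using W \<beta> by (simp add: r_def)
  have "((\<lambda>k. complex_of_real (fantappie_weight 1 k) * mpow w k / \<beta> ^ (mdeg k + 1) * mpow (z - a) k)
      has_sum (1 / (b - cdot w z))) UNIV"
    if z: "\<And>\<nu>. cmod (z $ \<nu> - a $ \<nu>) < r" for z
  proof (rule sums_mdeg_imp_has_sum)
    let ?F = "\<lambda>k. complex_of_real (fantappie_weight 1 k) * mpow w k / \<beta> ^ (mdeg k + 1) * mpow (z - a) k"
    define h where "h = z - a"
    define q where "q = (\<Sum>\<nu>\<in>UNIV. cmod (w $ \<nu>) * cmod (h $ \<nu>))"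
    have "q \<le> (\<Sum>\<nu>\<in>UNIV. cmod (w $ \<nu>) * r)"
      unfolding q_def by (intro sum_mono mult_left_mono) (use z in \<open>auto simp: h_def less_imp_le\<close>)
    also have "\<dots> = W * r" by (simp add: W_def sum_distrib_right)
    also have "\<dots> < cmod \<beta>" using W \<beta> by (simp add: r_def field_simps)
    finally have q: "q < cmod \<beta>" .
    have q0: "q \<ge> 0" by (simp add: q_def sum_nonneg)
    have "cmod (cdot w h) \<le> q"
      unfolding cdot_def q_def by (rule order_trans[OF norm_sum]) (simp add: norm_mult)
    with q have small: "cmod (cdot w h / \<beta>) < 1" using \<beta> by (simp add: norm_divide)
    have "(\<Sum>k | mdeg k = j. ?F k) = (cdot w h / \<beta>) ^ j / \<beta>" for j
      unfolding power_divide cdot_power h_def[symmetric] sum_divide_distrib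
      by (rule sum.cong) (auto simp: field_simps)
    moreover have "(\<lambda>j. (cdot w h / \<beta>) ^ j / \<beta>) sums (1 / (1 - cdot w h / \<beta>) / \<beta>)"
      by (intro sums_divide geometric_sums small)
    moreover have "1 / (1 - cdot w h / \<beta>) / \<beta> = 1 / (b - cdot w z)"
    proof -
      have "b - cdot w z = \<beta> - cdot w h"
        by (simp add: \<beta>_def h_def cdot_def sum_subtractf algebra_simps)
      also have "\<dots> = (1 - cdot w h / \<beta>) * \<beta>"
        using \<beta> by (simp add: field_simps)
      finally show ?thesis by simp
    qed
    ultimately show "(\<lambda>j. \<Sum>k | mdeg k = j. ?F k) sums (1 / (b - cdot w z))"
      by simp
    have "complex_of_real (\<Sum>k | mdeg k = j. cmod (?F k)) = complex_of_real ((q / cmod \<beta>) ^ j / cmod \<beta>)" for j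
    proof -
      have "complex_of_real (\<Sum>k | mdeg k = j. cmod (?F k)) =
          (\<Sum>k | mdeg k = j. complex_of_real (fantappie_weight 1 k) *
          (mpow (\<chi> \<nu>. complex_of_real (cmod (w $ \<nu>))) k * mpow (\<chi> \<nu>. complex_of_real (cmod (h $ \<nu>))) k)) /
              cmod \<beta> ^ (j + 1)"
        unfolding of_real_sum sum_divide_distrib h_def[symmetric]
        by (rule sum.cong)
           (auto simp: norm_mult norm_divide norm_power mpow_def fantappie_weight_pos less_imp_le simp flip:
               prod_norm)
      also have "\<dots> = complex_of_real q ^ j / cmod \<beta> ^ (j + 1)"
        unfolding cdot_power[symmetric] by (simp add: cdot_def q_def)
      finally show ?thesis by (simp add: power_divide)
    qed
    then have "(\<Sum>k | mdeg k = j. cmod (?F k)) = (q / cmod \<beta>) ^ j / cmod \<beta>" for j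
      using of_real_eq_iff by blast
    then show "summable (\<lambda>j. \<Sum>k | mdeg k = j. cmod (?F k))"
      using q q0 \<beta> by (auto intro!: summable_divide summable_geometric)
  qed
  then show ?thesis
    unfolding has_taylor_expansion_def \<beta>_def using r by blast
qed

lemma analytic_in_subset: "analytic_in f D \<Longrightarrow> D' \<subseteq> D \<Longrightarrow> analytic_in f D'"
  by (auto simp: analytic_in_def)

lemma analytic_in_add: "analytic_in f D \<Longrightarrow> analytic_in g D \<Longrightarrow> analytic_in (\<lambda>z. f z + g z) D"
  unfolding analytic_in_def by (blast intro: has_taylor_expansion_add)

lemma analytic_in_mult: "analytic_in f D \<Longrightarrow> analytic_in g D \<Longrightarrow> analytic_in (\<lambda>z. f z * g z) D"
  unfolding analytic_in_def by (blast intro: has_taylor_expansion_mult)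

lemma analytic_in_const: "analytic_in (\<lambda>z. x) D"
proof -
  have "has_taylor_expansion (\<lambda>z. x) (\<lambda>k. if k \<in> {\<lambda>_. 0} then x else 0) a" for a :: "complex ^ 'a"
    using has_taylor_expansion_finite[of "{\<lambda>_. 0}" "\<lambda>_. x" a] by simp
  then show ?thesis unfolding analytic_in_def by blast
qed

lemma analytic_in_cmult: "analytic_in f D \<Longrightarrow> analytic_in (\<lambda>z. x * f z) D"
  by (rule analytic_in_mult[OF analytic_in_const])

lemma analytic_in_power: "analytic_in f D \<Longrightarrow> analytic_in (\<lambda>z. f z ^ m) D"
  by (induction m) (auto intro: analytic_in_const analytic_in_mult)

lemma analytic_in_sum:
  "(\<And>i. i \<in> I \<Longrightarrow> analytic_in (f i) D) \<Longrightarrow> analytic_in (\<lambda>z. \<Sum>i\<in>I. f i z) D"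
  by (induction I rule: infinite_finite_induct) (auto intro: analytic_in_const analytic_in_add)

lemma analytic_in_prod:
  "(\<And>i. i \<in> I \<Longrightarrow> analytic_in (f i) D) \<Longrightarrow> analytic_in (\<lambda>z. \<Prod>i\<in>I. f i z) D"
  by (induction I rule: infinite_finite_induct) (auto intro: analytic_in_const analytic_in_mult)

lemma mpow_unit: "mpow z ((\<lambda>_. 0)(\<nu> := 1)) = z $ \<nu>"
  unfolding mpow_def by (subst prod.remove[of _ \<nu>]) auto

lemma analytic_in_component: "analytic_in (\<lambda>z. z $ \<nu>) D"
  unfolding analytic_in_def
proof
  fix a :: "complex ^ 'a"
  show "\<exists>c. has_taylor_expansion (\<lambda>z. z $ \<nu>) c a"
    using has_taylor_expansion_add[OF has_taylor_expansion_finite[of "{(\<lambda>_. 0)(\<nu> := 1)}" "\<lambda>_. 1" a]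
        has_taylor_expansion_finite[of "{\<lambda>_. 0}" "\<lambda>_. a $ \<nu>" a]]
    by (auto simp: mpow_unit[unfolded One_nat_def])
qed

lemma analytic_in_mpow: "analytic_in (\<lambda>z. mpow z k) D"
  unfolding mpow_def by (intro analytic_in_prod analytic_in_power analytic_in_component)

lemma analytic_in_cdot: "analytic_in (\<lambda>z. cdot w z) D"
  unfolding cdot_def by (intro analytic_in_sum analytic_in_cmult analytic_in_component)

lemma analytic_in_inverse_affine:
  "(\<And>z. z \<in> D \<Longrightarrow> b - cdot w z \<noteq> 0) \<Longrightarrow> analytic_in (\<lambda>z. 1 / (b - cdot w z)) D"
  unfolding analytic_in_def by (blast intro: has_taylor_expansion_inverse_affine)

section \<open>Cauchy estimates\<close>

text \<open>The closed polydisc with equal radii.\<close>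

definition polydisc :: "complex ^ 'n \<Rightarrow> real \<Rightarrow> (complex ^ 'n::finite) set" where
  "polydisc a \<rho> = {z. \<forall>\<nu>. cmod (z $ \<nu> - a $ \<nu>) \<le> \<rho>}"

lemma polydisc_mono: "\<rho> \<le> r \<Longrightarrow> polydisc a \<rho> \<subseteq> polydisc a r"
  by (auto simp: polydisc_def intro: order_trans)

lemma taylor_expansion_along_line:
  fixes x b :: "complex ^ 'n::finite"
  assumes "has_taylor_expansion f c b"
  obtains e where "e > 0" "\<And>\<tau>. cmod \<tau> < e \<Longrightarrow>
    (\<lambda>j. (\<Sum>k | mdeg k = j. c k * mpow x k) * \<tau> ^ j) sums f (b + \<tau> *s x)"
proof -
  obtain r where r: "r > 0" "\<And>z. (\<And>\<nu>. cmod (z $ \<nu> - b $ \<nu>) < r) \<Longrightarrow>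
      ((\<lambda>k. c k * mpow (z - b) k) has_sum f z) UNIV"
    using assms unfolding has_taylor_expansion_def by blast
  define W where "W = 1 + (\<Sum>\<nu>\<in>UNIV. cmod (x $ \<nu>))"
  have W: "W > 0" unfolding W_def by (simp add: sum_nonneg add_pos_nonneg)
  have "(\<lambda>j. (\<Sum>k | mdeg k = j. c k * mpow x k) * \<tau> ^ j) sums f (b + \<tau> *s x)"
    if \<tau>: "cmod \<tau> < r / W" for \<tau>
  proof -
    have "cmod ((b + \<tau> *s x) $ \<nu> - b $ \<nu>) < r" for \<nu>
    proof -
      have "cmod (x $ \<nu>) \<le> (\<Sum>\<nu>\<in>UNIV. cmod (x $ \<nu>))"
        by (rule member_le_sum) auto
      then have "cmod \<tau> * cmod (x $ \<nu>) \<le> cmod \<tau> * W"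
        unfolding W_def by (intro mult_left_mono) auto
      also have "\<dots> < r" using \<tau> W by (simp add: field_simps)
      finally show ?thesis by (simp add: norm_mult)
    qed
    then have "((\<lambda>k. c k * mpow (\<tau> *s x) k) has_sum f (b + \<tau> *s x)) UNIV"
      using r(2)[of "b + \<tau> *s x"] by simp
    then have "(\<lambda>j. \<Sum>k | mdeg k = j. c k * mpow (\<tau> *s x) k) sums f (b + \<tau> *s x)"
      by (rule has_sum_imp_sums_mdeg)
    moreover have "(\<Sum>k | mdeg k = j. c k * mpow (\<tau> *s x) k) = (\<Sum>k | mdeg k = j. c k * mpow x k) * \<tau> ^ j" for j
      by (subst sum_distrib_right, rule sum.cong) (auto simp: mpow_scale)
    ultimately show ?thesis by simp
  qed
  then show ?thesis
    using that[of "r / W"] r W by simp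
qed

lemma holomorphic_along_line:
  assumes f: "analytic_in f D" and S: "\<And>\<tau>. \<tau> \<in> S \<Longrightarrow> a + \<tau> *s x \<in> D"
  shows "(\<lambda>\<tau>. f (a + \<tau> *s x)) holomorphic_on S"
proof (rule analytic_imp_holomorphic, subst analytic_on_analytic_at, intro ballI)
  fix \<tau>0 assume "\<tau>0 \<in> S"
  then obtain c where "has_taylor_expansion f c (a + \<tau>0 *s x)"
    using f S unfolding analytic_in_def by blast
  then obtain e where e: "e > 0" "\<And>\<tau>. cmod \<tau> < e \<Longrightarrow>
      (\<lambda>j. (\<Sum>k | mdeg k = j. c k * mpow x k) * \<tau> ^ j) sums f (a + \<tau>0 *s x + \<tau> *s x)"
    using taylor_expansion_along_line by blast
  have "(\<lambda>\<tau>. f (a + \<tau> *s x)) analytic_on ball \<tau>0 e"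
  proof (rule power_series_analytic)
    fix \<tau> assume "\<tau> \<in> ball \<tau>0 e"
    then show "(\<lambda>j. (\<Sum>k | mdeg k = j. c k * mpow x k) * (\<tau> - \<tau>0) ^ j) sums f (a + \<tau> *s x)"
      using e(2)[of "\<tau> - \<tau>0"]
      by (simp add: dist_norm norm_minus_commute vector_sub_rdistrib algebra_simps)
  qed
  then show "(\<lambda>\<tau>. f (a + \<tau> *s x)) analytic_on {\<tau>0}"
    using e(1) analytic_on_subset by fastforce
qed

lemma powser_eq_0_imp_coeff_0:
  fixes d :: "nat \<Rightarrow> complex"
  assumes e: "e > 0" and sums: "\<And>\<tau>. cmod \<tau> < e \<Longrightarrow> (\<lambda>j. d j * \<tau> ^ j) sums 0"
  shows "d j = 0"
proof (rule ccontr)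
  assume j: "d j \<noteq> 0"
  have "d 0 = 0"
    using sums[of 0] e powser_sums_zero[of d] sums_unique2 by fastforce
  with j have "j > 0" by (metis gr0I)
  show False
  proof (rule powser_0_nonzero[of e 0 d "\<lambda>_. 0" j])
    fix s :: real assume s: "0 < s" "\<And>z :: complex. z \<in> cball 0 s - {0} \<Longrightarrow> (0::complex) \<noteq> 0"
    show False using s(2)[of "complex_of_real s"] s(1) by simp
  qed (use e sums j \<open>j > 0\<close> in auto)
qed

text \<open>The homogeneous parts of the Taylor series are the Taylor coefficients of the restrictions of
  \<open>f\<close> to complex lines through \<open>a\<close>, so the Cauchy inequality in one variable applies.  The
  polydisc need only lie in \<open>D\<close>, not in the domain of convergence of the series at \<open>a\<close>.\<close>

lemma homogeneous_part_bound:
  fixes x :: "complex ^ 'n::finite"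
  assumes f: "analytic_in f D" and c: "has_taylor_expansion f c a"
    and \<rho>: "polydisc a \<rho> \<subseteq> D" and M: "\<And>z. z \<in> polydisc a \<rho> \<Longrightarrow> cmod (f z) \<le> M"
    and x: "\<And>\<nu>. cmod (x $ \<nu>) \<le> \<rho>"
  shows "cmod (\<Sum>k | mdeg k = j. c k * mpow x k) \<le> M"
proof -
  define g where "g = (\<lambda>\<tau>. f (a + \<tau> *s x))"
  have line: "a + \<tau> *s x \<in> polydisc a \<rho>" if "\<tau> \<in> cball 0 1" for \<tau>
    using that mult_mono[of "cmod \<tau>" 1 "cmod (x $ \<nu>)" \<rho> for \<nu>] x
    by (auto simp: polydisc_def norm_mult intro: order_trans)
  have g: "g holomorphic_on cball 0 1"
    unfolding g_def using line \<rho> by (intro holomorphic_along_line[OF f]) blast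
  then have g': "g holomorphic_on ball 0 1"
    by (rule holomorphic_on_subset) auto
  have deriv_bound: "cmod ((deriv ^^ j) g 0) \<le> fact j * M / 1 ^ j"
  proof (rule Cauchy_inequality[OF g'])
    show "continuous_on (cball 0 1) g" using g by (rule holomorphic_on_imp_continuous_on)
    show "cmod (g \<tau>) \<le> M" if "cmod (0 - \<tau>) = 1" for \<tau>
      unfolding g_def using that by (intro M line) simp
  qed simp
  obtain e where e: "e > 0" "\<And>\<tau>. cmod \<tau> < e \<Longrightarrow>
      (\<lambda>j. (\<Sum>k | mdeg k = j. c k * mpow x k) * \<tau> ^ j) sums g \<tau>"
    using taylor_expansion_along_line[OF c] unfolding g_def by blast
  have "(\<lambda>j. ((\<Sum>k | mdeg k = j. c k * mpow x k) - (deriv ^^ j) g 0 / fact j) * \<tau> ^ j) sums 0"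
    if "cmod \<tau> < min e 1" for \<tau>
    using sums_diff[OF e(2)[of \<tau>] holomorphic_power_series[OF g', of \<tau>]] that
    by (simp add: algebra_simps)
  from powser_eq_0_imp_coeff_0[of "min e 1", OF _ this, of j] e(1)
  have "(\<Sum>k | mdeg k = j. c k * mpow x k) = (deriv ^^ j) g 0 / fact j"
    by simp
  then show ?thesis
    using divide_right_mono[OF deriv_bound, of "fact j"] by (simp add: norm_divide)
qed

text \<open>Averaging a homogeneous polynomial of degree \<open>j\<close> over the products of \<open>(j + 1)\<close>-th
  roots of unity isolates a single coefficient.\<close>

lemma homogeneous_coeff_bound:
  fixes c :: "'n::finite multiindex \<Rightarrow> complex"
  assumes \<rho>: "\<rho> > 0" and k: "mdeg k = j"
    and M: "\<And>x. (\<And>\<nu>. cmod (x $ \<nu>) \<le> \<rho>) \<Longrightarrow> cmod (\<Sum>l | mdeg l = j. c l * mpow x l) \<le> M"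
  shows "cmod (c k) * \<rho> ^ j \<le> M"
proof -
  define N where "N = Suc j"
  define \<zeta> where "\<zeta> = exp (2 * complex_of_real pi * \<i> / of_nat N)"
  have norm_\<zeta>: "cmod \<zeta> = 1" by (simp add: \<zeta>_def)
  have \<zeta>_power: "\<zeta> ^ m = exp (2 * complex_of_real pi * \<i> * of_nat m / of_nat N)" for m
    by (simp add: \<zeta>_def exp_of_nat_mult[symmetric] algebra_simps)
  have root1: "\<zeta> ^ m = 1 \<longleftrightarrow> N dvd m" for m
    unfolding \<zeta>_power by (rule complex_root_unity_eq_1) (simp add: N_def)
  define T where "T = Pi\<^sub>E (UNIV :: 'n set) (\<lambda>_. {..<N})"
  define X where "X t = (\<chi> \<nu>. complex_of_real \<rho> * \<zeta> ^ t \<nu>)" for t :: "'n \<Rightarrow> nat"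
  define u where "u t = (\<Prod>\<nu>\<in>UNIV. \<zeta> ^ (t \<nu> * (N - k \<nu>)))" for t
  have kN: "k \<nu> < N" for \<nu>
    using mdeg_ge[of k \<nu>] k by (simp add: N_def)
  have cardT: "card T = N ^ CARD('n)"
    by (simp add: T_def card_PiE)
  have orth: "(\<Sum>t\<in>T. u t * mpow (X t) l) = (if l = k then of_nat (card T) * complex_of_real \<rho> ^ j else 0)"
    if l: "mdeg l = j" for l
  proof -
    have lN: "l \<nu> < N" for \<nu>
      using mdeg_ge[of l \<nu>] l by (simp add: N_def)
    have "u t * mpow (X t) l = complex_of_real \<rho> ^ j * (\<Prod>\<nu>\<in>UNIV. (\<zeta> ^ (l \<nu> + (N - k \<nu>))) ^ t \<nu>)" for t
    proof -
      have "mpow (X t) l = complex_of_real \<rho> ^ j * (\<Prod>\<nu>\<in>UNIV. \<zeta> ^ (t \<nu> * l \<nu>))"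
        using l by (simp add: mpow_def X_def power_mult_distrib prod.distrib power_mult mdeg_def flip:
            power_sum)
      then show ?thesis
        by (simp add: u_def algebra_simps flip: prod.distrib power_add power_mult)
    qed
    then have "(\<Sum>t\<in>T. u t * mpow (X t) l) =
        complex_of_real \<rho> ^ j * (\<Sum>t\<in>T. \<Prod>\<nu>\<in>UNIV. (\<zeta> ^ (l \<nu> + (N - k \<nu>))) ^ t \<nu>)"
      by (simp add: sum_distrib_left)
    also have "(\<Sum>t\<in>T. \<Prod>\<nu>\<in>UNIV. (\<zeta> ^ (l \<nu> + (N - k \<nu>))) ^ t \<nu>) =
        (\<Prod>\<nu>\<in>UNIV. \<Sum>i<N. (\<zeta> ^ (l \<nu> + (N - k \<nu>))) ^ i)"
      unfolding T_def by (subst prod_sum_PiE) auto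
    also have "\<dots> = (\<Prod>\<nu>\<in>UNIV. if l \<nu> = k \<nu> then of_nat N else 0)"
    proof (rule prod.cong[OF refl])
      fix \<nu>
      let ?\<omega> = "\<zeta> ^ (l \<nu> + (N - k \<nu>))"
      show "(\<Sum>i<N. ?\<omega> ^ i) = (if l \<nu> = k \<nu> then of_nat N else 0)"
      proof (cases "l \<nu> = k \<nu>")
        case True
        then have "?\<omega> = 1" using root1[of N] kN[of \<nu>] by simp
        then show ?thesis using True by simp
      next
        case False
        have "\<not> N dvd l \<nu> + (N - k \<nu>)"
        proof
          assume "N dvd l \<nu> + (N - k \<nu>)"
          then obtain m where m: "l \<nu> + (N - k \<nu>) = N * m" by blast
          have "0 < N * m" "N * m < N * 2" using lN[of \<nu>] kN[of \<nu>] m by linarith+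
          then have "m = 1" by simp
          then show False using m False kN[of \<nu>] by simp
        qed
        then have "?\<omega> \<noteq> 1" using root1 by blast
        moreover have "?\<omega> ^ N = 1"
          using root1[of "(l \<nu> + (N - k \<nu>)) * N"] by (simp add: power_mult)
        ultimately show ?thesis using False by (simp add: geometric_sum)
      qed
    qed
    also have "\<dots> = (if l = k then of_nat (card T) else 0)"
    proof (cases "l = k")
      case False
      then obtain \<nu> where "l \<nu> \<noteq> k \<nu>" by auto
      then show ?thesis using False by (auto intro!: prod_zero)
    qed (simp add: cardT)
    finally show ?thesis by simp
  qed
  have "of_nat (card T) * (c k * complex_of_real \<rho> ^ j) =
      (\<Sum>l | mdeg l = j. c l * (\<Sum>t\<in>T. u t * mpow (X t) l))"
    using k by (simp add: orth if_distrib[of "(*) _"] sum.delta cong: if_cong)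
  also have "\<dots> = (\<Sum>t\<in>T. u t * (\<Sum>l | mdeg l = j. c l * mpow (X t) l))"
    unfolding sum_distrib_left by (subst sum.swap) (simp add: algebra_simps)
  finally have "cmod (of_nat (card T) * (c k * complex_of_real \<rho> ^ j)) =
      cmod (\<Sum>t\<in>T. u t * (\<Sum>l | mdeg l = j. c l * mpow (X t) l))"
    by simp
  also have "\<dots> \<le> of_nat (card T) * M"
  proof (rule sum_norm_bound)
    fix t
    have "cmod (u t) = 1" by (simp add: u_def norm_power norm_\<zeta> flip: prod_norm)
    moreover have "cmod (\<Sum>l | mdeg l = j. c l * mpow (X t) l) \<le> M"
      using \<rho> by (intro M) (simp add: X_def norm_mult norm_power norm_\<zeta>)
    ultimately show "cmod (u t * (\<Sum>l | mdeg l = j. c l * mpow (X t) l)) \<le> M"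
      by (simp add: norm_mult)
  qed
  finally have "real (card T) * (cmod (c k) * \<rho> ^ j) \<le> real (card T) * M"
    using \<rho> by (simp add: norm_mult norm_power)
  moreover have "real (card T) > 0"
    unfolding cardT by (simp add: N_def)
  ultimately show ?thesis
    by (rule mult_left_le_imp_le)
qed

lemma taylor_coeff_bound:
  assumes "analytic_in f D" "has_taylor_expansion f c a"
    and "\<rho> > 0" "polydisc a \<rho> \<subseteq> D" and "\<And>z. z \<in> polydisc a \<rho> \<Longrightarrow> cmod (f z) \<le> M"
  shows "cmod (c k) * \<rho> ^ mdeg k \<le> M"
  by (rule homogeneous_coeff_bound[OF assms(3) refl])
     (rule homogeneous_part_bound[OF assms(1,2,4,5)])

lemma has_taylor_expansion_unique:
  assumes "has_taylor_expansion f c a" "has_taylor_expansion f c' a"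
  shows "c = c'"
proof
  fix k
  have "has_taylor_expansion (\<lambda>z. 0) (\<lambda>k. c k - c' k) a"
    using has_taylor_expansion_add[OF assms(1) has_taylor_expansion_cmult[OF assms(2), of "-1"]] by simp
  then have "cmod (c k - c' k) * 1 ^ mdeg k \<le> 0"
    by (intro taylor_coeff_bound[OF analytic_in_const[of 0 UNIV]]) auto
  then show "c k = c' k" by simp
qed

text \<open>The Taylor coefficients at \<open>a\<close>; arbitrary when \<open>f\<close> has no Taylor expansion there.\<close>

definition taylor_coeff ::
    "(complex ^ 'n::finite \<Rightarrow> complex) \<Rightarrow> complex ^ 'n \<Rightarrow> 'n multiindex \<Rightarrow> complex" where
  "taylor_coeff f a = (THE c. has_taylor_expansion f c a)"

lemma taylor_coeffI: "has_taylor_expansion f c a \<Longrightarrow> taylor_coeff f a = c"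
  unfolding taylor_coeff_def by (rule the_equality) (auto dest: has_taylor_expansion_unique)

lemma has_taylor_expansion_taylor_coeff:
  "analytic_in f D \<Longrightarrow> a \<in> D \<Longrightarrow> has_taylor_expansion f (taylor_coeff f a) a"
  by (auto simp: analytic_in_def dest: taylor_coeffI)

text \<open>Taylor coefficients below the order of vanishing are zero.\<close>

lemma taylor_coeff_eq_0_of_order:
  assumes f: "analytic_in f D" "has_taylor_expansion f c a"
    and r: "r > 0" "polydisc a r \<subseteq> D"
    and bound: "\<And>\<rho> z. 0 < \<rho> \<Longrightarrow> \<rho> \<le> r \<Longrightarrow> z \<in> polydisc a \<rho> \<Longrightarrow> cmod (f z) \<le> C * \<rho> ^ N"
    and k: "mdeg k < N"
  shows "c k = 0"
proof (rule ccontr)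
  assume "c k \<noteq> 0"
  define m where "m = N - mdeg k"
  have m: "m > 0" "N = mdeg k + m" using k by (auto simp: m_def)
  have "cmod (c k) \<le> C * \<rho> ^ m" if \<rho>: "0 < \<rho>" "\<rho> \<le> r" for \<rho>
  proof -
    have "polydisc a \<rho> \<subseteq> D" using polydisc_mono[OF \<rho>(2)] r(2) by blast
    then have "cmod (c k) * \<rho> ^ mdeg k \<le> C * \<rho> ^ N"
      using \<rho> by (intro taylor_coeff_bound[OF f]) (auto intro: bound)
    then show ?thesis using \<rho> m by (simp add: power_add field_simps)
  qed
  then have "eventually (\<lambda>\<rho>. cmod (c k) \<le> C * \<rho> ^ m) (at_right 0)"
    using r(1) by (auto simp: eventually_at_right_field intro!: exI[of _ r])
  moreover have "((\<lambda>\<rho>::real. C * \<rho> ^ m) \<longlongrightarrow> C * 0 ^ m) (at_right 0)"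
    by (intro tendsto_intros)
  ultimately have "cmod (c k) \<le> C * 0 ^ m"
    by (intro tendsto_lowerbound) auto
  with m \<open>c k \<noteq> 0\<close> show False by (simp add: power_0_left)
qed

lemma compact_polydisc: "compact (polydisc a \<rho>)"
proof -
  have "bounded (polydisc a \<rho>)"
  proof (rule boundedI)
    fix z assume "z \<in> polydisc a \<rho>"
    then have "norm (z - a) \<le> (\<Sum>\<nu>\<in>(UNIV :: 'a set). \<rho>)"
      unfolding polydisc_def by (intro order_trans[OF norm_le_sum_components] sum_mono) auto
    then show "norm z \<le> norm a + (\<Sum>\<nu>\<in>(UNIV :: 'a set). \<rho>)"
      using norm_triangle_sub[of z a] by linarith
  qed
  moreover have "closed (polydisc a \<rho>)"
    unfolding polydisc_def Collect_all_eq
    by (intro closed_INT ballI closed_Collect_le continuous_intros)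
  ultimately show ?thesis by (simp add: compact_eq_bounded_closed)
qed

lemma polydisc_in_open:
  fixes V :: "(complex ^ 'n::finite) set"
  assumes "open V" "a \<in> V"
  obtains \<rho> where "\<rho> > 0" "polydisc a \<rho> \<subseteq> V"
proof -
  obtain r where r: "r > 0" "\<And>z. (\<And>\<nu>. cmod (z $ \<nu> - a $ \<nu>) < r) \<Longrightarrow> z \<in> V"
    using polydisc_subset_open[OF assms] by blast
  have "polydisc a (r / 2) \<subseteq> V"
  proof
    fix z assume "z \<in> polydisc a (r / 2)"
    then have "cmod (z $ \<nu> - a $ \<nu>) \<le> r / 2" for \<nu> unfolding polydisc_def by blast
    then have "cmod (z $ \<nu> - a $ \<nu>) < r" for \<nu>
      using r(1) by (smt (verit) field_sum_of_halves)
    then show "z \<in> V" by (rule r(2))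
  qed
  with r(1) that[of "r / 2"] show ?thesis by simp
qed

section \<open>The spaces of analytic functions and their functionals\<close>

lemma has_taylor_expansion_isCont:
  fixes f :: "complex ^ 'n::finite \<Rightarrow> complex"
  assumes "has_taylor_expansion f c a"
  shows "isCont f a"
proof -
  obtain r where r: "r > 0" "\<And>z. (\<And>\<nu>. cmod (z $ \<nu> - a $ \<nu>) < r) \<Longrightarrow>
      ((\<lambda>k. c k * mpow (z - a) k) has_sum f z) UNIV"
    using assms unfolding has_taylor_expansion_def by blast
  \<comment> \<open>The series converges absolutely at the point of the distinguished boundary with radius
    \<open>\<rho>\<close>; shrinking that radius by a factor \<open>t\<close> gains at least a factor \<open>t\<close> in each
    nonconstant term.\<close>
  define \<rho> where "\<rho> = r / 2"
  have \<rho>: "\<rho> > 0" "\<rho> < r" using r by (auto simp: \<rho>_def)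
  have "((\<lambda>k. c k * mpow ((a + (\<chi> \<nu>. complex_of_real \<rho>)) - a) k) has_sum f (a + (\<chi> \<nu>. complex_of_real \<rho>))) UNIV"
    using \<rho> by (intro r(2)) simp
  then have "(\<lambda>k. c k * complex_of_real \<rho> ^ mdeg k) summable_on UNIV"
    using has_sum_imp_summable by (fastforce simp: mpow_def mdeg_def power_sum)
  then have "(\<lambda>k. cmod (c k * complex_of_real \<rho> ^ mdeg k)) summable_on UNIV"
    by (subst (asm) summable_on_iff_abs_summable_on_complex)
  then have summ: "(\<lambda>k. cmod (c k) * \<rho> ^ mdeg k) summable_on UNIV"
    using \<rho> by (simp add: norm_mult norm_power)
  define S where "S = (\<Sum>\<^sub>\<infinity>k. cmod (c k) * \<rho> ^ mdeg k)"
  have S: "S \<ge> 0" unfolding S_def using \<rho> by (intro infsum_nonneg) auto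
  have S_sum: "((\<lambda>k. cmod (c k) * \<rho> ^ mdeg k) has_sum S) UNIV"
    unfolding S_def by (rule has_sum_infsum[OF summ])
  have c0: "((\<lambda>k. c k * mpow (a - a) k) has_sum f a) UNIV"
    using r by (intro r(2)) auto
  have est: "cmod (f z - f a) \<le> t * S" if t: "0 \<le> t" "t \<le> 1" "\<And>\<nu>. cmod (z $ \<nu> - a $ \<nu>) \<le> t * \<rho>" for z t
  proof -
    have small: "cmod (z $ \<nu> - a $ \<nu>) < r" for \<nu>
      using t(3)[of \<nu>] mult_right_mono[of t 1 \<rho>] t(2) \<rho> by linarith
    have "((\<lambda>k. c k * mpow (z - a) k - c k * mpow (a - a) k) has_sum (f z - f a)) UNIV"
      using has_sum_add[OF r(2)[OF small] has_sum_cmult_right[OF c0, of "-1"]] by simp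
    moreover have "((\<lambda>k. t * (cmod (c k) * \<rho> ^ mdeg k)) has_sum (t * S)) UNIV"
      by (rule has_sum_cmult_right[OF S_sum])
    moreover have "cmod (c k * mpow (z - a) k - c k * mpow (a - a) k) \<le> t * (cmod (c k) * \<rho> ^ mdeg k)" for k
    proof (cases "mdeg k = 0")
      case True
      then show ?thesis using t \<rho> by (simp add: mdeg_0_iff)
    next
      case False
      then obtain m where m: "mdeg k = Suc m" by (cases "mdeg k") auto
      have "cmod (mpow (a - a) k) \<le> 0 ^ mdeg k" by (rule norm_mpow_le) simp
      then have "mpow (a - a) k = 0" using m by simp
      moreover have "cmod (mpow (z - a) k) \<le> (t * \<rho>) ^ mdeg k"
        by (rule norm_mpow_le) (use t in auto)
      moreover have "(t * \<rho>) ^ mdeg k \<le> t * \<rho> ^ mdeg k"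
      proof -
        have "t ^ m * \<rho> ^ mdeg k \<le> 1 * \<rho> ^ mdeg k"
          using t \<rho> by (intro mult_right_mono power_le_one) auto
        then have "t * (t ^ m * \<rho> ^ mdeg k) \<le> t * \<rho> ^ mdeg k"
          using t by (intro mult_left_mono) auto
        then show ?thesis by (simp add: power_mult_distrib m mult_ac)
      qed
      ultimately have "cmod (mpow (z - a) k) \<le> t * \<rho> ^ mdeg k" "mpow (a - a) k = 0"
        by linarith+
      then show ?thesis
        using mult_left_mono[of "cmod (mpow (z - a) k)" "t * \<rho> ^ mdeg k" "cmod (c k)"]
        by (simp add: norm_mult mult.left_commute)
    qed
    ultimately show ?thesis
      by (rule norm_infsum_le)
  qed
  show ?thesis
    unfolding continuous_at_eps_delta
  proof (intro allI impI)
    fix e :: real assume e: "e > 0"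
    define t where "t = min 1 (e / (2 * (S + 1)))"
    have t: "0 < t" "t \<le> 1" "t * S < e"
    proof -
      show "0 < t" "t \<le> 1" using e S by (auto simp: t_def)
      have "t * S \<le> e / (2 * (S + 1)) * S" using S by (intro mult_right_mono) (auto simp: t_def)
      also have "\<dots> < e" using S e by (simp add: field_simps add_nonneg_pos)
      finally show "t * S < e" .
    qed
    show "\<exists>d>0. \<forall>z. dist z a < d \<longrightarrow> dist (f z) (f a) < e"
    proof (intro exI[of _ "t * \<rho>"] conjI allI impI)
      show "t * \<rho> > 0" using t \<rho> by simp
      fix z assume z: "dist z a < t * \<rho>"
      have "cmod (z $ \<nu> - a $ \<nu>) \<le> t * \<rho>" for \<nu>
        using z Finite_Cartesian_Product.norm_nth_le[of "z - a" \<nu>] by (simp add: dist_norm)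
      from est[OF _ _ this] t show "dist (f z) (f a) < e" by (simp add: dist_norm)
    qed
  qed
qed

lemma analytic_in_continuous_on: "analytic_in f D \<Longrightarrow> continuous_on D f"
  unfolding analytic_in_def
  by (intro continuous_at_imp_continuous_on ballI) (blast intro: has_taylor_expansion_isCont)

lemma norm_le_sup_norm_on:
  assumes "analytic_in f D" "compact L" "L \<subseteq> D" "z \<in> L"
  shows "cmod (f z) \<le> sup_norm_on L f"
  unfolding sup_norm_on_def
proof (rule cSUP_upper[OF assms(4)])
  have "continuous_on L (\<lambda>z. cmod (f z))"
    using analytic_in_continuous_on[OF assms(1)] assms(3)
    by (intro continuous_on_norm) (rule continuous_on_subset)
  then show "bdd_above ((\<lambda>z. cmod (f z)) ` L)"
    by (intro bounded_imp_bdd_above compact_imp_bounded compact_continuous_image assms)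
qed

lemma sup_norm_on_le: "L \<noteq> {} \<Longrightarrow> (\<And>z. z \<in> L \<Longrightarrow> cmod (f z) \<le> M) \<Longrightarrow> sup_norm_on L f \<le> M"
  unfolding sup_norm_on_def by (rule cSUP_least)

lemma hol_space_zero: "(\<lambda>z. 0) \<in> hol_space D"
  by (simp add: hol_space_def analytic_in_const)

lemma hol_space_add: "f \<in> hol_space D \<Longrightarrow> g \<in> hol_space D \<Longrightarrow> (\<lambda>z. f z + g z) \<in> hol_space D"
  by (simp add: hol_space_def analytic_in_add)

lemma hol_space_cmult: "f \<in> hol_space D \<Longrightarrow> (\<lambda>z. x * f z) \<in> hol_space D"
  by (simp add: hol_space_def analytic_in_cmult)

lemma hol_space_diff: "f \<in> hol_space D \<Longrightarrow> g \<in> hol_space D \<Longrightarrow> (\<lambda>z. f z - g z) \<in> hol_space D"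
  using hol_space_add[OF _ hol_space_cmult[of g D "-1"]] by simp

text \<open>Restriction to \<open>D\<close>, extended by zero as required of the elements of \<^const>\<open>hol_space\<close>.\<close>

definition restrict0 :: "'a set \<Rightarrow> ('a \<Rightarrow> complex) \<Rightarrow> 'a \<Rightarrow> complex" where
  "restrict0 D f = (\<lambda>z. if z \<in> D then f z else 0)"

lemma has_taylor_expansion_restrict0:
  "open D \<Longrightarrow> a \<in> D \<Longrightarrow> has_taylor_expansion f c a \<Longrightarrow> has_taylor_expansion (restrict0 D f) c a"
  by (rule has_taylor_expansion_cong[of _ _ _ D]) (auto simp: restrict0_def)

lemma restrict0_hol_space: "open D \<Longrightarrow> analytic_in f D \<Longrightarrow> restrict0 D f \<in> hol_space D"
  unfolding hol_space_def analytic_in_def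
  by (fastforce intro: has_taylor_expansion_restrict0 simp: restrict0_def[abs_def])

lemma topspace_hol_topology:
  assumes "D \<noteq> {}"
  shows "topspace (hol_topology D) = hol_space D"
proof -
  obtain z where z: "z \<in> D" using assms by blast
  have "f \<in> \<Union>{{g \<in> hol_space D. sup_norm_on L (\<lambda>z. g z - f z) < \<epsilon>} | f L \<epsilon>.
        f \<in> hol_space D \<and> compact L \<and> L \<noteq> {} \<and> L \<subseteq> D \<and> \<epsilon> > 0}" if "f \<in> hol_space D" for f
    using that z
    by (intro UnionI[of "{g \<in> hol_space D. sup_norm_on {z} (\<lambda>z. g z - f z) < 1}"] CollectI exI[of _ f]
        exI[of _ "{z}"] exI[of _ 1])
       (auto simp: sup_norm_on_def)
  then show ?thesis
    unfolding hol_topology_def topology_generated_by_topspace by blast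
qed

lemma taylor_coeff_hol_space:
  "f \<in> hol_space D \<Longrightarrow> a \<in> D \<Longrightarrow> has_taylor_expansion f (taylor_coeff f a) a"
  by (auto simp: hol_space_def intro: has_taylor_expansion_taylor_coeff)

text \<open>The functional on \<open>A(D)\<close> that pairs the Taylor coefficients at \<open>a\<close>, divided by the
  multinomial weights, with the coefficients \<open>p\<close> of a polynomial supported on \<open>S\<close>.\<close>

definition taylor_functional ::
    "(complex ^ 'n::finite) set \<Rightarrow> complex ^ 'n \<Rightarrow> 'n multiindex set \<Rightarrow> ('n multiindex \<Rightarrow> complex) \<Rightarrow>
     (complex ^ 'n \<Rightarrow> complex) \<Rightarrow> complex" where
  "taylor_functional D a S p f =
     (if f \<in> hol_space D
      then \<Sum>k\<in>S. p k * (taylor_coeff f a k / complex_of_real (fantappie_weight 1 k)) else 0)"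

lemma centre_in_polydisc: "\<rho> \<ge> 0 \<Longrightarrow> a \<in> polydisc a \<rho>"
  by (simp add: polydisc_def)

lemma taylor_functional_bound:
  fixes D :: "(complex ^ 'n::finite) set"
  assumes \<rho>: "\<rho> > 0" "polydisc a \<rho> \<subseteq> D"
  obtains C where "C \<ge> 0" "\<And>f. f \<in> hol_space D \<Longrightarrow> cmod (taylor_functional D a S p f) \<le> C *
      sup_norm_on (polydisc a \<rho>) f"
proof
  let ?C = "\<Sum>k\<in>S. cmod (p k) / fantappie_weight 1 k / \<rho> ^ mdeg k"
  show "?C \<ge> 0" using \<rho> by (intro sum_nonneg) (simp add: fantappie_weight_pos less_imp_le)
  fix f assume f: "f \<in> hol_space D"
  have a: "a \<in> D" using \<rho> centre_in_polydisc[of \<rho> a] by auto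
  have "cmod (taylor_functional D a S p f) \<le>
      (\<Sum>k\<in>S. cmod (p k * (taylor_coeff f a k / complex_of_real (fantappie_weight 1 k))))"
    using f by (auto simp: taylor_functional_def intro: norm_sum)
  also have "\<dots> \<le> (\<Sum>k\<in>S. cmod (p k) / fantappie_weight 1 k / \<rho> ^ mdeg k * sup_norm_on (polydisc a \<rho>) f)"
  proof (rule sum_mono)
    fix k
    have "cmod (taylor_coeff f a k) * \<rho> ^ mdeg k \<le> sup_norm_on (polydisc a \<rho>) f"
      using f a \<rho> by (intro taylor_coeff_bound[of f D _ a] taylor_coeff_hol_space norm_le_sup_norm_on[of f D])
        (auto simp: hol_space_def compact_polydisc)
    then have "cmod (taylor_coeff f a k) \<le> sup_norm_on (polydisc a \<rho>) f / \<rho> ^ mdeg k"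
      using \<rho> by (simp add: field_simps)
    then have "(cmod (p k) / fantappie_weight 1 k) * cmod (taylor_coeff f a k) \<le>
        (cmod (p k) / fantappie_weight 1 k) * (sup_norm_on (polydisc a \<rho>) f / \<rho> ^ mdeg k)"
      by (rule mult_left_mono) (simp add: fantappie_weight_pos less_imp_le)
    then show "cmod (p k * (taylor_coeff f a k / complex_of_real (fantappie_weight 1 k))) \<le>
        cmod (p k) / fantappie_weight 1 k / \<rho> ^ mdeg k * sup_norm_on (polydisc a \<rho>) f"
      using fantappie_weight_pos[of 1 k] by (simp add: norm_mult norm_divide field_simps)
  qed
  finally show "cmod (taylor_functional D a S p f) \<le> ?C * sup_norm_on (polydisc a \<rho>) f"
    by (simp add: sum_distrib_right)
qed

lemma taylor_functional_hol_dual: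
  fixes D :: "(complex ^ 'n::finite) set"
  assumes "open D" "a \<in> D"
  shows "taylor_functional D a S p \<in> hol_dual D"
proof -
  let ?F = "taylor_functional D a S p"
  obtain \<rho> where \<rho>: "\<rho> > 0" "polydisc a \<rho> \<subseteq> D"
    using polydisc_in_open[OF assms] by blast
  obtain C where C: "C \<ge> 0" "\<And>f. f \<in> hol_space D \<Longrightarrow> cmod (?F f) \<le> C * sup_norm_on (polydisc a \<rho>) f"
    using taylor_functional_bound[OF \<rho>, of S p] by blast
  have add: "?F (\<lambda>z. f z + g z) = ?F f + ?F g" if "f \<in> hol_space D" "g \<in> hol_space D" for f g
  proof -
    have "taylor_coeff (\<lambda>z. f z + g z) a = (\<lambda>k. taylor_coeff f a k + taylor_coeff g a k)"
      using that assms by (intro taylor_coeffI has_taylor_expansion_add taylor_coeff_hol_space)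
    then show ?thesis using that
      by (simp add: taylor_functional_def hol_space_add add_divide_distrib distrib_left sum.distrib)
  qed
  have cmult: "?F (\<lambda>z. x * f z) = x * ?F f" if "f \<in> hol_space D" for f x
  proof -
    have "taylor_coeff (\<lambda>z. x * f z) a = (\<lambda>k. x * taylor_coeff f a k)"
      using that assms by (intro taylor_coeffI has_taylor_expansion_cmult taylor_coeff_hol_space)
    then show ?thesis using that
      by (simp add: taylor_functional_def hol_space_cmult sum_distrib_left mult.left_commute)
  qed
  have top: "topspace (hol_topology D) = hol_space D"
    using assms by (intro topspace_hol_topology) auto
  have "continuous_map (hol_topology D) euclidean ?F"
    unfolding continuous_map_def top
  proof (intro conjI allI impI)
    fix V :: "complex set" assume "openin euclidean V"
    then have V: "open V" by simp
    show "openin (hol_topology D) {f \<in> hol_space D. ?F f \<in> V}"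
    proof (subst openin_subopen, intro ballI)
      fix f assume "f \<in> {f \<in> hol_space D. ?F f \<in> V}"
      then have f: "f \<in> hol_space D" "?F f \<in> V" by auto
      obtain e where e: "e > 0" "ball (?F f) e \<subseteq> V" using V f(2) by (meson openE)
      define T where "T = {g \<in> hol_space D. sup_norm_on (polydisc a \<rho>) (\<lambda>z. g z - f z) < e / (C + 1)}"
      have ne: "polydisc a \<rho> \<noteq> {}" using \<rho>(1) centre_in_polydisc[of \<rho> a] by auto
      have "e / (C + 1) > 0" using e C by simp
      then have "openin (hol_topology D) T"
        unfolding hol_topology_def T_def using f(1) \<rho>(2) ne compact_polydisc[of a \<rho>]
        by (intro topology_generated_by_Basis CollectI exI[of _ f] exI[of _ "polydisc a \<rho>"]
            exI[of _ "e / (C + 1)"] conjI refl)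
      moreover have "f \<in> T"
        using f ne e C by (auto simp: T_def sup_norm_on_def)
      moreover have "T \<subseteq> {f \<in> hol_space D. ?F f \<in> V}"
      proof
        fix g assume g: "g \<in> T"
        then have gD: "g \<in> hol_space D" by (simp add: T_def)
        have "?F g - ?F f = ?F (\<lambda>z. g z - f z)"
          using add[OF gD hol_space_cmult[OF f(1), of "-1"]] cmult[OF f(1), of "-1"] by simp
        then have "cmod (?F g - ?F f) \<le> C * sup_norm_on (polydisc a \<rho>) (\<lambda>z. g z - f z)"
          using C(2)[OF hol_space_diff[OF gD f(1)]] by simp
        also have "\<dots> \<le> C * (e / (C + 1))"
          using g C by (intro mult_left_mono) (auto simp: T_def)
        also have "\<dots> < e" using C e by (simp add: field_simps)
        finally have "?F g \<in> ball (?F f) e" by (simp add: dist_norm norm_minus_commute)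
        then show "g \<in> {f \<in> hol_space D. ?F f \<in> V}" using gD e by blast
      qed
      ultimately show "\<exists>T. openin (hol_topology D) T \<and> f \<in> T \<and> T \<subseteq> {f \<in> hol_space D. ?F f \<in> V}"
        by blast
    qed
  qed simp
  then show ?thesis
    using add cmult by (auto simp: hol_dual_def taylor_functional_def)
qed

lemma sum_mdeg_le:
  fixes F :: "'n::finite multiindex \<Rightarrow> 'b::comm_monoid_add"
  shows "(\<Sum>k | mdeg k \<le> J. F k) = (\<Sum>j\<le>J. \<Sum>k | mdeg k = j. F k)"
proof -
  have "(\<Sum>k | mdeg k \<le> J. F k) = (\<Sum>j\<in>{..J}. sum F {k \<in> {k. mdeg k \<le> J}. mdeg k = j})"
    by (rule sum.group[symmetric]) (auto intro: finite_mdeg_le)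
  also have "\<dots> = (\<Sum>j\<le>J. \<Sum>k | mdeg k = j. F k)"
    by (intro sum.cong) auto
  finally show ?thesis .
qed

lemma cdot_diff_right: "cdot w (x - y) = cdot w x - cdot w y"
  by (simp add: cdot_def sum_subtractf algebra_simps)

lemma cdot_add_left: "cdot (w + x) z = cdot w z + cdot x z"
  by (simp add: cdot_def sum.distrib algebra_simps)

lemma cdot_add_right: "cdot w (x + z) = cdot w x + cdot w z"
  by (simp add: cdot_def sum.distrib algebra_simps)

lemma norm_cdot_le:
  assumes "\<And>\<nu>. cmod (h $ \<nu>) \<le> r"
  shows "cmod (cdot w h) \<le> (\<Sum>\<nu>\<in>UNIV. cmod (w $ \<nu>)) * r"
  unfolding cdot_def sum_distrib_right
  by (rule order_trans[OF norm_sum], intro sum_mono) (simp add: norm_mult mult_left_mono assms)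

text \<open>If a hyperplane \<open>w \<cdot> z = 1\<close> misses a polydisc around \<open>a\<close>, then \<open>w \<cdot> (z - a)\<close> is
  smaller than \<open>1 - w \<cdot> a\<close> on it.\<close>

lemma conjugate_set_polydisc:
  assumes \<rho>: "\<rho> > 0" "polydisc a \<rho> \<subseteq> D" and w: "w \<in> conjugate_set D"
  shows "(\<Sum>\<nu>\<in>UNIV. cmod (w $ \<nu>)) * \<rho> < cmod (1 - cdot w a)"
proof (rule ccontr)
  let ?W = "\<Sum>\<nu>\<in>UNIV. cmod (w $ \<nu>)"
  assume "\<not> ?thesis"
  then have le: "cmod (1 - cdot w a) \<le> ?W * \<rho>" by simp
  \<comment> \<open>The components of \<open>h\<close> have the phases that make all terms of \<open>w \<cdot> h\<close> align.\<close>
  define \<beta> where "\<beta> = (1 - cdot w a) / complex_of_real (?W * \<rho>)"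
  define h where "h = (\<chi> \<nu>. \<beta> * complex_of_real \<rho> * cnj (sgn (w $ \<nu>)))"
  have W0: "?W \<noteq> 0"
  proof
    assume "?W = 0"
    then have "w $ \<nu> = 0" for \<nu> by (simp add: sum_nonneg_eq_0_iff)
    then have "cdot w a = 0" by (simp add: cdot_def)
    with le \<open>?W = 0\<close> show False by simp
  qed
  then have W: "?W > 0" by (simp add: sum_nonneg less_le)
  have \<beta>: "cmod \<beta> \<le> 1"
    using le W \<rho>(1) unfolding \<beta>_def norm_divide norm_of_real by (simp add: divide_le_eq abs_mult)
  have "cmod (h $ \<nu>) \<le> \<rho>" for \<nu>
  proof -
    have "cmod \<beta> * cmod (sgn (w $ \<nu>)) \<le> 1" using \<beta> by (simp add: norm_sgn)
    then have "cmod \<beta> * cmod (sgn (w $ \<nu>)) * \<rho> \<le> 1 * \<rho>" using \<rho> by (intro mult_right_mono) auto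
    then show ?thesis using \<rho> by (simp add: h_def norm_mult mult_ac)
  qed
  then have "a + h \<in> D" using \<rho>(2) by (auto simp: polydisc_def)
  moreover have "cdot w (a + h) = 1"
  proof -
    have "w $ \<nu> * cnj (sgn (w $ \<nu>)) = complex_of_real (cmod (w $ \<nu>))" for \<nu>
    proof -
      have "cnj (sgn (w $ \<nu>)) = cnj (w $ \<nu>) / complex_of_real (cmod (w $ \<nu>))"
        by (simp add: sgn_div_norm scaleR_conv_of_real divide_inverse)
      then have "w $ \<nu> * cnj (sgn (w $ \<nu>)) =
          complex_of_real ((cmod (w $ \<nu>))\<^sup>2) / complex_of_real (cmod (w $ \<nu>))"
        by (simp only: complex_norm_square times_divide_eq_right)
      then show ?thesis by (simp add: power2_eq_square)
    qed
    then have "cdot w h = \<beta> * complex_of_real \<rho> * (\<Sum>\<nu>\<in>UNIV. complex_of_real (cmod (w $ \<nu>)))"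
      unfolding cdot_def h_def sum_distrib_left by (intro sum.cong) (simp_all add: mult.left_commute)
    also have "\<dots> = 1 - cdot w a" using W0 \<rho> by (simp add: \<beta>_def field_simps flip: of_real_sum)
    finally show ?thesis by (simp add: cdot_add_right)
  qed
  ultimately show False using w by (auto simp: conjugate_set_def)
qed

lemma continuous_on_cdot [continuous_intros]:
  "continuous_on A f \<Longrightarrow> continuous_on A g \<Longrightarrow> continuous_on A (\<lambda>x. cdot (f x) (g x))"
  unfolding cdot_def by (intro continuous_intros)

text \<open>The Fantappie transform of such a functional is the rational function below.  Near \<open>a\<close>
  the kernel is the limit of the partial sums of its Taylor series, and the functional only sees
  finitely many of the coefficients.\<close>

lemma fantappie_transform_taylor_functional:
  fixes D :: "(complex ^ 'n::finite) set"
  assumes D: "open D" "a \<in> D" and S: "finite S"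
  shows "(\<lambda>v. \<Sum>k\<in>S. p k * (mpow v k / (1 - cdot v a) ^ (mdeg k + 1)))
    \<in> fantappie_transform D (taylor_functional D a S p)"
proof -
  let ?F = "taylor_functional D a S p"
  let ?Q = "\<lambda>v. \<Sum>k\<in>S. p k * (mpow v k / (1 - cdot v a) ^ (mdeg k + 1))"
  obtain \<rho> where \<rho>: "\<rho> > 0" "polydisc a \<rho> \<subseteq> D"
    using polydisc_in_open[OF D] by blast
  \<comment> \<open>On the polydisc of half the radius the geometric series has ratio at most one half.\<close>
  define L where "L = polydisc a (\<rho> / 2)"
  have L: "compact L" "L \<noteq> {}" "L \<subseteq> D"
    using \<rho> polydisc_mono[of "\<rho> / 2" \<rho> a] centre_in_polydisc[of "\<rho> / 2" a]
    by (auto simp: L_def compact_polydisc)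
  have "\<rho> / 2 > 0" using \<rho> by simp
  from taylor_functional_bound[OF this L(3)[unfolded L_def], of S p]
  obtain C where C: "\<And>f. f \<in> hol_space D \<Longrightarrow> cmod (?F f) \<le> C * sup_norm_on L f"
    unfolding L_def by blast
  define W where "W w = (\<Sum>\<nu>\<in>UNIV. cmod (w $ \<nu>))" for w :: "complex ^ 'n"
  define U where "U = {w. W w * \<rho> < cmod (1 - cdot w a)}"
  have U_open: "open U"
    unfolding U_def W_def by (intro open_Collect_less continuous_intros)
  have U_super: "conjugate_set D \<subseteq> U"
    using conjugate_set_polydisc[OF \<rho>] by (auto simp: U_def W_def)
  have half: "cmod (cdot w (z - a)) \<le> cmod (1 - cdot w a) / 2" if "w \<in> U" "z \<in> L" for w z
  proof -
    have "cmod (cdot w (z - a)) \<le> W w * (\<rho> / 2)"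
      unfolding W_def using that by (intro norm_cdot_le) (auto simp: L_def polydisc_def)
    then show ?thesis using that by (simp add: U_def)
  qed
  have nz: "1 - cdot w a \<noteq> 0" if "w \<in> U" for w
  proof -
    have "0 \<le> W w * \<rho>" using \<rho> by (auto simp: W_def intro!: mult_nonneg_nonneg sum_nonneg)
    also have "\<dots> < cmod (1 - cdot w a)" using that by (simp add: U_def)
    finally show ?thesis by auto
  qed
  have U_sub: "U \<subseteq> conjugate_set L"
  proof (clarsimp simp: conjugate_set_def)
    fix w z assume wz: "w \<in> U" "z \<in> L" "cdot w z = 1"
    then have "cdot w (z - a) = 1 - cdot w a" by (simp add: cdot_diff_right)
    then show False using half[OF wz(1,2)] nz[OF wz(1)] by simp
  qed
  have Q_analytic: "analytic_in ?Q U"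
  proof -
    have "analytic_in (\<lambda>v. \<Sum>k\<in>S. p k * (mpow v k * (1 / (1 - cdot a v)) ^ (mdeg k + 1))) U"
      using nz by (intro analytic_in_sum analytic_in_cmult analytic_in_mult analytic_in_mpow analytic_in_power
          analytic_in_inverse_affine) (auto simp: cdot_def mult.commute)
    then show ?thesis by (simp add: power_divide cdot_def mult.commute)
  qed
  have approx: "\<exists>f\<in>hol_space D. sup_norm_on L (\<lambda>z. f z - fantappie_kernel w z) < \<epsilon> \<and> cmod (?F f - ?Q w) < \<epsilon>"
    if w: "w \<in> U" and \<epsilon>: "\<epsilon> > 0" for w \<epsilon>
  proof -
    define \<beta> where "\<beta> = 1 - cdot w a"
    have \<beta>: "\<beta> \<noteq> 0" using nz[OF w] by (simp add: \<beta>_def)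
    have "(\<lambda>J. (2 / cmod \<beta>) * (1 / 2) ^ Suc J) \<longlonglongrightarrow> (2 / cmod \<beta>) * 0"
      by (intro tendsto_mult tendsto_const LIMSEQ_power_zero[THEN LIMSEQ_Suc]) auto
    then have "eventually (\<lambda>J. (2 / cmod \<beta>) * (1 / 2) ^ Suc J < \<epsilon> / 2) sequentially"
      using \<epsilon> by (intro order_tendstoD) auto
    then obtain J0 where J0: "\<And>J. J \<ge> J0 \<Longrightarrow> (2 / cmod \<beta>) * (1 / 2) ^ Suc J < \<epsilon> / 2"
      unfolding eventually_sequentially by blast
    define J1 where "J1 = (\<Sum>k\<in>S. mdeg k)"
    have J1: "mdeg k \<le> J1" if "k \<in> S" for k
      unfolding J1_def using S that by (intro member_le_sum) auto
    define J where "J = max J0 J1"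
    define f where "f z = (\<Sum>k | mdeg k \<le> J. complex_of_real (fantappie_weight 1 k) *
        mpow w k / \<beta> ^ (mdeg k + 1) * mpow (z - a) k)" for z
    have f_eq: "f z = (\<Sum>j\<le>J. (cdot w (z - a) / \<beta>) ^ j) / \<beta>" for z
      unfolding f_def sum_mdeg_le power_divide cdot_power sum_divide_distrib
      by (intro sum.cong refl) (auto simp: field_simps)
    have taylor: "has_taylor_expansion f (\<lambda>k.
        if k \<in> {k. mdeg k \<le> J} then complex_of_real (fantappie_weight 1 k) *
        mpow w k / \<beta> ^ (mdeg k + 1) else 0) a"
      unfolding f_def by (rule has_taylor_expansion_finite[OF finite_mdeg_le])
    have "analytic_in (\<lambda>z. (\<Sum>j\<le>J. ((cdot w z + (- cdot w a)) * (1 / \<beta>)) ^ j) * (1 / \<beta>)) D"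
      by (intro analytic_in_sum analytic_in_mult analytic_in_power analytic_in_add analytic_in_cdot
          analytic_in_const)
    then have f_an: "analytic_in f D"
      by (simp add: f_eq[abs_def] cdot_diff_right)
    define g where "g = restrict0 D f"
    have gD: "g \<in> hol_space D" unfolding g_def by (rule restrict0_hol_space[OF D(1) f_an])
    have coeff: "taylor_coeff g a = (\<lambda>k.
        if k \<in> {k. mdeg k \<le> J} then complex_of_real (fantappie_weight 1 k) *
        mpow w k / \<beta> ^ (mdeg k + 1) else 0)"
      unfolding g_def by (intro taylor_coeffI has_taylor_expansion_restrict0 D taylor)
    have Fg: "?F g = ?Q w"
    proof -
      have "p k * (taylor_coeff g a k / complex_of_real (fantappie_weight 1 k)) = p k *
          (mpow w k / (1 - cdot w a) ^ (mdeg k + 1))"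
        if "k \<in> S" for k
        using fantappie_weight_pos[of 1 k] J1[OF that] by (simp add: coeff \<beta>_def J_def)
      then show ?thesis
        using gD by (simp add: taylor_functional_def)
    qed
    have "cmod (g z - fantappie_kernel w z) \<le> \<epsilon> / 2" if z: "z \<in> L" for z
    proof -
      define x where "x = cdot w (z - a) / \<beta>"
      have x: "cmod x \<le> 1 / 2"
        using half[OF w z] \<beta> by (simp add: x_def \<beta>_def norm_divide divide_simps)
      have x1: "1 - x \<noteq> 0" using x by auto
      have den: "1 - cdot w z = \<beta> * (1 - x)"
        using \<beta> by (simp add: x_def \<beta>_def field_simps cdot_diff_right)
      have "(1 - x) * (\<Sum>j\<le>J. x ^ j) = 1 - x ^ Suc J"
        using one_diff_power_eq[of x "Suc J"] by (simp add: lessThan_Suc_atMost)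
      then have geo: "(\<Sum>j\<le>J. x ^ j) = (1 - x ^ Suc J) / (1 - x)"
        using x1 by (simp add: field_simps)
      have "g z = (\<Sum>j\<le>J. x ^ j) / \<beta>"
        using z L(3) by (auto simp: g_def restrict0_def f_eq x_def)
      then have "g z - fantappie_kernel w z = (1 - x ^ Suc J) / (1 - x) / \<beta> - 1 / (\<beta> * (1 - x))"
        by (simp only: fantappie_kernel_def den geo)
      also have "\<dots> = - (x ^ Suc J / (\<beta> * (1 - x)))"
        by (simp add: mult.commute[of _ \<beta>] flip: diff_divide_distrib)
      finally have "cmod (g z - fantappie_kernel w z) = cmod x ^ Suc J / (cmod \<beta> * cmod (1 - x))"
        by (simp add: norm_divide norm_mult norm_power)
      also have "\<dots> \<le> (1 / 2) ^ Suc J / (cmod \<beta> * (1 / 2))"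
      proof (intro frac_le mult_left_mono power_mono)
        show "1 / 2 \<le> cmod (1 - x)"
          using norm_triangle_ineq2[of 1 x] x by simp
      qed (use x \<beta> in auto)
      also have "\<dots> \<le> \<epsilon> / 2" using J0[of J] by (simp add: J_def field_simps)
      finally show ?thesis .
    qed
    then have "sup_norm_on L (\<lambda>z. g z - fantappie_kernel w z) \<le> \<epsilon> / 2"
      by (rule sup_norm_on_le[OF L(2)])
    then show ?thesis
      using gD Fg \<epsilon> by (intro bexI[of _ g]) auto
  qed
  show ?thesis
    unfolding fantappie_transform_def
  proof (rule CollectI, rule exI[of _ L], rule exI[of _ C], rule exI[of _ U], intro conjI ballI allI impI)
    show "cmod (?F f) \<le> C * sup_norm_on L f" if "f \<in> hol_space D" for f
      by (rule C[OF that])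
    fix w and \<epsilon> :: real assume "w \<in> U" "0 < \<epsilon>"
    then show "\<exists>f\<in>hol_space D. sup_norm_on L (\<lambda>z. f z - fantappie_kernel w z) < \<epsilon> \<and> cmod (?F f - ?Q w) < \<epsilon>"
      by (rule approx)
  qed (fact L U_open U_super U_sub Q_analytic)+
qed

section \<open>Bounds from the strict linear convexity\<close>

text \<open>Neighbourhoods in a generated topology contain finite nonempty intersections of generators.\<close>

lemma topology_generated_by_nbhd:
  assumes "openin (topology_generated_by \<S>) T" "x \<in> T"
  obtains \<F> where "finite \<F>" "\<F> \<noteq> {}" "\<F> \<subseteq> \<S>" "x \<in> \<Inter>\<F>" "\<Inter>\<F> \<subseteq> T"
proof -
  have "generate_topology_on \<S> T"
    using assms(1) by (simp add: openin_topology_generated_by_iff)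
  then have "\<exists>\<F>. finite \<F> \<and> \<F> \<noteq> {} \<and> \<F> \<subseteq> \<S> \<and> x \<in> \<Inter>\<F> \<and> \<Inter>\<F> \<subseteq> T"
    using assms(2)
  proof induction
    case (Int a b)
    then obtain \<F> \<G> where "finite \<F>" "\<F> \<noteq> {}" "\<F> \<subseteq> \<S>" "x \<in> \<Inter>\<F>" "\<Inter>\<F> \<subseteq> a"
      "finite \<G>" "\<G> \<subseteq> \<S>" "x \<in> \<Inter>\<G>" "\<Inter>\<G> \<subseteq> b"
      by (metis IntE)
    then show ?case by (intro exI[of _ "\<F> \<union> \<G>"]) auto
  next
    case (UN A)
    then obtain k \<F> where "k \<in> A" "finite \<F>" "\<F> \<noteq> {}" "\<F> \<subseteq> \<S>" "x \<in> \<Inter>\<F>" "\<Inter>\<F> \<subseteq> k"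
      by (metis UnionE)
    then show ?case by (intro exI[of _ \<F>]) blast
  next
    case (Basis s)
    then show ?case by (intro exI[of _ "{s}"]) auto
  qed auto
  then show ?thesis using that by blast
qed

text \<open>The property \<open>P\<close> holds on a neighbourhood of zero in \<open>A(U)\<close>: for all functions that are small
  enough on some nonempty compact subset of \<open>U\<close>.\<close>

definition zero_nbhd :: "(complex ^ 'n::finite) set \<Rightarrow> ((complex ^ 'n \<Rightarrow> complex) \<Rightarrow> bool) \<Rightarrow> bool" where
  "zero_nbhd U P \<longleftrightarrow> (\<exists>L \<eta>. compact L \<and> L \<noteq> {} \<and> L \<subseteq> U \<and> \<eta> > 0 \<and>
     (\<forall>g\<in>hol_space U. (\<forall>z\<in>L. cmod (g z) \<le> \<eta>) \<longrightarrow> P g))"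

lemma zero_nbhd_finite:
  assumes "finite \<F>" "\<F> \<noteq> {}" "\<And>A. A \<in> \<F> \<Longrightarrow> zero_nbhd U (P A)"
  shows "zero_nbhd U (\<lambda>g. \<forall>A\<in>\<F>. P A g)"
  using assms
proof (induction rule: finite_ne_induct)
  case (singleton A)
  then show ?case by simp
next
  case (insert A \<F>)
  then have "zero_nbhd U (P A)" "zero_nbhd U (\<lambda>g. \<forall>A\<in>\<F>. P A g)" by auto
  then obtain L \<eta> L' \<eta>' where
    "compact L" "L \<noteq> {}" "L \<subseteq> U" "\<eta> > 0" "\<And>g. g \<in> hol_space U \<Longrightarrow> (\<forall>z\<in>L. cmod (g z) \<le> \<eta>) \<Longrightarrow> P A g"
    "compact L'" "L' \<noteq> {}" "L' \<subseteq> U" "\<eta>' > 0" "\<And>g. g \<in> hol_space U \<Longrightarrow> (\<forall>z\<in>L'. cmod (g z) \<le> \<eta>') \<Longrightarrow> \<forall>A\<in>\<F>. P A g"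
    unfolding zero_nbhd_def by metis
  then show ?case
    unfolding zero_nbhd_def
    by (intro exI[of _ "L \<union> L'"] exI[of _ "min \<eta> \<eta>'"]) (auto intro: compact_Un)
qed

lemma zero_nbhd_sup_norm:
  assumes f: "f \<in> hol_space U" and L: "compact L" "L \<noteq> {}" "L \<subseteq> U"
    and small: "sup_norm_on L (\<lambda>z. 0 - f z) < \<epsilon>"
  shows "zero_nbhd U (\<lambda>g. sup_norm_on L (\<lambda>z. g z - f z) < \<epsilon>)"
proof -
  define \<eta> where "\<eta> = (\<epsilon> - sup_norm_on L (\<lambda>z. 0 - f z)) / 2"
  have \<eta>: "\<eta> > 0" using small by (simp add: \<eta>_def)
  have "sup_norm_on L (\<lambda>z. g z - f z) < \<epsilon>" if g: "g \<in> hol_space U" "\<forall>z\<in>L. cmod (g z) \<le> \<eta>" for g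
  proof -
    have "sup_norm_on L (\<lambda>z. g z - f z) \<le> \<eta> + sup_norm_on L (\<lambda>z. 0 - f z)"
    proof (rule sup_norm_on_le[OF L(2)])
      fix z assume z: "z \<in> L"
      have "cmod (0 - f z) \<le> sup_norm_on L (\<lambda>z. 0 - f z)"
        using hol_space_diff[OF hol_space_zero f] L z
        by (intro norm_le_sup_norm_on[of "\<lambda>z. 0 - f z" U]) (auto simp: hol_space_def)
      then show "cmod (g z - f z) \<le> \<eta> + sup_norm_on L (\<lambda>z. 0 - f z)"
        using g(2) z norm_triangle_ineq4[of "g z" "f z"] by force
    qed
    also have "\<dots> < \<epsilon>" using small by (simp add: \<eta>_def field_simps)
    finally show ?thesis .
  qed
  then show ?thesis
    unfolding zero_nbhd_def using L \<eta> by blast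
qed

lemma zero_nbhd_mono:
  "zero_nbhd U P \<Longrightarrow> (\<And>g. g \<in> hol_space U \<Longrightarrow> P g \<Longrightarrow> Q g) \<Longrightarrow> zero_nbhd U Q"
  unfolding zero_nbhd_def by meson

lemma zero_nbhd_continuous:
  assumes U: "U \<noteq> {}" and p: "continuous_map (hol_topology U) euclideanreal p" "p (\<lambda>z. 0) < \<delta>"
  shows "zero_nbhd U (\<lambda>g. p g < \<delta>)"
proof -
  define T where "T = {f \<in> topspace (hol_topology U). p f \<in> {..<\<delta>}}"
  have "openin (hol_topology U) T"
    unfolding T_def by (rule openin_continuous_map_preimage[OF p(1)]) auto
  moreover have "(\<lambda>z. 0) \<in> T"
    using p(2) by (simp add: T_def topspace_hol_topology[OF U] hol_space_zero)
  ultimately obtain \<F> where \<F>: "finite \<F>" "\<F> \<noteq> {}"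
    "\<F> \<subseteq> {{g \<in> hol_space U. sup_norm_on L (\<lambda>z. g z - f z) < \<epsilon>} | f L \<epsilon>.
        f \<in> hol_space U \<and> compact L \<and> L \<noteq> {} \<and> L \<subseteq> U \<and> \<epsilon> > 0}"
    "(\<lambda>z. 0) \<in> \<Inter>\<F>" "\<Inter>\<F> \<subseteq> T"
    unfolding hol_topology_def by (rule topology_generated_by_nbhd)
  have "zero_nbhd U (\<lambda>g. \<forall>A\<in>\<F>. g \<in> A)"
  proof (rule zero_nbhd_finite[OF \<F>(1,2)])
    fix A assume A: "A \<in> \<F>"
    then obtain f L \<epsilon> where fL: "f \<in> hol_space U" "compact L" "L \<noteq> {}" "L \<subseteq> U"
      "A = {g \<in> hol_space U. sup_norm_on L (\<lambda>z. g z - f z) < \<epsilon>}"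
      using \<F>(3) by blast
    have "(\<lambda>z. 0) \<in> A" using \<F>(4) A by blast
    then have "sup_norm_on L (\<lambda>z. 0 - f z) < \<epsilon>" unfolding fL(5) by simp
    from zero_nbhd_sup_norm[OF fL(1-4) this] show "zero_nbhd U (\<lambda>g. g \<in> A)"
      by (rule zero_nbhd_mono) (simp add: fL(5))
  qed
  then show ?thesis
    by (rule zero_nbhd_mono) (use \<F>(5) in \<open>auto simp: T_def\<close>)
qed

lemma germ_eqI:
  assumes "open U" "K \<subseteq> U" "\<And>z. z \<in> U \<Longrightarrow> f z = g z"
  shows "germ K f = germ K g"
proof -
  have "germ K f \<subseteq> germ K g" if "\<And>z. z \<in> U \<Longrightarrow> f z = g z" for f g :: "complex ^ 'a \<Rightarrow> complex"
  proof
    fix h assume "h \<in> germ K f"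
    then obtain V where V: "open V" "K \<subseteq> V" "\<forall>z\<in>V. h z = f z" by (auto simp: germ_def)
    then show "h \<in> germ K g"
      using assms(1,2) that by (auto simp: germ_def intro!: exI[of _ "U \<inter> V"])
  qed
  from this[of f g] this[of g f] assms(3) show ?thesis by auto
qed

lemma germ_self: "f \<in> germ K f"
  by (auto simp: germ_def)

lemma germ_eq_iff: "germ K f = germ K g \<longleftrightarrow> (\<exists>U. open U \<and> K \<subseteq> U \<and> (\<forall>z\<in>U. f z = g z))"
  using germ_self[of f K] germ_eqI[of _ K f g] by (auto simp: germ_def[of K g])

lemma analytic_near_diff:
  assumes "analytic_near f K" "analytic_near g K"
  shows "analytic_near (\<lambda>z. f z - g z) K"
proof -
  obtain U V where "open U" "K \<subseteq> U" "analytic_in f U" "open V" "K \<subseteq> V" "analytic_in g V"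
    using assms unfolding analytic_near_def by blast
  moreover from this have "analytic_in (\<lambda>z. f z + - 1 * g z) (U \<inter> V)"
    by (intro analytic_in_add analytic_in_cmult) (auto intro: analytic_in_subset)
  ultimately show ?thesis
    unfolding analytic_near_def by (intro exI[of _ "U \<inter> V"]) auto
qed

text \<open>The generators of the germ topology that contain the zero germ pull back to neighbourhoods of
  zero in each \<open>A(U)\<close>.\<close>

lemma zero_nbhd_germ:
  assumes U: "open U" "K \<subseteq> U" "U \<noteq> {}"
    and f: "analytic_near f K" and p: "germ_seminorm K p"
    and zero: "germ K (\<lambda>z. 0) \<in> {germ K g | g. analytic_near g K \<and> p (\<lambda>z. g z - f z) < \<epsilon>}"
  shows "zero_nbhd U (\<lambda>g. germ K g \<in> {germ K g | g. analytic_near g K \<and> p (\<lambda>z. g z - f z) < \<epsilon>})"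
proof -
  have zero_near: "analytic_near (\<lambda>z. 0) K"
    unfolding analytic_near_def using analytic_in_const[of 0 U] U by blast
  obtain g0 where g0: "germ K g0 = germ K (\<lambda>z. 0)" "analytic_near g0 K" "p (\<lambda>z. g0 z - f z) < \<epsilon>"
    using zero by auto
  have "germ K (\<lambda>z. g0 z - f z) = germ K (\<lambda>z. 0 - f z)"
    using g0(1) unfolding germ_eq_iff by auto
  then have "p (\<lambda>z. g0 z - f z) = p (\<lambda>z. 0 - f z)"
    using p analytic_near_diff[OF g0(2) f] analytic_near_diff[OF zero_near f]
    unfolding germ_seminorm_def by blast
  with g0(3) have small: "p (\<lambda>z. 0 - f z) < \<epsilon>" by simp
  have "p (\<lambda>z. 0 * f z) = cmod 0 * p f"
    using p f unfolding germ_seminorm_def by blast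
  then have "p (\<lambda>z. 0) < \<epsilon> - p (\<lambda>z. 0 - f z)" using small by simp
  moreover have "continuous_map (hol_topology U) euclideanreal p"
    using p U unfolding germ_seminorm_def by blast
  ultimately have "zero_nbhd U (\<lambda>g. p g < \<epsilon> - p (\<lambda>z. 0 - f z))"
    by (intro zero_nbhd_continuous U)
  then show ?thesis
  proof (rule zero_nbhd_mono)
    fix g assume g: "g \<in> hol_space U" "p g < \<epsilon> - p (\<lambda>z. 0 - f z)"
    have near: "analytic_near g K"
      using g(1) U unfolding analytic_near_def hol_space_def by blast
    have "p (\<lambda>z. g z + (0 - f z)) \<le> p g + p (\<lambda>z. 0 - f z)"
      using p near analytic_near_diff[OF zero_near f] unfolding germ_seminorm_def by blast
    then have "p (\<lambda>z. g z - f z) < \<epsilon>" using g(2) by simp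
    then show "germ K g \<in> {germ K g | g. analytic_near g K \<and> p (\<lambda>z. g z - f z) < \<epsilon>}"
      using near by blast
  qed
qed

lemma topspace_strong_dual_topology: "topspace (strong_dual_topology D) = hol_dual D"
proof -
  have "F \<in> \<Union>{{G \<in> hol_dual D. sup_norm_on B (\<lambda>f. G f - F f) < \<epsilon>} | F B \<epsilon>.
        F \<in> hol_dual D \<and> hol_bounded D B \<and> B \<noteq> {} \<and> \<epsilon> > 0}" if F: "F \<in> hol_dual D" for F
  proof (rule UnionI)
    show "F \<in> {G \<in> hol_dual D. sup_norm_on {\<lambda>z. 0} (\<lambda>f. G f - F f) < 1}"
      using F by (simp add: sup_norm_on_def)
    have "hol_bounded D {\<lambda>z. 0}"
      by (auto simp: hol_bounded_def hol_space_zero)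
    with F show "{G \<in> hol_dual D. sup_norm_on {\<lambda>z. 0} (\<lambda>f. G f - F f) < 1} \<in>
      {{G \<in> hol_dual D. sup_norm_on B (\<lambda>f. G f - F f) < \<epsilon>} | F B \<epsilon>.
        F \<in> hol_dual D \<and> hol_bounded D B \<and> B \<noteq> {} \<and> \<epsilon> > 0}"
      by (intro CollectI exI[of _ F] exI[of _ "{\<lambda>z. 0}"] exI[of _ 1]) auto
  qed
  then show ?thesis
    unfolding strong_dual_topology_def topology_generated_by_topspace by blast
qed

lemma zero_in_conjugate_set: "0 \<in> conjugate_set E"
  by (simp add: conjugate_set_def cdot_def)

lemma cdot_scale_left: "cdot (x *s w) z = x * cdot w z"
  by (simp add: cdot_def sum_distrib_left mult.assoc)

text \<open>Under strict linear convexity each value of the transform is a germ, hence the germ of any of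
  its members.\<close>

lemma fantappie_transform_eq_germ:
  fixes D :: "(complex ^ 'n::finite) set"
  assumes D: "strictly_linearly_convex_domain D" "a \<in> D" and S: "finite S"
  shows "fantappie_transform D (taylor_functional D a S p) =
    germ (conjugate_set D) (\<lambda>v. \<Sum>k\<in>S. p k * (mpow v k / (1 - cdot v a) ^ (mdeg k + 1)))"
proof -
  have op: "open D" and hom: "homeomorphic_map (strong_dual_topology D) (germ_topology (conjugate_set D))
      (fantappie_transform D)"
    using D by (auto simp: strictly_linearly_convex_domain_def)
  have "fantappie_transform D (taylor_functional D a S p) \<in> topspace (germ_topology (conjugate_set D))"
    using homeomorphic_imp_surjective_map[OF hom] taylor_functional_hol_dual[OF op D(2), of S p]
    by (auto simp: topspace_strong_dual_topology)
  then obtain g where g: "fantappie_transform D (taylor_functional D a S p) = germ (conjugate_set D) g"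
    unfolding germ_topology_def topology_generated_by_topspace by auto
  have "(\<lambda>v. \<Sum>k\<in>S. p k * (mpow v k / (1 - cdot v a) ^ (mdeg k + 1))) \<in> germ (conjugate_set D) g"
    using fantappie_transform_taylor_functional[OF op D(2) S, of p] g by simp
  then obtain U where "open U" "conjugate_set D \<subseteq> U"
    "\<forall>v\<in>U. (\<Sum>k\<in>S. p k * (mpow v k / (1 - cdot v a) ^ (mdeg k + 1))) = g v"
    by (auto simp: germ_def)
  then show ?thesis
    unfolding g germ_eq_iff by auto
qed

text \<open>The transform of the functional with coefficients \<open>p\<close> is the polynomial with coefficients
  \<open>p\<close> composed with the projective map \<open>v \<mapsto> v / (1 - v \<cdot> a)\<close>, up to a non-vanishing factor; this map
  carries the conjugate set of \<open>D\<close> into that of \<open>D - a\<close>.\<close>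

lemma taylor_functional_bound_on_bounded:
  fixes D :: "(complex ^ 'n::finite) set"
  assumes D: "strictly_linearly_convex_domain D" "a \<in> D" and B: "hol_bounded D B"
    and V: "open V" "conjugate_set ((\<lambda>z. z - a) ` D) \<subseteq> V"
  obtains C where "C \<ge> 0" "\<And>f S p M. f \<in> B \<Longrightarrow> finite S \<Longrightarrow>
    (\<And>w. w \<in> V \<Longrightarrow> cmod (\<Sum>k\<in>S. p k * mpow w k) \<le> M) \<Longrightarrow>
    cmod (\<Sum>k\<in>S. p k * (taylor_coeff f a k / complex_of_real (fantappie_weight 1 k))) \<le> C * M"
proof (cases "B = {}")
  case True
  then show ?thesis using that[of 0] by simp
next
  case False
  define K where "K = conjugate_set D"
  define \<Theta> where "\<Theta> = fantappie_transform D"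
  define Q where "Q S p v = (\<Sum>k\<in>S. p k * (mpow v k / (1 - cdot v a) ^ (mdeg k + 1)))"
    for S and p :: "'n multiindex \<Rightarrow> complex" and v
  have op: "open D" and hom: "homeomorphic_map (strong_dual_topology D) (germ_topology K) \<Theta>"
    using D by (auto simp: strictly_linearly_convex_domain_def K_def \<Theta>_def)
  have \<Theta>_eq: "\<Theta> (taylor_functional D a S p) = germ K (Q S p)" if "finite S" for S p
    using fantappie_transform_eq_germ[OF D that] unfolding \<Theta>_def K_def Q_def[abs_def] .
  have dual: "taylor_functional D a S p \<in> hol_dual D" for S p
    by (rule taylor_functional_hol_dual[OF op D(2)])
  define \<tau> where "\<tau> v = (1 / (1 - cdot v a)) *s v" for v
  define U where "U = {v. 1 - cdot v a \<noteq> 0} \<inter> \<tau> -` V"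
  have U_open: "open U"
  proof -
    have "open {v. 1 - cdot v a \<noteq> 0}"
      by (intro open_Collect_neq continuous_intros)
    moreover have "continuous_on {v. 1 - cdot v a \<noteq> 0} \<tau>"
      unfolding \<tau>_def vector_scalar_mult_def by (intro continuous_intros) auto
    ultimately show ?thesis
      unfolding U_def using V(1) by (intro continuous_open_preimage)
  qed
  have KU: "K \<subseteq> U"
  proof
    fix v assume v: "v \<in> K"
    then have nz: "1 - cdot v a \<noteq> 0" using D(2) by (auto simp: K_def conjugate_set_def)
    have "cdot (\<tau> v) (z - a) \<noteq> 1" if "z \<in> D" for z
    proof
      assume "cdot (\<tau> v) (z - a) = 1"
      then have "cdot v (z - a) = 1 - cdot v a"
        using nz by (simp add: \<tau>_def cdot_scale_left field_simps)
      then have "cdot v z = 1" by (simp add: cdot_diff_right)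
      then show False using v that by (auto simp: K_def conjugate_set_def)
    qed
    then have "\<tau> v \<in> conjugate_set ((\<lambda>z. z - a) ` D)" by (auto simp: conjugate_set_def)
    then show "v \<in> U" using nz V(2) by (auto simp: U_def)
  qed
  have U_ne: "U \<noteq> {}" using KU zero_in_conjugate_set[of D] by (auto simp: K_def)
  have Q_eq: "Q S p v = 1 / (1 - cdot v a) * (\<Sum>k\<in>S. p k * mpow (\<tau> v) k)" if "v \<in> U" for S p v
    using that unfolding Q_def sum_distrib_left
    by (intro sum.cong) (auto simp: \<tau>_def mpow_scale power_divide U_def)
  \<comment> \<open>The functionals bounded by one on \<open>B\<close>: a neighbourhood of zero in the strong dual.\<close>
  define W where "W = {G \<in> hol_dual D. sup_norm_on B (\<lambda>f. G f - taylor_functional D a {} (\<lambda>k. 0) f) < 1}"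
  have zero_fun: "taylor_functional D a {} (\<lambda>k. 0) = (\<lambda>f. 0)"
    by (simp add: taylor_functional_def fun_eq_iff)
  have "openin (strong_dual_topology D) W"
    unfolding strong_dual_topology_def W_def
    using dual[of "{}" "\<lambda>k. 0"] B False
        by (intro topology_generated_by_Basis) (rule CollectI, rule exI, rule exI[of _ B], rule exI[of _ 1],
        simp)
  then have "openin (germ_topology K) (\<Theta> ` W)"
    using homeomorphic_imp_open_map[OF hom] by (simp add: open_map_def)
  moreover have "germ K (\<lambda>z. 0) \<in> \<Theta> ` W"
  proof
    show "germ K (\<lambda>z. 0) = \<Theta> (taylor_functional D a {} (\<lambda>k. 0))"
      by (subst \<Theta>_eq) (auto simp: Q_def[abs_def])
    show "taylor_functional D a {} (\<lambda>k. 0) \<in> W"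
      unfolding W_def using dual False by (simp add: sup_norm_on_def)
  qed
  ultimately obtain \<F> where \<F>: "finite \<F>" "\<F> \<noteq> {}"
    "\<F> \<subseteq> {{germ K g | g. analytic_near g K \<and> p (\<lambda>z. g z - f z) < \<epsilon>} | f p \<epsilon>.
        analytic_near f K \<and> germ_seminorm K p \<and> \<epsilon> > 0}"
    "germ K (\<lambda>z. 0) \<in> \<Inter>\<F>" "\<Inter>\<F> \<subseteq> \<Theta> ` W"
    unfolding germ_topology_def by (rule topology_generated_by_nbhd)
  have "zero_nbhd U (\<lambda>g. \<forall>A\<in>\<F>. germ K g \<in> A)"
  proof (rule zero_nbhd_finite[OF \<F>(1,2)])
    fix A assume A: "A \<in> \<F>"
    with \<F>(3) obtain f p \<epsilon> where fp: "A = {germ K g | g. analytic_near g K \<and> p (\<lambda>z. g z - f z) < \<epsilon>}"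
      "analytic_near f K" "germ_seminorm K p" by blast
    have "germ K (\<lambda>z. 0) \<in> A" using \<F>(4) A by blast
    then show "zero_nbhd U (\<lambda>g. germ K g \<in> A)"
      unfolding fp(1) by (rule zero_nbhd_germ[OF U_open KU U_ne fp(2,3)])
  qed
  then have "zero_nbhd U (\<lambda>g. germ K g \<in> \<Theta> ` W)"
    by (rule zero_nbhd_mono) (use \<F>(5) in blast)
  then obtain L \<eta> where L: "compact L" "L \<noteq> {}" "L \<subseteq> U" and \<eta>: "\<eta> > 0"
    and germ_small: "\<And>g. g \<in> hol_space U \<Longrightarrow> (\<forall>z\<in>L. cmod (g z) \<le> \<eta>) \<Longrightarrow> germ K g \<in> \<Theta> ` W"
    unfolding zero_nbhd_def by blast
  have "continuous_on L (\<lambda>v. 1 / (1 - cdot v a))"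
    using L(3) by (intro continuous_intros) (auto simp: U_def)
  then obtain C1 where C1: "C1 > 0" "\<And>v. v \<in> L \<Longrightarrow> cmod (1 / (1 - cdot v a)) \<le> C1"
    using compact_continuous_image[OF _ L(1)] compact_imp_bounded bounded_pos image_eqI by (smt (verit, best))
  have zero_V: "0 \<in> V" using V(2) zero_in_conjugate_set by blast
  show ?thesis
  proof (rule that[of "C1 / \<eta>"])
    show "C1 / \<eta> \<ge> 0" using C1 \<eta> by simp
    fix f S M and p :: "'n multiindex \<Rightarrow> complex"
    assume f: "f \<in> B" and S: "finite S" and M: "\<And>w. w \<in> V \<Longrightarrow> cmod (\<Sum>k\<in>S. p k * mpow w k) \<le> M"
    let ?s = "\<Sum>k\<in>S. p k * (taylor_coeff f a k / complex_of_real (fantappie_weight 1 k))"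
    have fD: "f \<in> hol_space D" using f B by (auto simp: hol_bounded_def)
    have M0: "M \<ge> 0" using M[OF zero_V] norm_ge_zero order_trans by blast
    have "cmod ?s \<le> C1 / \<eta> * M'" if M': "M' > M" for M'
    proof -
      \<comment> \<open>The scaling that makes the transform at most \<open>\<eta>\<close> on \<open>L\<close>.\<close>
      define t where "t = \<eta> / (C1 * M')"
      have t: "t > 0" using C1 \<eta> M' M0 by (simp add: t_def)
      define p' where "p' k = complex_of_real t * p k" for k
      define g where "g = restrict0 U (Q S p')"
      have "analytic_in (Q S p') U"
      proof -
        have "analytic_in (\<lambda>v. \<Sum>k\<in>S. p' k * (mpow v k * (1 / (1 - cdot a v)) ^ (mdeg k + 1))) U"
          by (intro analytic_in_sum analytic_in_cmult analytic_in_mult analytic_in_mpow analytic_in_power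
              analytic_in_inverse_affine) (auto simp: U_def cdot_def mult.commute)
        then show ?thesis by (simp add: Q_def[abs_def] power_divide cdot_def mult.commute)
      qed
      then have gU: "g \<in> hol_space U" unfolding g_def by (rule restrict0_hol_space[OF U_open])
      have "cmod (g v) \<le> \<eta>" if v: "v \<in> L" for v
      proof -
        have vU: "v \<in> U" using v L(3) by blast
        have "g v = complex_of_real t * (1 / (1 - cdot v a) * (\<Sum>k\<in>S. p k * mpow (\<tau> v) k))"
          using vU by (simp add: g_def restrict0_def Q_eq p'_def mult.assoc flip: sum_distrib_left)
        then have "cmod (g v) = t * (cmod (1 / (1 - cdot v a)) * cmod (\<Sum>k\<in>S. p k * mpow (\<tau> v) k))"
          using t by (simp only: norm_mult norm_of_real abs_of_pos)
        also have "\<dots> \<le> t * (C1 * M')"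
          using t C1(1) C1(2)[OF v] M[of "\<tau> v"] vU M'
          by (intro mult_left_mono mult_mono) (auto simp: U_def)
        also have "\<dots> = \<eta>" using C1 M' M0 by (simp add: t_def)
        finally show ?thesis .
      qed
      then have "germ K g \<in> \<Theta> ` W" using germ_small gU by blast
      moreover have "germ K g = \<Theta> (taylor_functional D a S p')"
        unfolding \<Theta>_eq[OF S] by (rule germ_eqI[OF U_open KU]) (simp add: g_def restrict0_def)
      ultimately obtain G where G: "G \<in> W" "\<Theta> G = \<Theta> (taylor_functional D a S p')" by auto
      have "G = taylor_functional D a S p'"
        using homeomorphic_imp_injective_map[OF hom] G dual
        by (auto simp: inj_on_def topspace_strong_dual_topology W_def)
      then have less: "sup_norm_on B (taylor_functional D a S p') < 1"
        using G(1) by (simp add: W_def zero_fun)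
      obtain \<rho> where \<rho>: "\<rho> > 0" "polydisc a \<rho> \<subseteq> D" using polydisc_in_open[OF op D(2)] by blast
      obtain C where C: "C \<ge> 0" "\<And>f. f \<in> hol_space D \<Longrightarrow> cmod (taylor_functional D a S p' f) \<le> C *
          sup_norm_on (polydisc a \<rho>) f"
        using taylor_functional_bound[OF \<rho>, of S p'] by blast
      obtain N where N: "\<And>f z. f \<in> B \<Longrightarrow> z \<in> polydisc a \<rho> \<Longrightarrow> cmod (f z) \<le> N"
        using B \<rho>(2) compact_polydisc[of a \<rho>] unfolding hol_bounded_def by meson
      have "cmod (taylor_functional D a S p' f) \<le> C * N" if "f \<in> B" for f
      proof -
        have "sup_norm_on (polydisc a \<rho>) f \<le> N"
          using N that \<rho>(1) centre_in_polydisc[of \<rho> a] by (intro sup_norm_on_le) auto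
        then have "C * sup_norm_on (polydisc a \<rho>) f \<le> C * N" using C by (intro mult_left_mono)
        moreover have "f \<in> hol_space D" using that B by (auto simp: hol_bounded_def)
        ultimately show ?thesis using C(2)[of f] by linarith
      qed
      then have "bdd_above ((\<lambda>f. cmod (taylor_functional D a S p' f)) ` B)" by (intro bdd_aboveI2)
      then have "cmod (taylor_functional D a S p' f) \<le> sup_norm_on B (taylor_functional D a S p')"
        unfolding sup_norm_on_def using f by (intro cSUP_upper)
      with less have "cmod (taylor_functional D a S p' f) < 1" by simp
      moreover have "taylor_functional D a S p' f = complex_of_real t * ?s"
        using fD by (simp add: taylor_functional_def p'_def sum_distrib_left mult.assoc)
      ultimately have "t * cmod ?s < 1" using t by (simp add: norm_mult)
      then show ?thesis using C1 \<eta> M' M0 by (simp add: t_def field_simps)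
    qed
    then have "cmod ?s \<le> C1 / \<eta> * M + e" if "e > 0" for e
    proof -
      have "M < M + e * \<eta> / C1" using that \<eta> C1 by simp
      from \<open>\<And>M'. M' > M \<Longrightarrow> cmod ?s \<le> C1 / \<eta> * M'\<close>[OF this]
      have "cmod ?s \<le> C1 / \<eta> * (M + e * \<eta> / C1)" .
      also have "\<dots> = C1 / \<eta> * M + e" using \<eta> C1(1) by (simp add: field_simps)
      finally show ?thesis .
    qed
    then show "cmod ?s \<le> C1 / \<eta> * M" by (rule field_le_epsilon)
  qed
qed

lemma taylor_coeff_cmult:
  "f \<in> hol_space D \<Longrightarrow> a \<in> D \<Longrightarrow> taylor_coeff (\<lambda>z. x * f z) a = (\<lambda>k. x * taylor_coeff f a k)"
  by (intro taylor_coeffI has_taylor_expansion_cmult taylor_coeff_hol_space)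

text \<open>If no compact set worked, the offending functions for an exhaustion of \<open>D\<close> by compact sets,
  once normalised, would form a bounded set, against the previous bound.\<close>

lemma taylor_functional_bound_equicontinuous:
  fixes D :: "(complex ^ 'n::finite) set"
  assumes D: "strictly_linearly_convex_domain D" "a \<in> D"
    and V: "open V" "conjugate_set ((\<lambda>z. z - a) ` D) \<subseteq> V"
  obtains L C where "compact L" "L \<subseteq> D" "C \<ge> 0" "\<And>f N S p M. f \<in> hol_space D \<Longrightarrow> N > 0 \<Longrightarrow>
    (\<And>z. z \<in> L \<Longrightarrow> cmod (f z) \<le> N) \<Longrightarrow> finite S \<Longrightarrow>
    (\<And>w. w \<in> V \<Longrightarrow> cmod (\<Sum>k\<in>S. p k * mpow w k) \<le> M) \<Longrightarrow>
    cmod (\<Sum>k\<in>S. p k * (taylor_coeff f a k / complex_of_real (fantappie_weight 1 k))) \<le> C * N * M"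
proof -
  have "open D" using D by (auto simp: strictly_linearly_convex_domain_def)
  then obtain L :: "nat \<Rightarrow> (complex ^ 'n) set" where L: "\<And>n. compact (L n)" "\<And>n. L n \<subseteq> D"
    "\<And>K. compact K \<Longrightarrow> K \<subseteq> D \<Longrightarrow> \<exists>N. \<forall>n\<ge>N. K \<subseteq> L n"
    using open_Union_compact_subsets by metis
  define good where "good n f N S p M \<longleftrightarrow>
    cmod (\<Sum>k\<in>S. p k * (taylor_coeff f a k / complex_of_real (fantappie_weight 1 k))) \<le> real n * N * M"
    for n f N S M and p :: "'n multiindex \<Rightarrow> complex"
  define adm where "adm n f N S p M \<longleftrightarrow> f \<in> hol_space D \<and> N > 0 \<and> (\<forall>z\<in>L n. cmod (f z) \<le> N) \<and>
    finite S \<and> (\<forall>w\<in>V. cmod (\<Sum>k\<in>S. p k * mpow w k) \<le> M)"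
    for n f N S M and p :: "'n multiindex \<Rightarrow> complex"
  have "\<exists>n. \<forall>f N S p M. adm n f N S p M \<longrightarrow> good n f N S p M"
  proof (rule ccontr)
    assume "\<not> ?thesis"
    then have "\<forall>n. \<exists>f N S p M. adm n f N S p M \<and> \<not> good n f N S p M" by blast
    then obtain f N S p M where bad: "\<And>n. adm n (f n) (N n) (S n) (p n) (M n)"
      "\<And>n. \<not> good n (f n) (N n) (S n) (p n) (M n)"
      by metis
    define g where "g n = (\<lambda>z. complex_of_real (1 / N n) * f n z)" for n
    have fD: "f n \<in> hol_space D" and N: "N n > 0" for n using bad(1)[of n] by (auto simp: adm_def)
    have gD: "g n \<in> hol_space D" for n
      unfolding g_def by (rule hol_space_cmult[OF fD])
    have "hol_bounded D (range g)"
      unfolding hol_bounded_def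
    proof (intro conjI allI impI)
      show "range g \<subseteq> hol_space D" using gD by auto
      fix K assume K: "compact K \<and> K \<subseteq> D"
      obtain m where m: "\<And>n. n \<ge> m \<Longrightarrow> K \<subseteq> L n" using L(3) K by blast
      have g_le: "cmod (g n z) \<le> sup_norm_on K (g n)" if "z \<in> K" for n z
        using gD[of n] K that by (intro norm_le_sup_norm_on[of _ D]) (auto simp: hol_space_def)
      have "cmod (g n z) \<le> 1 + (\<Sum>n<m. \<bar>sup_norm_on K (g n)\<bar>)" if z: "z \<in> K" for n z
      proof (cases "n < m")
        case True
        have "\<bar>sup_norm_on K (g n)\<bar> \<le> (\<Sum>n<m. \<bar>sup_norm_on K (g n)\<bar>)"
          using True by (intro member_le_sum) auto
        then show ?thesis using g_le[OF z, of n] by linarith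
      next
        case False
        then have "z \<in> L n" using m[of n] z by auto
        then have "cmod (f n z) \<le> N n" using bad(1)[of n] by (auto simp: adm_def)
        then have "cmod (g n z) \<le> 1" using N[of n] by (simp add: g_def norm_mult norm_divide)
        moreover have "0 \<le> (\<Sum>n<m. \<bar>sup_norm_on K (g n)\<bar>)" by (intro sum_nonneg) auto
        ultimately show ?thesis by linarith
      qed
      then show "\<exists>M. \<forall>f\<in>range g. \<forall>z\<in>K. cmod (f z) \<le> M" by blast
    qed
    from taylor_functional_bound_on_bounded[OF D this V] obtain C where C: "C \<ge> 0"
      "\<And>f S p M. f \<in> range g \<Longrightarrow> finite S \<Longrightarrow> (\<And>w. w \<in> V \<Longrightarrow> cmod (\<Sum>k\<in>S. p k * mpow w k) \<le> M) \<Longrightarrow>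
        cmod (\<Sum>k\<in>S. p k * (taylor_coeff f a k / complex_of_real (fantappie_weight 1 k))) \<le> C * M"
      by blast
    define n where "n = nat \<lceil>C\<rceil>"
    have n: "real n \<ge> C" unfolding n_def by linarith
    let ?s = "\<Sum>k\<in>S n. p n k * (taylor_coeff (f n) a k / complex_of_real (fantappie_weight 1 k))"
    have "(\<Sum>k\<in>S n. p n k * (taylor_coeff (g n) a k / complex_of_real (fantappie_weight 1 k))) =
        complex_of_real (1 / N n) * ?s"
      unfolding g_def taylor_coeff_cmult[OF fD D(2)] sum_distrib_left
          by (intro sum.cong) (auto simp: algebra_simps)
    moreover have "cmod (\<Sum>k\<in>S n. p n k *
        (taylor_coeff (g n) a k / complex_of_real (fantappie_weight 1 k))) \<le> C * M n"
      using bad(1)[of n] by (intro C(2)) (auto simp: adm_def)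
    ultimately have "cmod ?s / N n \<le> C * M n" using N[of n] by (simp add: norm_mult norm_divide)
    then have s_le: "cmod ?s \<le> C * M n * N n" using N[of n] by (simp add: field_simps)
    have "0 \<in> V" using V(2) zero_in_conjugate_set by blast
    then have "0 \<le> M n" using bad(1)[of n] norm_ge_zero order_trans unfolding adm_def by blast
    then have "C * M n * N n \<le> real n * M n * N n" using n N[of n] by (intro mult_right_mono) auto
    with s_le have "good n (f n) (N n) (S n) (p n) (M n)" by (simp add: good_def mult_ac)
    then show False using bad(2) by blast
  qed
  then obtain n where n: "\<And>f N S p M. adm n f N S p M \<Longrightarrow> good n f N S p M" by blast
  show ?thesis
    by (rule that[of "L n" "real n"]) (use L n in \<open>auto simp: adm_def good_def\<close>)
qed

section \<open>The weights of higher order\<close>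

lemma compact_conjugate_set:
  fixes E :: "(complex ^ 'n::finite) set"
  assumes E: "open E" "0 \<in> E"
  shows "compact (conjugate_set E)"
proof -
  obtain \<rho> where \<rho>: "\<rho> > 0" "polydisc 0 \<rho> \<subseteq> E" using polydisc_in_open[OF E] by blast
  have "norm w \<le> 1 / \<rho>" if "w \<in> conjugate_set E" for w
  proof -
    have "(\<Sum>\<nu>\<in>UNIV. cmod (w $ \<nu>)) * \<rho> < 1"
      using conjugate_set_polydisc[OF \<rho> that] by (simp add: cdot_def)
    then have "(\<Sum>\<nu>\<in>UNIV. cmod (w $ \<nu>)) \<le> 1 / \<rho>" using \<rho>(1) by (simp add: field_simps)
    then show ?thesis using norm_le_sum_components[of w] by linarith
  qed
  then have "bounded (conjugate_set E)" by (rule boundedI)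
  moreover have "open (- conjugate_set E)"
  proof -
    have "- conjugate_set E = (\<Union>z\<in>E. {w. cdot w z \<noteq> 0} \<inter> (\<lambda>w. (1 / cdot w z) *s z) -` E)"
    proof (intro equalityI subsetI)
      fix w assume "w \<in> - conjugate_set E"
      then obtain z where "z \<in> E" "cdot w z = 1" by (auto simp: conjugate_set_def)
      then show "w \<in> (\<Union>z\<in>E. {w. cdot w z \<noteq> 0} \<inter> (\<lambda>w. (1 / cdot w z) *s z) -` E)" by force
    next
      fix w assume "w \<in> (\<Union>z\<in>E. {w. cdot w z \<noteq> 0} \<inter> (\<lambda>w. (1 / cdot w z) *s z) -` E)"
      then obtain z where z: "cdot w z \<noteq> 0" "(1 / cdot w z) *s z \<in> E" by auto
      have "cdot w ((1 / cdot w z) *s z) = (1 / cdot w z) * cdot w z"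
        unfolding cdot_def by (simp add: sum_distrib_left mult.left_commute)
      then have "cdot w ((1 / cdot w z) *s z) = 1" using z by simp
      then show "w \<in> - conjugate_set E" using z(2) by (auto simp: conjugate_set_def)
    qed
    moreover have "open ({w. cdot w z \<noteq> 0} \<inter> (\<lambda>w. (1 / cdot w z) *s z) -` E)" for z
    proof (rule continuous_open_preimage[OF _ _ E(1)])
      show "continuous_on {w. cdot w z \<noteq> 0} (\<lambda>w. (1 / cdot w z) *s z)"
        unfolding vector_scalar_mult_def by (intro continuous_intros) auto
      show "open {w. cdot w z \<noteq> 0}" by (intro open_Collect_neq continuous_intros)
    qed
    ultimately show ?thesis by auto
  qed
  then have "closed (conjugate_set E)" by (simp add: closed_def)
  ultimately show ?thesis by (simp add: compact_eq_bounded_closed)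
qed

text \<open>A bound for a linear functional on polynomials, stated for an arbitrary presentation of the
  polynomial as a finite combination of monomials.\<close>

lemma functional_bound_family:
  fixes \<gamma> :: "'n::finite multiindex \<Rightarrow> complex"
  assumes bound: "\<And>S p M. finite S \<Longrightarrow> (\<And>w. w \<in> V \<Longrightarrow> cmod (\<Sum>k\<in>S. p k * mpow w k) \<le> M) \<Longrightarrow>
      cmod (\<Sum>k\<in>S. p k * \<gamma> k) \<le> C * M"
    and I: "finite I" and M: "\<And>w. w \<in> V \<Longrightarrow> cmod (\<Sum>i\<in>I. \<alpha> i * mpow w (\<kappa> i)) \<le> M"
  shows "cmod (\<Sum>i\<in>I. \<alpha> i * \<gamma> (\<kappa> i)) \<le> C * M"
proof -
  define p where "p k = (\<Sum>i | i \<in> I \<and> \<kappa> i = k. \<alpha> i)" for k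
  have regroup: "(\<Sum>i\<in>I. \<alpha> i * F (\<kappa> i)) = (\<Sum>k\<in>\<kappa> ` I. p k * F k)" for F :: "'n multiindex \<Rightarrow> complex"
    by (subst sum.image_gen[OF I, of _ \<kappa>]) (simp add: p_def sum_distrib_right)
  show ?thesis
    unfolding regroup by (rule bound) (use I M in \<open>simp_all add: regroup\<close>)
qed

lemma has_taylor_expansion_sum:
  assumes "finite I" "\<And>i. i \<in> I \<Longrightarrow> has_taylor_expansion (f i) (c i) a"
  shows "has_taylor_expansion (\<lambda>z. \<Sum>i\<in>I. f i z) (\<lambda>k. \<Sum>i\<in>I. c i k) a"
  using assms
proof (induction rule: finite_induct)
  case empty
  show ?case using has_taylor_expansion_finite[of "{}" "\<lambda>_. 0" a] by simp
next
  case (insert i I)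
  then show ?case by (simp add: has_taylor_expansion_add)
qed

text \<open>The Taylor coefficients of \<open>(y \<cdot> h)\<^sup>m / (1 - w \<cdot> h)\<close> at \<open>h = 0\<close>, read off from
  the powers of \<open>(w + \<tau> y) \<cdot> h\<close> as the coefficients of \<open>\<tau>\<^sup>m\<close>.  In degrees below \<open>m\<close>
  the quotient is zero divided by zero, which is zero, as it should be.\<close>

definition mixed_coeff :: "complex ^ 'n \<Rightarrow> complex ^ 'n \<Rightarrow> nat \<Rightarrow> 'n::finite multiindex \<Rightarrow> complex" where
  "mixed_coeff w y m q = complex_of_real (fantappie_weight 1 q) *
     Polynomial.coeff (\<Prod>\<nu>\<in>UNIV. [:w $ \<nu>, y $ \<nu>:] ^ q \<nu>) m / of_nat (mdeg q choose m)"

lemma poly_prod_linear: "poly (\<Prod>\<nu>\<in>UNIV. [:w $ \<nu>, y $ \<nu>:] ^ q \<nu>) \<tau> = mpow (w + \<tau> *s y) q"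
  by (simp add: poly_prod mpow_def)

lemma cdot_power_mult_power:
  "cdot y h ^ m * cdot w h ^ j = (\<Sum>q | mdeg q = j + m. mixed_coeff w y m q * mpow h q)"
proof -
  have "[:cdot w h, cdot y h:] ^ (j + m) = (\<Sum>q | mdeg q = j + m.
      Polynomial.smult (complex_of_real (fantappie_weight 1 q) * mpow h q) (\<Prod>\<nu>\<in>UNIV. [:w $ \<nu>, y $ \<nu>:] ^ q \<nu>))"
  proof (rule poly_eq_poly_eq_iff[THEN iffD1], rule ext)
    fix \<tau>
    have "poly ([:cdot w h, cdot y h:] ^ (j + m)) \<tau> = cdot (w + \<tau> *s y) h ^ (j + m)"
      by (simp add: cdot_add_left cdot_scale_left)
    then show "poly ([:cdot w h, cdot y h:] ^ (j + m)) \<tau> = poly (\<Sum>q | mdeg q = j + m.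
      Polynomial.smult (complex_of_real (fantappie_weight 1 q) * mpow h q) (\<Prod>\<nu>\<in>UNIV. [:w $ \<nu>, y $ \<nu>:] ^ q \<nu>)) \<tau>"
      unfolding cdot_power poly_sum poly_smult poly_prod_linear by (simp add: mult_ac)
  qed
  then have "Polynomial.coeff ([:cdot w h, cdot y h:] ^ (j + m)) m = (\<Sum>q | mdeg q = j + m.
      complex_of_real (fantappie_weight 1 q) * mpow h q * Polynomial.coeff (\<Prod>\<nu>\<in>UNIV. [:w $ \<nu>, y $ \<nu>:] ^ q \<nu>) m)"
    by (simp add: coeff_sum)
  then have "of_nat ((j + m) choose m) * (cdot y h ^ m * cdot w h ^ j) = (\<Sum>q | mdeg q = j + m.
      complex_of_real (fantappie_weight 1 q) * mpow h q * Polynomial.coeff (\<Prod>\<nu>\<in>UNIV. [:w $ \<nu>, y $ \<nu>:] ^ q \<nu>) m)"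
    by (simp add: coeff_linear_poly_power mult.assoc)
  then have "cdot y h ^ m * cdot w h ^ j = (\<Sum>q | mdeg q = j + m.
      complex_of_real (fantappie_weight 1 q) * mpow h q *
          Polynomial.coeff (\<Prod>\<nu>\<in>UNIV. [:w $ \<nu>, y $ \<nu>:] ^ q \<nu>) m) / of_nat ((j + m) choose m)"
    by (simp add: field_simps)
  then show ?thesis
    by (simp add: sum_divide_distrib mixed_coeff_def mult_ac)
qed

text \<open>The functional of order one for \<open>(y \<cdot> h)\<^sup>m / (1 - w \<cdot> h)\<close>, applied to
  \<open>(b \<cdot> v)\<^sup>m\<close> times the monomial \<open>v\<^sup>k\<close>: the factor \<open>b \<cdot> (w + \<tau> y) = \<tau>\<close> extracts the
  constant coefficient in \<open>\<tau>\<close>.\<close>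

lemma sum_mixed_coeff:
  assumes b: "cdot b w = 0" "cdot b y = 1"
  shows "(\<Sum>l | mdeg l = m. complex_of_real (fantappie_weight 1 l) * mpow b l *
      (mixed_coeff w y m (madd k l) / complex_of_real (fantappie_weight 1 (madd k l))))
    = mpow w k / of_nat ((mdeg k + m) choose m)"
proof -
  let ?\<Pi> = "\<lambda>q. \<Prod>\<nu>\<in>UNIV. [:w $ \<nu>, y $ \<nu>:] ^ q \<nu>"
  have "(\<Sum>l | mdeg l = m. Polynomial.smult (complex_of_real (fantappie_weight 1 l) *
      mpow b l) (?\<Pi> (madd k l))) = Polynomial.monom 1 m * ?\<Pi> k"
  proof (rule poly_eq_poly_eq_iff[THEN iffD1], rule ext)
    fix \<tau>
    have "cdot b (w + \<tau> *s y) = \<tau>"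
      using b by (simp add: cdot_def sum.distrib algebra_simps flip: sum_distrib_left)
    then have "\<tau> ^ m = (\<Sum>l | mdeg l = m. complex_of_real (fantappie_weight 1 l) *
        (mpow b l * mpow (w + \<tau> *s y) l))"
      using cdot_power[of b "w + \<tau> *s y" m] by simp
    then show "poly (\<Sum>l | mdeg l = m. Polynomial.smult (complex_of_real (fantappie_weight 1 l) *
        mpow b l) (?\<Pi> (madd k l))) \<tau> = poly (Polynomial.monom 1 m * ?\<Pi> k) \<tau>"
      unfolding poly_sum poly_smult poly_prod_linear poly_mult poly_monom mpow_madd
      by (simp add: sum_distrib_left sum_distrib_right mult_ac)
  qed
  from arg_cong[OF this, of "\<lambda>P. Polynomial.coeff P m"]
  have "(\<Sum>l | mdeg l = m. complex_of_real (fantappie_weight 1 l) * mpow b l *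
      Polynomial.coeff (?\<Pi> (madd k l)) m) = Polynomial.coeff (Polynomial.monom 1 m * ?\<Pi> k) m"
    by (simp only: Polynomial.coeff_sum Polynomial.coeff_smult)
  also have "\<dots> = mpow w k"
    using poly_prod_linear[of w y k 0] by (simp add: coeff_monom_mult poly_0_coeff_0)
  finally have *: "(\<Sum>l | mdeg l = m. complex_of_real (fantappie_weight 1 l) * mpow b l *
      Polynomial.coeff (?\<Pi> (madd k l)) m) = mpow w k" .
  have "(\<Sum>l | mdeg l = m. complex_of_real (fantappie_weight 1 l) * mpow b l *
      (mixed_coeff w y m (madd k l) / complex_of_real (fantappie_weight 1 (madd k l))))
    = (\<Sum>l | mdeg l = m. complex_of_real (fantappie_weight 1 l) * mpow b l *
        Polynomial.coeff (?\<Pi> (madd k l)) m / of_nat ((mdeg k + m) choose m))"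
  proof (rule sum.cong[OF refl])
    fix l :: "'a multiindex" assume "l \<in> {l. mdeg l = m}"
    then show "complex_of_real (fantappie_weight 1 l) * mpow b l *
      (mixed_coeff w y m (madd k l) / complex_of_real (fantappie_weight 1 (madd k l))) =
      complex_of_real (fantappie_weight 1 l) * mpow b l *
          Polynomial.coeff (?\<Pi> (madd k l)) m / of_nat ((mdeg k + m) choose m)"
      using fantappie_weight_pos[of 1 "madd k l"] by (simp add: mixed_coeff_def mdeg_madd)
  qed
  then show ?thesis by (simp only: sum_divide_distrib[symmetric] *)
qed

text \<open>The only place where a second variable is needed.\<close>

lemma exists_orthogonal_vector:
  fixes w :: "complex ^ 'n::finite"
  assumes "CARD('n) \<ge> 2"
  obtains b y :: "complex ^ 'n" where "cdot b w = 0" "cdot b y = 1"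
    "\<And>\<nu>. cmod (b $ \<nu>) \<le> 1" "\<And>\<nu>. cmod (y $ \<nu>) \<le> 1"
proof -
  obtain \<mu>0 \<nu>0 :: 'n where "\<mu>0 \<noteq> \<nu>0"
    using assms card_le_Suc0_iff_eq[of "UNIV :: 'n set"] by fastforce
  then obtain \<mu> \<nu> where \<mu>\<nu>: "\<mu> \<noteq> \<nu>" "cmod (w $ \<mu>) \<le> cmod (w $ \<nu>)"
    using linear[of "cmod (w $ \<mu>0)" "cmod (w $ \<nu>0)"] by metis
  define b :: "complex ^ 'n" where "b = (\<chi> i. if i = \<mu> then 1 else if i = \<nu> then - (w $ \<mu> / w $ \<nu>) else 0)"
  define y :: "complex ^ 'n" where "y = (\<chi> i. if i = \<mu> then 1 else 0)"
  have "cdot b w = (\<Sum>i\<in>{\<mu>, \<nu>}. b $ i * w $ i)"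
    unfolding cdot_def by (rule sum.mono_neutral_right) (auto simp: b_def)
  also have "\<dots> = w $ \<mu> - w $ \<mu> / w $ \<nu> * w $ \<nu>" using \<mu>\<nu>(1) by (simp add: b_def)
  also have "\<dots> = 0" using \<mu>\<nu>(2) by (cases "w $ \<nu> = 0") auto
  finally have "cdot b w = 0" .
  moreover have "cdot b y = (\<Sum>i\<in>{\<mu>}. b $ i * y $ i)"
    unfolding cdot_def by (rule sum.mono_neutral_right) (auto simp: y_def)
  then have "cdot b y = 1" by (simp add: b_def y_def)
  moreover have "cmod (b $ i) \<le> 1" for i
    using \<mu>\<nu>(2) by (cases "w $ \<nu> = 0") (auto simp: b_def norm_divide divide_le_eq_1)
  moreover have "cmod (y $ i) \<le> 1" for i by (simp add: y_def)
  ultimately show ?thesis using that by blast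
qed

lemma fantappie_weight_Suc:
  "fantappie_weight (Suc m) k = fantappie_weight 1 k * real ((mdeg k + m) choose m)"
proof -
  have "real ((mdeg k + m) choose m) = fact (mdeg k + m) / (fact m * fact (mdeg k))"
    using binomial_fact[of m "mdeg k + m", where ?'a = real] by simp
  then show ?thesis by (simp add: fantappie_weight_def)
qed

text \<open>A substitute for \<open>(y \<cdot> h)\<^sup>m / (1 - w \<cdot> h)\<close>, with \<open>h = z - a\<close>, when \<open>w = w' + x\<close> is only close to
  a point \<open>w'\<close> of the conjugate set: the partial sum of its expansion in powers of \<open>x \<cdot> h\<close>.  It is
  analytic on all of \<open>D\<close> and has the same Taylor coefficients up to degree \<open>J\<close>.\<close>

definition approx_kernel ::
    "complex ^ 'n \<Rightarrow> complex ^ 'n \<Rightarrow> complex ^ 'n \<Rightarrow> nat \<Rightarrow> nat \<Rightarrow> complex ^ 'n \<Rightarrow> complex ^ 'n::finite \<Rightarrow> complex"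
        where
  "approx_kernel w' x y m J a z = cdot y (z - a) ^ m *
     (\<Sum>i\<le>J. cdot x (z - a) ^ i * (1 / ((1 + cdot w' a) - cdot w' z)) ^ Suc i)"

lemma analytic_in_approx_kernel:
  assumes "w' \<in> conjugate_set ((\<lambda>z. z - a) ` D)"
  shows "analytic_in (approx_kernel w' x y m J a) D"
proof -
  have "analytic_in (\<lambda>z. (cdot y z + - cdot y a) ^ m *
     (\<Sum>i\<le>J. (cdot x z + - cdot x a) ^ i * (1 / ((1 + cdot w' a) - cdot w' z)) ^ Suc i)) D"
    using assms
    by (intro analytic_in_sum analytic_in_mult analytic_in_power analytic_in_add analytic_in_cdot
        analytic_in_const analytic_in_inverse_affine) (auto simp: conjugate_set_def cdot_diff_right diff_eq_eq)
  then show ?thesis by (simp add: approx_kernel_def[abs_def] cdot_diff_right)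
qed

lemma sum_geometric_complex:
  fixes q :: complex
  shows "(1 - q) * (\<Sum>i\<le>J. q ^ i) = 1 - q ^ Suc J"
  using one_diff_power_eq[of q "Suc J"] by (simp add: lessThan_Suc_atMost)

text \<open>The kernel and the corresponding partial sum \<open>A\<close> of the Taylor series differ by a function
  that vanishes at \<open>a\<close> to an order larger than \<open>J\<close>.\<close>

lemma taylor_coeff_approx_kernel:
  fixes D :: "(complex ^ 'n::finite) set"
  assumes D: "open D" "a \<in> D" and w': "w' \<in> conjugate_set ((\<lambda>z. z - a) ` D)" and q: "mdeg q \<le> J"
  shows "taylor_coeff (approx_kernel w' x y m J a) a q = mixed_coeff (w' + x) y m q"
proof -
  define w where "w = w' + x"
  define A where "A z = (\<Sum>j\<le>J. cdot y (z - a) ^ m * cdot w (z - a) ^ j)" for z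
  define g where "g = approx_kernel w' x y m J a"
  have A_taylor: "has_taylor_expansion A (\<lambda>k. \<Sum>j\<le>J.
      if k \<in> {k. mdeg k = j + m} then mixed_coeff w y m k else 0) a"
    unfolding A_def[abs_def] cdot_power_mult_power
    by (intro has_taylor_expansion_sum has_taylor_expansion_finite) auto
  have g_an: "analytic_in g D" unfolding g_def by (rule analytic_in_approx_kernel[OF w'])
  have A_an: "analytic_in A D"
  proof -
    have "analytic_in (\<lambda>z. \<Sum>j\<le>J. (cdot y z + - cdot y a) ^ m * (cdot w z + - cdot w a) ^ j) D"
      by (intro analytic_in_sum analytic_in_mult analytic_in_power analytic_in_add analytic_in_cdot
          analytic_in_const)
    then show ?thesis by (simp add: A_def[abs_def] cdot_diff_right)
  qed
  define d where "d z = g z + - 1 * A z" for z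
  have d_an: "analytic_in d D"
    unfolding d_def[abs_def] by (intro analytic_in_add analytic_in_cmult g_an A_an)
  have d_taylor: "has_taylor_expansion d (\<lambda>k. taylor_coeff g a k + - 1 *
      (\<Sum>j\<le>J. if k \<in> {k. mdeg k = j + m} then mixed_coeff w y m k else 0)) a"
    unfolding d_def[abs_def]
    by (intro has_taylor_expansion_add has_taylor_expansion_cmult A_taylor
        has_taylor_expansion_taylor_coeff[OF g_an D(2)])
  define W where "W u = (\<Sum>\<nu>\<in>UNIV. cmod (u $ \<nu>))" for u :: "complex ^ 'n"
  have W0: "W u \<ge> 0" for u by (simp add: W_def sum_nonneg)
  obtain r0 where r0: "r0 > 0" "polydisc a r0 \<subseteq> D" using polydisc_in_open[OF D] by blast
  define r where "r = min (min r0 1) (1 / (2 * (W w + W w' + 1)))"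
  have r: "r > 0" "r \<le> 1" "r \<le> r0" using r0 W0[of w] W0[of w'] by (auto simp: r_def add_nonneg_pos)
  have rW: "W u * \<rho> \<le> 1 / 2" if "u = w \<or> u = w'" "0 < \<rho>" "\<rho> \<le> r" for u \<rho>
  proof -
    have "W u * \<rho> \<le> (W w + W w' + 1) * (1 / (2 * (W w + W w' + 1)))"
      using that W0[of w] W0[of w'] by (intro mult_mono) (auto simp: r_def)
    also have "\<dots> = 1 / 2" using W0[of w] W0[of w'] by (simp add: add_nonneg_pos)
    finally show ?thesis .
  qed
  let ?C = "W y ^ m * (W w ^ Suc J + (2 * W x) ^ Suc J) * 2"
  have "cmod (d z) \<le> ?C * \<rho> ^ Suc J" if \<rho>: "0 < \<rho>" "\<rho> \<le> r" and z: "z \<in> polydisc a \<rho>" for \<rho> z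
  proof -
    define h where "h = z - a"
    have h: "cmod (cdot u h) \<le> W u * \<rho>" for u
      unfolding W_def using z by (intro norm_cdot_le) (auto simp: h_def polydisc_def)
    have small: "cmod (cdot w h) \<le> 1 / 2" "cmod (cdot w' h) \<le> 1 / 2"
      using h[of w] h[of w'] rW[of w \<rho>] rW[of w' \<rho>] \<rho> by auto
    define X where "X = cdot w h"
    define X' where "X' = cdot w' h"
    define \<xi> where "\<xi> = cdot x h"
    have XX: "X = X' + \<xi>" by (simp add: X_def X'_def \<xi>_def w_def cdot_add_left)
    have low: "cmod (1 - X) \<ge> 1 / 2" "cmod (1 - X') \<ge> 1 / 2"
      using small norm_triangle_ineq2[of 1 X] norm_triangle_ineq2[of 1 X'] by (auto simp: X_def X'_def)
    then have nz: "1 - X \<noteq> 0" "1 - X' \<noteq> 0" by auto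
    define Y where "Y = \<xi> / (1 - X')"
    have Y: "1 - Y = (1 - X) / (1 - X')" using nz by (simp add: Y_def XX field_simps)
    have "g z = cdot y h ^ m * (\<Sum>i\<le>J. \<xi> ^ i * (1 / (1 - X')) ^ Suc i)"
      by (simp add: g_def approx_kernel_def h_def \<xi>_def X'_def cdot_diff_right algebra_simps)
    also have "(\<Sum>i\<le>J. \<xi> ^ i * (1 / (1 - X')) ^ Suc i) = (\<Sum>i\<le>J. Y ^ i) / (1 - X')"
      unfolding sum_divide_distrib by (intro sum.cong) (auto simp: Y_def power_divide)
    also have "(\<Sum>i\<le>J. Y ^ i) = (1 - Y ^ Suc J) / (1 - Y)"
      using sum_geometric_complex[of Y J] nz by (simp add: Y field_simps)
    also have "(1 - Y ^ Suc J) / (1 - Y) / (1 - X') = (1 - Y ^ Suc J) / (1 - X)"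
      using nz by (simp add: Y)
    finally have gz: "g z = cdot y h ^ m * ((1 - Y ^ Suc J) / (1 - X))" .
    have "A z = cdot y h ^ m * (\<Sum>j\<le>J. X ^ j)"
      by (simp add: A_def h_def X_def sum_distrib_left)
    also have "(\<Sum>j\<le>J. X ^ j) = (1 - X ^ Suc J) / (1 - X)"
      using sum_geometric_complex[of X J] nz by (simp add: field_simps)
    finally have "d z = cdot y h ^ m * ((X ^ Suc J - Y ^ Suc J) / (1 - X))"
      unfolding d_def gz by (simp add: diff_divide_distrib algebra_simps)
    then have "cmod (d z) = cmod (cdot y h) ^ m * (cmod (X ^ Suc J - Y ^ Suc J) / cmod (1 - X))"
      by (simp only: norm_mult norm_divide norm_power)
    also have "\<dots> \<le> W y ^ m * (((W w * \<rho>) ^ Suc J + (2 * W x * \<rho>) ^ Suc J) / (1 / 2))"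
    proof (intro mult_mono frac_le)
      have "W y * \<rho> \<le> W y" using W0[of y] \<rho> r by (simp add: mult_left_le)
      then have "cmod (cdot y h) \<le> W y" using h[of y] by linarith
      then show "cmod (cdot y h) ^ m \<le> W y ^ m" by (intro power_mono) auto
      have "cmod \<xi> \<le> W x * \<rho>" using h[of x] by (simp add: \<xi>_def)
      then have "cmod Y \<le> (W x * \<rho>) / (1 / 2)"
        unfolding Y_def norm_divide using low W0[of x] \<rho> by (intro frac_le) auto
      then have "cmod Y \<le> 2 * W x * \<rho>" by simp
      then have "cmod Y ^ Suc J \<le> (2 * W x * \<rho>) ^ Suc J" by (intro power_mono) auto
      moreover have "cmod X ^ Suc J \<le> (W w * \<rho>) ^ Suc J"
        using h[of w] by (intro power_mono) (auto simp: X_def)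
      ultimately show "cmod (X ^ Suc J - Y ^ Suc J) \<le> (W w * \<rho>) ^ Suc J + (2 * W x * \<rho>) ^ Suc J"
        using norm_triangle_ineq4[of "X ^ Suc J" "Y ^ Suc J"] by (simp only: norm_power)
    qed (use low W0 \<rho> in auto)
    also have "\<dots> = ?C * \<rho> ^ Suc J"
      by (simp add: power_mult_distrib algebra_simps)
    finally show ?thesis .
  qed
  from taylor_coeff_eq_0_of_order[OF d_an d_taylor r(1) _ this, of q]
  have "taylor_coeff g a q = (\<Sum>j\<le>J. if q \<in> {k. mdeg k = j + m} then mixed_coeff w y m q else 0)"
    using polydisc_mono[OF r(3), of a] r0(2) q by auto
  also have "\<dots> = mixed_coeff w y m q"
  proof (cases "m \<le> mdeg q")
    case True
    then have "(\<Sum>j\<le>J. if q \<in> {k. mdeg k = j + m} then mixed_coeff w y m q else 0) =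
        (\<Sum>j\<le>J. if j = mdeg q - m then mixed_coeff w y m q else 0)"
      by (intro sum.cong) auto
    then show ?thesis using q by simp
  qed (simp add: mixed_coeff_def)
  finally show ?thesis by (simp add: g_def w_def)
qed

text \<open>Dividing the coefficients of a polynomial by the extra binomial weights is an operation
  bounded in the sup norms over neighbourhoods of the conjugate set.\<close>

lemma weighted_polynomial_bound:
  fixes D :: "(complex ^ 'n::finite) set"
  assumes D: "strictly_linearly_convex_domain D" "a \<in> D" and n: "CARD('n) \<ge> 2"
    and V: "open V" "conjugate_set ((\<lambda>z. z - a) ` D) \<subseteq> V"
  obtains U C where "open U" "conjugate_set ((\<lambda>z. z - a) ` D) \<subseteq> U" "C \<ge> 0"
    "\<And>S p M w. finite S \<Longrightarrow> (\<And>w. w \<in> V \<Longrightarrow> cmod (\<Sum>k\<in>S. p k * mpow w k) \<le> M) \<Longrightarrow> w \<in> U \<Longrightarrow>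
      cmod (\<Sum>k\<in>S. p k / of_nat ((mdeg k + m) choose m) * mpow w k) \<le> C * M"
proof -
  let ?Ka = "conjugate_set ((\<lambda>z. z - a) ` D)"
  have op: "open D" using D by (auto simp: strictly_linearly_convex_domain_def)
  have Ka: "compact ?Ka"
    using D(2) op by (intro compact_conjugate_set open_translation_subtract) auto
  then obtain R0 where R0: "R0 > 0" "?Ka \<subseteq> ball 0 R0"
    using bounded_subset_ballD[OF compact_imp_bounded[OF Ka], of 0] by blast
  define V' where "V' = V \<inter> ball 0 R0"
  have "open V'" "?Ka \<subseteq> V'" using V R0 by (auto simp: V'_def)
  from taylor_functional_bound_equicontinuous[OF D this]
  obtain L C where L: "compact L" "L \<subseteq> D" and C: "C \<ge> 0" and
    bound: "\<And>f N S p M. f \<in> hol_space D \<Longrightarrow> N > 0 \<Longrightarrow> (\<And>z. z \<in> L \<Longrightarrow> cmod (f z) \<le> N) \<Longrightarrow> finite S \<Longrightarrow>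
    (\<And>w. w \<in> V' \<Longrightarrow> cmod (\<Sum>k\<in>S. p k * mpow w k) \<le> M) \<Longrightarrow>
    cmod (\<Sum>k\<in>S. p k * (taylor_coeff f a k / complex_of_real (fantappie_weight 1 k))) \<le> C * N * M"
    by blast
  define n' where "n' = real CARD('n)"
  have n': "n' \<ge> 1" using n by (simp add: n'_def)
  obtain R where R: "R > 0" "\<And>z. z \<in> L \<Longrightarrow> norm (z - a) \<le> R"
  proof -
    have "bounded ((\<lambda>z. z - a) ` L)" using compact_imp_bounded[OF L(1)] by (rule bounded_translation_minus)
    then show ?thesis using that by (auto simp: bounded_pos)
  qed
  have "compact (?Ka \<times> insert a L)" using Ka L by (intro compact_Times) auto
  moreover have "continuous_on (?Ka \<times> insert a L) (\<lambda>(w, z). cmod (1 - cdot w (z - a)))"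
    unfolding case_prod_unfold by (intro continuous_intros)
  moreover have "?Ka \<times> insert a L \<noteq> {}" using zero_in_conjugate_set by blast
  ultimately have "\<exists>x0\<in>?Ka \<times> insert a L. \<forall>x\<in>?Ka \<times> insert a L.
      (case x0 of (w, z) \<Rightarrow> cmod (1 - cdot w (z - a))) \<le> (case x of (w, z) \<Rightarrow> cmod (1 - cdot w (z - a)))"
    by (intro continuous_attains_inf)
  then obtain w0 z0 where wz0: "w0 \<in> ?Ka" "z0 \<in> insert a L"
    "\<forall>w\<in>?Ka. \<forall>z\<in>insert a L. cmod (1 - cdot w0 (z0 - a)) \<le> cmod (1 - cdot w (z - a))"
    unfolding split_paired_Bex_Sigma split_paired_Ball_Sigma prod.case by blast
  define c where "c = cmod (1 - cdot w0 (z0 - a)) / 2"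
  have "z0 \<in> D" using wz0(2) L(2) D(2) by auto
  then have "cdot w0 (z0 - a) \<noteq> 1" using wz0(1) by (auto simp: conjugate_set_def)
  then have c: "c > 0" by (simp add: c_def)
  have c_le: "2 * c \<le> cmod (1 - cdot w (z - a))" if "w \<in> ?Ka" "z \<in> L" for w z
    using wz0(3) that by (simp add: c_def)
  \<comment> \<open>For \<open>w'\<close> in the conjugate set and \<open>x\<close> of norm below \<open>\<delta>\<close>,
      the ratio of \<open>x \<cdot> h\<close> to \<open>1 - w' \<cdot> h\<close> is at most one
    half on \<open>L\<close>, so the kernels are bounded there independently of their length \<open>J\<close>.\<close>
  define \<delta> where "\<delta> = c / (n' * R)"
  have \<delta>: "\<delta> > 0" using c n' R by (simp add: \<delta>_def)
  define U where "U = (\<Union>w\<in>?Ka. ball w \<delta>)"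
  define N where "N = (n' * R) ^ m / c + 1"
  have N: "N > 0" unfolding N_def using n' R c by (intro add_nonneg_pos divide_nonneg_pos) auto
  show ?thesis
  proof (rule that[of U "C * N * (n' * R0) ^ m"])
    show "open U" "?Ka \<subseteq> U" using \<delta> by (auto simp: U_def)
    show "C * N * (n' * R0) ^ m \<ge> 0" using C N n' R0 by simp
    fix S M w and p :: "'n multiindex \<Rightarrow> complex"
    assume S: "finite S" and M: "\<And>w. w \<in> V \<Longrightarrow> cmod (\<Sum>k\<in>S. p k * mpow w k) \<le> M" and w: "w \<in> U"
    obtain w' where w': "w' \<in> ?Ka" "dist w' w < \<delta>" using w by (auto simp: U_def)
    define x where "x = w - w'"
    obtain b y :: "complex ^ 'n" where b: "cdot b w = 0" "cdot b y = 1"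
      and b_le: "\<And>\<nu>. cmod (b $ \<nu>) \<le> 1" and y_le: "\<And>\<nu>. cmod (y $ \<nu>) \<le> 1"
      using exists_orthogonal_vector[OF n] by blast
    define J where "J = (\<Sum>k\<in>S. mdeg k) + m"
    define g where "g = restrict0 D (approx_kernel w' x y m J a)"
    have g_an: "analytic_in (approx_kernel w' x y m J a) D" by (rule analytic_in_approx_kernel[OF w'(1)])
    have gD: "g \<in> hol_space D" unfolding g_def by (rule restrict0_hol_space[OF op g_an])
    have coeff: "taylor_coeff g a q = mixed_coeff w y m q" if "mdeg q \<le> J" for q
    proof -
      have "taylor_coeff g a = taylor_coeff (approx_kernel w' x y m J a) a"
        unfolding g_def
        by (intro taylor_coeffI has_taylor_expansion_restrict0 op D has_taylor_expansion_taylor_coeff[OF g_an])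
      then show ?thesis using taylor_coeff_approx_kernel[OF op D(2) w'(1) that, of x y m] by (simp add: x_def)
    qed
    have unit_le: "cmod (cdot u h) \<le> n' * r" if "\<And>\<nu>. cmod (u $ \<nu>) \<le> 1" "norm h \<le> r"
        for u h :: "complex ^ 'n" and r
    proof -
      have "cmod (cdot u h) \<le> (\<Sum>\<nu>\<in>UNIV. cmod (u $ \<nu>)) * r"
        by (rule norm_cdot_le, rule order_trans[OF Finite_Cartesian_Product.norm_nth_le that(2)])
      also have "\<dots> \<le> n' * r"
        using sum_mono[of UNIV "\<lambda>\<nu>. cmod (u $ \<nu>)" "\<lambda>_. 1"] that order_trans[OF norm_ge_zero that(2)]
        by (intro mult_right_mono) (auto simp: n'_def)
      finally show ?thesis .
    qed
    have g_le: "cmod (g z) \<le> N" if z: "z \<in> L" for z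
    proof -
      define h where "h = z - a"
      have h: "norm h \<le> R" using R z by (simp add: h_def)
      have y_h: "cmod (cdot y h) \<le> n' * R" using unit_le[OF y_le h] .
      have x_h: "cmod (cdot x h) \<le> c"
      proof -
        have "cmod (x $ \<nu>) \<le> \<delta>" for \<nu>
          using w'(2) Finite_Cartesian_Product.norm_nth_le[of x \<nu>]
              by (simp add: x_def dist_norm norm_minus_commute)
        then have "(\<Sum>\<nu>\<in>UNIV. cmod (x $ \<nu>)) \<le> n' * \<delta>"
          using sum_mono[of UNIV "\<lambda>\<nu>. cmod (x $ \<nu>)" "\<lambda>_. \<delta>"] by (simp add: n'_def)
        moreover have "cmod (cdot x h) \<le> (\<Sum>\<nu>\<in>UNIV. cmod (x $ \<nu>)) * R"
          by (rule norm_cdot_le, rule order_trans[OF Finite_Cartesian_Product.norm_nth_le h])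
        ultimately have "cmod (cdot x h) \<le> n' * \<delta> * R"
          using mult_right_mono[of "\<Sum>\<nu>\<in>UNIV. cmod (x $ \<nu>)" "n' * \<delta>" R] R(1) by linarith
        also have "\<dots> = c" using n' R by (simp add: \<delta>_def)
        finally show ?thesis .
      qed
      define B where "B = cmod (1 - cdot w' h)"
      have B: "2 * c \<le> B" using c_le[OF w'(1) z] by (simp add: B_def h_def)
      have "g z = cdot y h ^ m * (\<Sum>i\<le>J. cdot x h ^ i * (1 / (1 - cdot w' h)) ^ Suc i)"
        using z L(2) by (auto simp: g_def restrict0_def approx_kernel_def h_def cdot_diff_right algebra_simps)
      then have "cmod (g z) = cmod (cdot y h) ^ m * cmod (\<Sum>i\<le>J. cdot x h ^ i * (1 / (1 - cdot w' h)) ^ Suc i)"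
        by (simp only: norm_mult norm_power)
      also have "\<dots> \<le> cmod (cdot y h) ^ m * (\<Sum>i\<le>J. cmod (cdot x h) ^ i * (1 / B) ^ Suc i)"
        unfolding B_def
        by (intro mult_left_mono order_trans[OF norm_sum] sum_mono)
            (auto simp: norm_mult norm_power norm_divide)
      also have "\<dots> \<le> (n' * R) ^ m * (\<Sum>i\<le>J. c ^ i * (1 / (2 * c)) ^ Suc i)"
        using y_h x_h B c n' R
        by (intro mult_mono sum_mono power_mono frac_le) (auto intro!: sum_nonneg)
      also have "(\<Sum>i\<le>J. c ^ i * (1 / (2 * c)) ^ Suc i) = (\<Sum>i\<le>J. (1 / 2) ^ i) / (2 * c)"
        unfolding sum_divide_distrib using c by (intro sum.cong) (auto simp: power_divide power_mult_distrib)
      also have "(\<Sum>i\<le>J. (1 / 2 :: real) ^ i) = 2 - 2 * (1 / 2) ^ Suc J"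
        using one_diff_power_eq[of "1 / 2 :: real" "Suc J"] by (simp add: lessThan_Suc_atMost)
      also have "(n' * R) ^ m * ((2 - 2 * (1 / 2) ^ Suc J) / (2 * c)) \<le> (n' * R) ^ m * (2 / (2 * c))"
        using n' R c by (intro mult_left_mono divide_right_mono) auto
      also have "\<dots> \<le> N" using c by (simp add: N_def)
      finally show ?thesis .
    qed
    let ?l1 = "\<lambda>k. complex_of_real (fantappie_weight 1 k)"
    define I where "I = {l :: 'n multiindex. mdeg l = m} \<times> S"
    define \<alpha> where "\<alpha> = (\<lambda>(l, k). ?l1 l * mpow b l * p k)"
    define \<kappa> where "\<kappa> = (\<lambda>(l :: 'n multiindex, k). madd k l)"
    have I: "finite I" using S by (simp add: I_def)
    have expand: "(\<Sum>i\<in>I. \<alpha> i * mpow v (\<kappa> i)) = cdot b v ^ m * (\<Sum>k\<in>S. p k * mpow v k)" for v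
      unfolding cdot_power sum_product sum.cartesian_product I_def
      by (intro sum.cong) (auto simp: \<alpha>_def \<kappa>_def mpow_madd)
    have poly_le: "cmod (\<Sum>i\<in>I. \<alpha> i * mpow v (\<kappa> i)) \<le> (n' * R0) ^ m * M" if v: "v \<in> V'" for v
    proof -
      have "norm v \<le> R0" using v by (simp add: V'_def)
      then have "cmod (cdot b v) ^ m \<le> (n' * R0) ^ m"
        using unit_le[OF b_le] by (intro power_mono) auto
      moreover have "cmod (\<Sum>k\<in>S. p k * mpow v k) \<le> M" using M v by (simp add: V'_def)
      ultimately show ?thesis
        unfolding expand norm_mult norm_power using n' R0 by (intro mult_mono) auto
    qed
    have "cmod (\<Sum>i\<in>I. \<alpha> i * (taylor_coeff g a (\<kappa> i) / ?l1 (\<kappa> i))) \<le> C * N * ((n' * R0) ^ m * M)"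
      by (rule functional_bound_family[where \<gamma> = "\<lambda>k. taylor_coeff g a k / ?l1 k" and V = V' and C = "C *
          N", OF _ I poly_le])
         (rule bound[OF gD N g_le])
    also have "(\<Sum>i\<in>I. \<alpha> i * (taylor_coeff g a (\<kappa> i) / ?l1 (\<kappa> i))) =
        (\<Sum>k\<in>S. \<Sum>l | mdeg l = m. ?l1 l * mpow b l * p k * (taylor_coeff g a (madd k l) / ?l1 (madd k l)))"
      by (subst sum.swap) (simp add: I_def \<alpha>_def \<kappa>_def sum.cartesian_product case_prod_unfold)
    also have "\<dots> = (\<Sum>k\<in>S. p k / of_nat ((mdeg k + m) choose m) * mpow w k)"
    proof (rule sum.cong[OF refl])
      fix k assume k: "k \<in> S"
      have "mdeg k \<le> (\<Sum>k\<in>S. mdeg k)" using S k by (intro member_le_sum) auto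
      then have "taylor_coeff g a (madd k l) = mixed_coeff w y m (madd k l)" if "mdeg l = m" for l
        using that by (intro coeff) (simp add: mdeg_madd J_def)
      then have "(\<Sum>l | mdeg l = m. ?l1 l * mpow b l * p k * (taylor_coeff g a (madd k l) / ?l1 (madd k l))) =
          p k * (\<Sum>l | mdeg l = m. ?l1 l * mpow b l * (mixed_coeff w y m (madd k l) / ?l1 (madd k l)))"
        unfolding sum_distrib_left by (intro sum.cong) auto
      then show "(\<Sum>l | mdeg l = m. ?l1 l * mpow b l * p k * (taylor_coeff g a (madd k l) / ?l1 (madd k l))) =
          p k / of_nat ((mdeg k + m) choose m) * mpow w k"
        unfolding sum_mixed_coeff[OF b] by simp
    qed
    finally show "cmod (\<Sum>k\<in>S. p k / of_nat ((mdeg k + m) choose m) * mpow w k) \<le> C * N * (n' * R0) ^ m * M"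
      by (simp only: mult.assoc)
  qed
qed

lemma hol_bounded_singleton:
  assumes "f \<in> hol_space D"
  shows "hol_bounded D {f}"
  unfolding hol_bounded_def
  using assms norm_le_sup_norm_on[of f D] by (auto simp: hol_space_def)

lemma taylor_functional_bound_single:
  fixes D :: "(complex ^ 'n::finite) set"
  assumes D: "strictly_linearly_convex_domain D" "a \<in> D" and f: "f \<in> hol_space D"
    and V: "open V" "conjugate_set ((\<lambda>z. z - a) ` D) \<subseteq> V"
  obtains C where "C \<ge> 0" "\<And>S p M. finite S \<Longrightarrow>
    (\<And>w. w \<in> V \<Longrightarrow> cmod (\<Sum>k\<in>S. p k * mpow w k) \<le> M) \<Longrightarrow>
    cmod (\<Sum>k\<in>S. p k * (taylor_coeff f a k / complex_of_real (fantappie_weight 1 k))) \<le> C * M"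
proof (rule taylor_functional_bound_on_bounded[OF D hol_bounded_singleton[OF f] V])
  fix C :: real
  assume C: "C \<ge> 0" and bound: "\<And>f' S p M. f' \<in> {f} \<Longrightarrow> finite S \<Longrightarrow>
    (\<And>w. w \<in> V \<Longrightarrow> cmod (\<Sum>k\<in>S. p k * mpow w k) \<le> M) \<Longrightarrow>
    cmod (\<Sum>k\<in>S. p k * (taylor_coeff f' a k / complex_of_real (fantappie_weight 1 k))) \<le> C * M"
  show thesis
    by (rule that[OF C]) (rule bound[OF singletonI])
qed

lemma weighted_taylor_functional_bound:
  fixes D :: "(complex ^ 'n::finite) set"
  assumes D: "strictly_linearly_convex_domain D" "a \<in> D" and f: "f \<in> hol_space D"
    and s: "s \<in> {1..CARD('n)}"
    and V: "open V" "conjugate_set ((\<lambda>z. z - a) ` D) \<subseteq> V"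
  obtains C where "C \<ge> 0" "\<And>S p M. finite S \<Longrightarrow>
    (\<And>w. w \<in> V \<Longrightarrow> cmod (\<Sum>k\<in>S. p k * mpow w k) \<le> M) \<Longrightarrow>
    cmod (\<Sum>k\<in>S. p k * (taylor_coeff f a k / complex_of_real (fantappie_weight s k))) \<le> C * M"
proof (cases "s = 1")
  case True
  show ?thesis
  proof (rule taylor_functional_bound_single[OF D f V])
    fix C :: real
    assume C: "C \<ge> 0" and bound: "\<And>S p M. finite S \<Longrightarrow>
      (\<And>w. w \<in> V \<Longrightarrow> cmod (\<Sum>k\<in>S. p k * mpow w k) \<le> M) \<Longrightarrow>
      cmod (\<Sum>k\<in>S. p k * (taylor_coeff f a k / complex_of_real (fantappie_weight 1 k))) \<le> C * M"
    show thesis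
      by (rule that[OF C]) (unfold True, rule bound)
  qed
next
  case False
  define m where "m = s - 1"
  have m: "s = Suc m" "CARD('n) \<ge> 2" using s False by (auto simp: m_def)
  show ?thesis
  proof (rule weighted_polynomial_bound[OF D m(2) V, of m])
    fix U and C :: real
    assume U: "open U" "conjugate_set ((\<lambda>z. z - a) ` D) \<subseteq> U" and C: "C \<ge> 0"
      and weighted: "\<And>S p M w. finite S \<Longrightarrow> (\<And>w. w \<in> V \<Longrightarrow> cmod (\<Sum>k\<in>S. p k * mpow w k) \<le> M) \<Longrightarrow>
        w \<in> U \<Longrightarrow> cmod (\<Sum>k\<in>S. p k / of_nat ((mdeg k + m) choose m) * mpow w k) \<le> C * M"
    show thesis
    proof (rule taylor_functional_bound_single[OF D f U])
      fix C' :: real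
      assume C': "C' \<ge> 0" and bound: "\<And>S p M. finite S \<Longrightarrow>
        (\<And>w. w \<in> U \<Longrightarrow> cmod (\<Sum>k\<in>S. p k * mpow w k) \<le> M) \<Longrightarrow>
        cmod (\<Sum>k\<in>S. p k * (taylor_coeff f a k / complex_of_real (fantappie_weight 1 k))) \<le> C' * M"
      show thesis
      proof (rule that[of "C' * C"])
        show "C' * C \<ge> 0" using C C' by simp
        fix S M and p :: "'n multiindex \<Rightarrow> complex"
        assume S: "finite S" and M: "\<And>w. w \<in> V \<Longrightarrow> cmod (\<Sum>k\<in>S. p k * mpow w k) \<le> M"
        have "cmod (\<Sum>k\<in>S. p k / of_nat ((mdeg k + m) choose m) *
            (taylor_coeff f a k / complex_of_real (fantappie_weight 1 k))) \<le> C' * (C * M)"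
          by (rule bound[OF S], rule weighted[OF S M])
        then show "cmod (\<Sum>k\<in>S. p k * (taylor_coeff f a k / complex_of_real (fantappie_weight s k))) \<le> C' *
            C * M"
          by (simp add: m(1) fantappie_weight_Suc[of m] mult_ac)
      qed
    qed
  qed
qed

section \<open>Monic polynomials for a graded monomial order\<close>

text \<open>An arbitrary numbering of the variables.\<close>

definition coordinate_rank :: "'n::finite \<Rightarrow> nat" where
  "coordinate_rank = (SOME f. bij_betw f UNIV {..<CARD('n)})"

lemma bij_betw_coordinate_rank: "bij_betw (coordinate_rank :: 'n::finite \<Rightarrow> nat) UNIV {..<CARD('n)}"
proof -
  have "\<exists>f. bij_betw f (UNIV :: 'n set) {..<CARD('n)}"
    using ex_bij_betw_finite_nat[of "UNIV :: 'n set"] by (simp add: atLeast0LessThan)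
  then show ?thesis unfolding coordinate_rank_def by (rule someI_ex)
qed

lemma inj_coordinate_rank: "inj coordinate_rank"
  using bij_betw_coordinate_rank bij_betw_imp_inj_on by blast

lemma coordinate_rank_less: "coordinate_rank (\<nu> :: 'n::finite) < CARD('n)"
  using bij_betw_coordinate_rank bij_betwE by blast

text \<open>A graded total order on the multi-indices that is compatible with addition, given by an
  injective additive map into the group of integer polynomials, ordered by the sign of the leading
  coefficient of the difference: a multi-index is sent to
  the polynomial with its components as lower coefficients and its degree as the coefficient of
  the highest power.\<close>

definition monomial_key :: "'n::finite multiindex \<Rightarrow> int poly" where
  "monomial_key k = Polynomial.monom (int (mdeg k)) CARD('n) +
     (\<Sum>\<nu>\<in>UNIV. Polynomial.monom (int (k \<nu>)) (coordinate_rank \<nu>))"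

lemma monomial_key_madd: "monomial_key (madd k l) = monomial_key k + monomial_key l"
  by (simp add: monomial_key_def mdeg_madd sum.distrib add_monom[symmetric])
      (simp add: madd_def sum.distrib add_monom[symmetric])

lemma coeff_monomial_key:
  fixes k :: "'n::finite multiindex"
  shows "Polynomial.coeff (monomial_key k) CARD('n) = int (mdeg k)"
    and "Polynomial.coeff (monomial_key k) (coordinate_rank \<nu>) = int (k \<nu>)"
    and "j > CARD('n) \<Longrightarrow> Polynomial.coeff (monomial_key k) j = 0"
proof -
  have neq: "coordinate_rank \<nu> \<noteq> CARD('n)" "coordinate_rank \<nu> < CARD('n)" for \<nu> :: 'n
    using coordinate_rank_less[of \<nu>] by auto
  show "Polynomial.coeff (monomial_key k) CARD('n) = int (mdeg k)"
    using neq by (simp add: monomial_key_def Polynomial.coeff_sum)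
  show "Polynomial.coeff (monomial_key k) (coordinate_rank \<nu>) = int (k \<nu>)"
    using neq(1)[of \<nu>]
    by (simp add: monomial_key_def Polynomial.coeff_sum inj_eq[OF inj_coordinate_rank])
  show "Polynomial.coeff (monomial_key k) j = 0" if "j > CARD('n)"
  proof -
    have "coordinate_rank \<nu> \<noteq> j" for \<nu> :: 'n using neq(2)[of \<nu>] that by simp
    then show ?thesis using that by (simp add: monomial_key_def Polynomial.coeff_sum)
  qed
qed

lemma inj_monomial_key: "inj (monomial_key :: 'n::finite multiindex \<Rightarrow> int poly)"
proof (rule injI)
  fix k l :: "'n multiindex" assume "monomial_key k = monomial_key l"
  then have "int (k \<nu>) = int (l \<nu>)" for \<nu>
    using coeff_monomial_key(2)[of k \<nu>] coeff_monomial_key(2)[of l \<nu>] by simp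
  then show "k = l" by (auto simp: fun_eq_iff)
qed

lemma monomial_key_less_of_mdeg_less:
  fixes k l :: "'n::finite multiindex"
  assumes "mdeg l < mdeg k"
  shows "monomial_key l < monomial_key k"
proof -
  let ?d = "monomial_key k - monomial_key l"
  have top: "Polynomial.coeff ?d CARD('n) > 0"
    using assms by (simp add: coeff_monomial_key)
  have "degree ?d \<le> CARD('n)"
    by (intro degree_le) (simp add: coeff_monomial_key(3))
  moreover have "degree ?d \<ge> CARD('n)" using top by (intro le_degree) simp
  ultimately have "pos_poly ?d" using top by (simp add: pos_poly_def)
  then show ?thesis by (simp add: less_poly_def)
qed

lemma mdeg_le_of_monomial_key_less:
  fixes k l :: "'n::finite multiindex"
  shows "monomial_key l < monomial_key k \<Longrightarrow> mdeg l \<le> mdeg k"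
  using monomial_key_less_of_mdeg_less[of k l] by (meson leI order_less_asym)

lemma finite_monomial_key_less [simp]: "finite
    {l :: 'n multiindex. monomial_key l < monomial_key (k :: 'n::finite multiindex)}"
  by (rule finite_subset[OF _ finite_mdeg_le[of "mdeg k"]]) (auto dest: mdeg_le_of_monomial_key_less)

text \<open>Polynomials, as functions, in the monomials below \<open>k\<close>, and those with leading term \<open>z\<^sup>k\<close>.\<close>

definition lower_polys :: "'n::finite multiindex \<Rightarrow> (complex ^ 'n \<Rightarrow> complex) set" where
  "lower_polys k = {f. \<exists>c. f = (\<lambda>z. \<Sum>l | monomial_key l < monomial_key k. c l * mpow z l)}"

definition monic_polys :: "'n::finite multiindex \<Rightarrow> (complex ^ 'n \<Rightarrow> complex) set" where
  "monic_polys k = {q. \<exists>f\<in>lower_polys k. q = (\<lambda>z. mpow z k + f z)}"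

lemma lower_polys_zero: "(\<lambda>z. 0) \<in> lower_polys k"
  unfolding lower_polys_def by (intro CollectI exI[of _ "\<lambda>_. 0"]) simp

lemma lower_polys_add:
  assumes "f \<in> lower_polys k" "g \<in> lower_polys k"
  shows "(\<lambda>z. f z + g z) \<in> lower_polys k"
proof -
  obtain c d where "f = (\<lambda>z. \<Sum>l | monomial_key l < monomial_key k. c l * mpow z l)"
    "g = (\<lambda>z. \<Sum>l | monomial_key l < monomial_key k. d l * mpow z l)"
    using assms unfolding lower_polys_def by blast
  then show ?thesis
    unfolding lower_polys_def
    by (intro CollectI exI[of _ "\<lambda>l. c l + d l"]) (simp add: distrib_right sum.distrib)
qed

lemma lower_polys_monomial:
  assumes "monomial_key l < monomial_key k"
  shows "(\<lambda>z. x * mpow z l) \<in> lower_polys k"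
  unfolding lower_polys_def
  by (intro CollectI exI[of _ "\<lambda>i. if i = l then x else 0"])
     (use assms in \<open>simp add: if_distrib[of "\<lambda>c. c * _"] cong: if_cong\<close>)

lemma lower_polys_sum:
  "(\<And>i. i \<in> I \<Longrightarrow> f i \<in> lower_polys k) \<Longrightarrow> (\<lambda>z. \<Sum>i\<in>I. f i z) \<in> lower_polys k"
  by (induction I rule: infinite_finite_induct) (auto intro: lower_polys_zero lower_polys_add)

lemma monic_polysI: "f \<in> lower_polys k \<Longrightarrow> (\<And>z. q z = mpow z k + f z) \<Longrightarrow> q \<in> monic_polys k"
  by (auto simp: monic_polys_def fun_eq_iff)

lemma monic_polys_mult:
  assumes "p \<in> monic_polys k" "q \<in> monic_polys l"
  shows "(\<lambda>z. p z * q z) \<in> monic_polys (madd k l)"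
proof -
  let ?K = "{i. monomial_key i < monomial_key k}" and ?L = "{j. monomial_key j < monomial_key l}"
  obtain c d where c: "p = (\<lambda>z. mpow z k + (\<Sum>i\<in>?K. c i * mpow z i))"
    and d: "q = (\<lambda>z. mpow z l + (\<Sum>j\<in>?L. d j * mpow z j))"
    using assms unfolding monic_polys_def lower_polys_def by blast
  have ring: "(A + C) * (B + D) = A * B + (A * D + (C * B + C * D))" for A B C D :: complex
    by (simp add: algebra_simps)
  have "p z * q z = mpow z (madd k l) + ((\<Sum>j\<in>?L. d j * mpow z (madd k j)) + ((\<Sum>i\<in>?K. c i * mpow z (madd i l))
      + (\<Sum>j\<in>?L. \<Sum>i\<in>?K. c i * d j * mpow z (madd i j))))" for z
    unfolding c d ring mpow_madd sum_product sum_distrib_left sum_distrib_right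
    by (simp add: mult_ac)
  moreover have "(\<lambda>z. (\<Sum>j\<in>?L. d j * mpow z (madd k j)) + ((\<Sum>i\<in>?K. c i * mpow z (madd i l))
      + (\<Sum>j\<in>?L. \<Sum>i\<in>?K. c i * d j * mpow z (madd i j)))) \<in> lower_polys (madd k l)"
    by (intro lower_polys_add lower_polys_sum lower_polys_monomial)
       (auto simp: monomial_key_madd intro: add_strict_mono)
  ultimately show ?thesis by (intro monic_polysI)
qed

lemma mpow_monic: "(\<lambda>z. mpow z k) \<in> monic_polys k"
  unfolding monic_polys_def using lower_polys_zero[of k] by force

lemma monic_polys_zero_index:
  fixes q :: "complex ^ 'n::finite \<Rightarrow> complex"
  assumes "q \<in> monic_polys (\<lambda>_. 0)"
  shows "q = (\<lambda>z. 1)"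
proof -
  have "\<not> monomial_key l < monomial_key (\<lambda>_ :: 'n. 0)" for l :: "'n multiindex"
  proof
    assume less: "monomial_key l < monomial_key (\<lambda>_ :: 'n. 0)"
    then have "mdeg l \<le> mdeg (\<lambda>_ :: 'n. 0)" by (rule mdeg_le_of_monomial_key_less)
    then have "l = (\<lambda>_. 0)" by (simp add: mdeg_def fun_eq_iff)
    with less show False by simp
  qed
  then have empty: "{l :: 'n multiindex. monomial_key l < monomial_key (\<lambda>_ :: 'n. 0)} = {}" by simp
  show ?thesis
    using assms unfolding monic_polys_def lower_polys_def empty by auto
qed

lemma continuous_on_mpow [continuous_intros]: "continuous_on A (\<lambda>z. mpow z k)"
  unfolding mpow_def by (intro continuous_intros)

lemma continuous_on_monic:
  assumes "q \<in> monic_polys k"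
  shows "continuous_on A q"
proof -
  obtain c where "q = (\<lambda>z. mpow z k + (\<Sum>i | monomial_key i < monomial_key k. c i * mpow z i))"
    using assms unfolding monic_polys_def lower_polys_def by blast
  then show ?thesis by (auto intro!: continuous_intros)
qed

section \<open>Chebyshev constants and Vandermonde determinants\<close>

text \<open>The smallest sup norm on \<open>K\<close> of a polynomial with leading monomial \<open>z\<^sup>k\<close>.\<close>

definition chebyshev_const :: "(complex ^ 'n::finite) set \<Rightarrow> 'n multiindex \<Rightarrow> real" where
  "chebyshev_const K k = (INF q\<in>monic_polys k. sup_norm_on K q)"

lemma monic_norm_le_sup_norm_on:
  assumes "compact K" "q \<in> monic_polys k" "z \<in> K"
  shows "cmod (q z) \<le> sup_norm_on K q"
  unfolding sup_norm_on_def
proof (rule cSUP_upper[OF assms(3)])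
  have "continuous_on K (\<lambda>z. cmod (q z))"
    by (intro continuous_intros continuous_on_monic[OF assms(2)])
  then show "bdd_above ((\<lambda>z. cmod (q z)) ` K)"
    by (intro bounded_imp_bdd_above compact_imp_bounded compact_continuous_image assms)
qed

lemma monic_sup_norm_attained:
  assumes K: "compact K" "K \<noteq> {}" and q: "q \<in> monic_polys k"
  obtains z where "z \<in> K" "cmod (q z) = sup_norm_on K q"
proof -
  have "continuous_on K (\<lambda>z. cmod (q z))"
    by (intro continuous_intros continuous_on_monic[OF q])
  then obtain z where z: "z \<in> K" "\<forall>y\<in>K. cmod (q y) \<le> cmod (q z)"
    using continuous_attains_sup[OF K] by blast
  then have "sup_norm_on K q = cmod (q z)"
    using monic_norm_le_sup_norm_on[OF K(1) q z(1)] sup_norm_on_le[OF K(2)] by (intro antisym) auto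
  with z(1) show ?thesis using that by simp
qed

lemma sup_norm_on_nonneg_monic:
  assumes K: "compact K" "K \<noteq> {}" and q: "q \<in> monic_polys k"
  shows "0 \<le> sup_norm_on K q"
  using monic_sup_norm_attained[OF assms] by (metis norm_ge_zero)

lemma bdd_below_monic:
  assumes K: "compact K" "K \<noteq> {}"
  shows "bdd_below (sup_norm_on K ` monic_polys k)"
  using sup_norm_on_nonneg_monic[OF K] by (auto intro!: bdd_belowI[of _ 0])

lemma chebyshev_const_nonneg:
  assumes K: "compact K" "K \<noteq> {}"
  shows "0 \<le> chebyshev_const K k"
  unfolding chebyshev_const_def using mpow_monic[of k] sup_norm_on_nonneg_monic[OF K]
  by (intro cINF_greatest) auto

lemma chebyshev_const_attained:
  assumes K: "compact K" "K \<noteq> {}" and q: "q \<in> monic_polys k"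
  obtains z where "z \<in> K" "chebyshev_const K k \<le> cmod (q z)"
proof -
  obtain z where z: "z \<in> K" "cmod (q z) = sup_norm_on K q"
    using monic_sup_norm_attained[OF assms] by blast
  have "chebyshev_const K k \<le> sup_norm_on K q"
    unfolding chebyshev_const_def by (rule cINF_lower[OF bdd_below_monic[OF K] q])
  with z show ?thesis using that by simp
qed

lemma chebyshev_const_lessD:
  assumes K: "compact K" "K \<noteq> {}" and less: "chebyshev_const K k < \<tau>"
  shows "\<exists>q\<in>monic_polys k. \<forall>z\<in>K. cmod (q z) < \<tau>"
proof -
  have "\<exists>q\<in>monic_polys k. sup_norm_on K q < \<tau>"
    using less mpow_monic[of k] bdd_below_monic[OF K, of k] unfolding chebyshev_const_def
    by (subst (asm) cINF_less_iff) auto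
  then show ?thesis
    using monic_norm_le_sup_norm_on[OF K(1)] by (meson le_less_trans)
qed

lemma chebyshev_const_zero_index:
  assumes K: "compact K" "K \<noteq> {}"
  shows "1 \<le> chebyshev_const K (\<lambda>_. 0)"
  unfolding chebyshev_const_def
proof (rule cINF_greatest)
  show "monic_polys (\<lambda>_. 0 :: nat) \<noteq> {}" using mpow_monic by blast
  fix q :: "complex ^ 'a \<Rightarrow> complex" assume "q \<in> monic_polys (\<lambda>_. 0)"
  then have "q = (\<lambda>z. 1)" by (rule monic_polys_zero_index)
  then show "1 \<le> sup_norm_on K q" using K(2) by (simp add: sup_norm_on_def)
qed

lemma norm_det_le:
  fixes A :: "complex mat"
  assumes A: "A \<in> carrier_mat n n"
    and entries: "\<And>i j. i < n \<Longrightarrow> j < n \<Longrightarrow> cmod (A $$ (i, j)) \<le> t i * u j"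
  shows "cmod (Determinant.det A) \<le> fact n * ((\<Prod>i<n. t i) * (\<Prod>j<n. u j))"
proof -
  let ?P = "{p. p permutes {0..<n}}"
  have "cmod (Determinant.det A) \<le> (\<Sum>p\<in>?P. cmod (signof p * (\<Prod>i = 0..<n. A $$ (i, p i))))"
    unfolding det_def'[OF A] by (rule norm_sum)
  also have "\<dots> \<le> (\<Sum>p\<in>?P. (\<Prod>i<n. t i) * (\<Prod>j<n. u j))"
  proof (rule sum_mono)
    fix p assume "p \<in> ?P"
    then have p: "p permutes {0..<n}" by simp
    have "cmod (signof p * (\<Prod>i = 0..<n. A $$ (i, p i))) = (\<Prod>i<n. cmod (A $$ (i, p i)))"
      by (auto simp: norm_mult sign_def prod_norm atLeast0LessThan)
    also have "\<dots> \<le> (\<Prod>i<n. t i * u (p i))"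
      using permutes_in_image[OF p] by (intro prod_mono) (auto intro: entries)
    also have "\<dots> = (\<Prod>i<n. t i) * (\<Prod>j<n. u j)"
      using prod.permute[OF p, of u] by (simp add: prod.distrib atLeast0LessThan comp_def)
    finally show "cmod (signof p * (\<Prod>i = 0..<n. A $$ (i, p i))) \<le> (\<Prod>i<n. t i) * (\<Prod>j<n. u j)" .
  qed
  also have "\<dots> = fact n * ((\<Prod>i<n. t i) * (\<Prod>j<n. u j))"
    by (simp add: card_permutations)
  finally show ?thesis .
qed

text \<open>Adding one point at a time, each new Vandermonde determinant, divided by the previous one,
  is a monic polynomial in the new point.\<close>

lemma vandermonde_ge_prod_chebyshev:
  fixes K :: "(complex ^ 'n::finite) set" and S :: "'n multiindex set"
  assumes K: "compact K" "K \<noteq> {}" and S: "finite S"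
  shows "\<exists>e \<zeta>. bij_betw e {..<card S} S \<and> (\<forall>j. \<zeta> j \<in> K) \<and>
    (\<Prod>k\<in>S. chebyshev_const K k) \<le> cmod (Determinant.det
        (Matrix.mat (card S) (card S) (\<lambda>(i, j). mpow (\<zeta> j) (e i))))"
  using S
proof (induction S rule: finite_ranking_induct[where f = monomial_key])
  case empty
  obtain z where "z \<in> K" using K(2) by blast
  then show ?case
    by (intro exI[of _ "\<lambda>_. undefined"] exI[of _ "\<lambda>_. z"]) (auto simp: bij_betw_def)
next
  case (insert x S)
  show ?case
  proof (cases "x \<in> S")
    case True
    then show ?thesis using insert.IH by (simp add: insert_absorb)
  next
    case x: False
    define m where "m = card S"
    obtain e \<zeta> where e: "bij_betw e {..<m} S" and \<zeta>: "\<And>j. \<zeta> j \<in> K"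
      and ge: "(\<Prod>k\<in>S. chebyshev_const K k) \<le>
          cmod (Determinant.det (Matrix.mat m m (\<lambda>(i, j). mpow (\<zeta> j) (e i))))"
      using insert.IH unfolding m_def by blast
    define v where "v = Determinant.det (Matrix.mat m m (\<lambda>(i, j). mpow (\<zeta> j) (e i)))"
    define e' where "e' = e(m := x)"
    define A where "A z = Matrix.mat (Suc m) (Suc m) (\<lambda>(i, j). mpow ((\<zeta>(m := z)) j) (e' i))" for z
    have card: "card (insert x S) = Suc m" using x insert.hyps by (simp add: m_def)
    have e': "bij_betw e' {..<Suc m} (insert x S)"
    proof -
      have "bij_betw e' {..<m} S" using e by (subst bij_betw_cong[of _ _ e]) (auto simp: e'_def)
      then have "bij_betw e' ({..<m} \<union> {m}) (S \<union> {x})"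
        by (rule bij_betw_combine) (use x in \<open>auto simp: e'_def bij_betw_def\<close>)
      then show ?thesis by (simp add: lessThan_Suc)
    qed
    have cofactor_eq: "Determinant.cofactor (A z) i m =
        (-1) ^ (i + m) * Determinant.det (Matrix.mat m m
            (\<lambda>(r, j). mpow (\<zeta> j) (e' (if r < i then r else Suc r))))"
      if "i \<le> m" for i z
    proof -
      have "mat_delete (A z) i m = Matrix.mat m m (\<lambda>(r, j). mpow (\<zeta> j) (e' (if r < i then r else Suc r)))"
        by (rule eq_matI) (use that in \<open>auto simp: mat_delete_def A_def\<close>)
      then show ?thesis by (simp add: Determinant.cofactor_def)
    qed
    define C where "C i = Determinant.cofactor (A 0) i m" for i
    have "C m = v"
    proof -
      have "Matrix.mat m m (\<lambda>(r, j). mpow (\<zeta> j) (e' (if r < m then r else Suc r))) =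
          Matrix.mat m m (\<lambda>(i, j). mpow (\<zeta> j) (e i))"
        by (rule eq_matI) (auto simp: e'_def)
      then show ?thesis by (simp add: C_def cofactor_eq v_def)
    qed
    have det_A: "Determinant.det (A z) = v * mpow z x + (\<Sum>i<m. C i * mpow z (e i))" for z
    proof -
      have "Determinant.det (A z) = (\<Sum>i<Suc m. A z $$ (i, m) * Determinant.cofactor (A z) i m)"
        by (rule laplace_expansion_column) (auto simp: A_def)
      also have "\<dots> = (\<Sum>i<Suc m. C i * mpow z (e' i))"
      proof (rule sum.cong[OF refl])
        fix i assume "i \<in> {..<Suc m}"
        then have "i \<le> m" "A z $$ (i, m) = mpow z (e' i)" by (auto simp: A_def)
        then show "A z $$ (i, m) * Determinant.cofactor (A z) i m = C i * mpow z (e' i)"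
          by (simp add: C_def cofactor_eq)
      qed
      also have "\<dots> = v * mpow z x + (\<Sum>i<m. C i * mpow z (e i))"
        by (simp add: \<open>C m = v\<close> e'_def)
      finally show ?thesis .
    qed
    have "\<exists>z\<in>K. (\<Prod>k\<in>insert x S. chebyshev_const K k) \<le> cmod (Determinant.det (A z))"
    proof (cases "v = 0")
      case True
      have "(\<Prod>k\<in>S. chebyshev_const K k) = 0"
        using ge True by (intro antisym prod_nonneg) (auto simp: v_def intro: chebyshev_const_nonneg[OF K])
      moreover obtain z where "z \<in> K" using K(2) by blast
      ultimately show ?thesis
        by (intro bexI[of _ z]) (simp_all only: prod.insert[OF insert.hyps(1) x] mult_zero_right norm_ge_zero)
    next
      case False
      define q where "q z = mpow z x + (\<Sum>i<m. C i / v * mpow z (e i))" for z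
      have q_eq: "Determinant.det (A z) = v * q z" for z
        using False by (simp add: det_A q_def distrib_left sum_distrib_left)
      have "(\<lambda>z. \<Sum>i<m. C i / v * mpow z (e i)) \<in> lower_polys x"
      proof (intro lower_polys_sum lower_polys_monomial)
        fix i assume "i \<in> {..<m}"
        then have "e i \<in> S" using e bij_betwE by blast
        then have "monomial_key (e i) \<le> monomial_key x" "e i \<noteq> x" using insert.hyps x by auto
        then show "monomial_key (e i) < monomial_key x"
          using inj_monomial_key by (metis injD order_le_less)
      qed
      then have "q \<in> monic_polys x" by (rule monic_polysI) (simp add: q_def)
      then obtain z where z: "z \<in> K" "chebyshev_const K x \<le> cmod (q z)"
        using chebyshev_const_attained[OF K] by blast
      have "chebyshev_const K x * (\<Prod>k\<in>S. chebyshev_const K k) \<le> cmod (q z) * cmod v"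
        using z(2) ge by (intro mult_mono) (auto simp: v_def intro!: prod_nonneg chebyshev_const_nonneg[OF K])
      then show ?thesis
        using z(1) x insert.hyps by (intro bexI[of _ z]) (auto simp: q_eq norm_mult mult.commute)
    qed
    then obtain z where z: "z \<in> K" "(\<Prod>k\<in>insert x S. chebyshev_const K k) \<le> cmod (Determinant.det (A z))"
      by blast
    show ?thesis
      unfolding card using e' \<zeta> z
      by (intro exI[of _ e'] exI[of _ "\<zeta>(m := z)"]) (auto simp: A_def)
  qed
qed

lemma graded_enumeration_image:
  fixes k :: "nat \<Rightarrow> 'n::finite multiindex"
  assumes k: "graded_enumeration k"
  shows "k ` {1..num_monomials TYPE('n) \<sigma>} = {l. mdeg l \<le> \<sigma>}"
proof -
  have bij: "bij_betw k {1..} UNIV" and mono: "mono_on {1..} (\<lambda>i. mdeg (k i))"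
    using k by (auto simp: graded_enumeration_def)
  define I where "I = {i \<in> {1..}. mdeg (k i) \<le> \<sigma>}"
  have img: "k ` I = {l. mdeg l \<le> \<sigma>}"
    using bij_betw_imp_surj_on[OF bij] unfolding I_def by (auto simp: image_iff)
  have inj: "inj_on k I"
    using bij_betw_imp_inj_on[OF bij] by (rule inj_on_subset) (auto simp: I_def)
  have fin: "finite I"
    using finite_mdeg_le[of \<sigma>] img finite_image_iff[OF inj] by metis
  have card: "card I = num_monomials TYPE('n) \<sigma>"
    using card_image[OF inj] img by (simp add: num_monomials_def)
  have down: "j \<in> I" if "i \<in> I" "1 \<le> j" "j \<le> i" for i j
    using mono_onD[OF mono, of j i] that by (auto simp: I_def)
  have "I = {1..card I}"
  proof (cases "I = {}")
    case False
    then have "Max I \<in> I" using fin by simp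
    have "I = {1..Max I}"
    proof (intro equalityI subsetI)
      fix i assume "i \<in> I"
      moreover from this have "i \<le> Max I" by (rule Max_ge[OF fin])
      ultimately show "i \<in> {1..Max I}" unfolding I_def by auto
    next
      fix i assume "i \<in> {1..Max I}"
      then show "i \<in> I" using down[OF \<open>Max I \<in> I\<close>, of i] by auto
    qed
    moreover from this have "card I = Max I" by (metis card_atLeastAtMost diff_Suc_1)
    ultimately show ?thesis by simp
  qed simp
  then show ?thesis using img card by simp
qed

lemma vandermonde_max_ge:
  fixes k :: "nat \<Rightarrow> 'n::finite multiindex"
  assumes k: "graded_enumeration k" and K: "compact K" "K \<noteq> {}"
  shows "(\<Prod>l | mdeg l \<le> \<sigma>. chebyshev_const K l) \<le> vandermonde_max k K (num_monomials TYPE('n) \<sigma>)"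
proof -
  define m where "m = num_monomials TYPE('n) \<sigma>"
  define S where "S = {l :: 'n multiindex. mdeg l \<le> \<sigma>}"
  have S: "finite S" "card S = m" by (auto simp: S_def m_def num_monomials_def finite_mdeg_le)
  obtain e \<zeta> where e: "bij_betw e {..<m} S" and \<zeta>: "\<And>j. \<zeta> j \<in> K"
    and ge: "(\<Prod>k\<in>S. chebyshev_const K k) \<le> cmod (Determinant.det (Matrix.mat m m (\<lambda>(i, j). mpow (\<zeta> j) (e i))))"
    using vandermonde_ge_prod_chebyshev[OF K S(1)] unfolding S(2) by blast
  define V where "V \<zeta> = Matrix.mat m m (\<lambda>(i, j). mpow (\<zeta> (j + 1)) (k (i + 1)))" for \<zeta>
  define \<kappa> where "\<kappa> i = k (i + 1)" for i
  have img: "k ` {1..m} = S" unfolding m_def S_def by (rule graded_enumeration_image[OF k])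
  have inj: "inj_on k {1..m}"
    using k inj_on_subset[of k "{1..}" "{1..m}"] by (auto simp: graded_enumeration_def bij_betw_def)
  have \<kappa>: "bij_betw \<kappa> {..<m} S"
  proof -
    have "bij_betw (\<lambda>i. i + 1) {..<m} {1..m}"
      by (rule bij_betwI[where g = "\<lambda>i. i - 1"]) auto
    moreover have "bij_betw k {1..m} S" using inj img by (simp add: bij_betw_def)
    ultimately have "bij_betw (k \<circ> (\<lambda>i. i + 1)) {..<m} S" by (rule bij_betw_trans)
    then show ?thesis by (simp add: \<kappa>_def[abs_def] comp_def)
  qed
  define p where "p i = (if i < m then inv_into {..<m} \<kappa> (e i) else i)" for i
  have "bij_betw (inv_into {..<m} \<kappa> \<circ> e) {..<m} {..<m}"
    using e bij_betw_inv_into[OF \<kappa>] by (rule bij_betw_trans)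
  then have "bij_betw p {0..<m} {0..<m}"
    by (subst bij_betw_cong[of _ _ "inv_into {..<m} \<kappa> \<circ> e"]) (auto simp: p_def atLeast0LessThan)
  then have p: "p permutes {0..<m}" by (rule bij_imp_permutes) (auto simp: p_def)
  define \<zeta>' where "\<zeta>' j = \<zeta> (j - 1)" for j
  have "Matrix.mat m m (\<lambda>(i, j). mpow (\<zeta> j) (e i)) = Matrix.mat m m (\<lambda>(i, j). V \<zeta>' $$ (p i, j))"
  proof (rule eq_matI)
    fix i j assume "i < dim_row (Matrix.mat m m (\<lambda>(i, j). V \<zeta>' $$ (p i, j)))"
        "j < dim_col (Matrix.mat m m (\<lambda>(i, j). V \<zeta>' $$ (p i, j)))"
    then have ij: "i < m" "j < m" by auto
    have "p i < m" using permutes_in_image[OF p, of i] ij by simp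
    moreover have "\<kappa> (p i) = e i"
      using ij e \<kappa> by (auto simp: p_def bij_betw_def f_inv_into_f)
    ultimately show "Matrix.mat m m (\<lambda>(i, j). mpow (\<zeta> j) (e i)) $$ (i, j) =
        Matrix.mat m m (\<lambda>(i, j). V \<zeta>' $$ (p i, j)) $$ (i, j)"
      using ij by (simp add: V_def \<kappa>_def \<zeta>'_def)
  qed auto
  then have "Determinant.det (Matrix.mat m m (\<lambda>(i, j). mpow (\<zeta> j) (e i))) = signof p * Determinant.det (V \<zeta>')"
    using det_permute_rows[OF _ p, of "V \<zeta>'"] by (simp add: V_def)
  then have "cmod (Determinant.det (Matrix.mat m m (\<lambda>(i, j). mpow (\<zeta> j) (e i)))) =
      cmod (Determinant.det (V \<zeta>'))"
    by (auto simp: norm_mult sign_def)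
  moreover have "cmod (Determinant.det (V \<zeta>')) \<le> vandermonde_max k K m"
    unfolding vandermonde_max_def V_def
  proof (rule cSUP_upper)
    show "\<zeta>' \<in> {1..m} \<rightarrow> K" using \<zeta> by (auto simp: \<zeta>'_def)
    obtain R where R: "R > 0" "\<And>z. z \<in> K \<Longrightarrow> norm z \<le> R"
      using compact_imp_bounded[OF K(1)] by (auto simp: bounded_pos)
    show "bdd_above ((\<lambda>\<zeta>. cmod (Determinant.det (Matrix.mat m m (\<lambda>(i, j). mpow (\<zeta> (j + 1)) (k (i + 1)))))) `
        ({1..m} \<rightarrow> K))"
    proof (rule bdd_aboveI2)
      fix \<zeta> assume \<zeta>: "\<zeta> \<in> {1..m} \<rightarrow> K"
      show "cmod (Determinant.det (Matrix.mat m m (\<lambda>(i, j). mpow (\<zeta> (j + 1)) (k (i + 1)))))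
          \<le> fact m * ((\<Prod>i<m. R ^ mdeg (k (i + 1))) * (\<Prod>j<m. 1))"
      proof (rule norm_det_le)
        fix i j assume ij: "i < m" "j < m"
        have "\<zeta> (j + 1) \<in> K" using \<zeta> ij by auto
        then have "cmod (\<zeta> (j + 1) $ \<nu>) \<le> R" for \<nu>
          using R(2) Finite_Cartesian_Product.norm_nth_le order_trans by blast
        then show "cmod (Matrix.mat m m (\<lambda>(i, j). mpow (\<zeta> (j + 1)) (k (i + 1))) $$ (i, j)) \<le>
            R ^ mdeg (k (i + 1)) * 1"
          using ij norm_mpow_le[of "\<zeta> (j + 1)" R] by simp
      qed simp
    qed
  qed
  ultimately show ?thesis using ge by (simp add: m_def S_def)
qed

section \<open>Hankel determinants and monic polynomials\<close>

text \<open>A permutation other than the identity moves some index to one of larger or equal rank, where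
  the entry is zero.\<close>

lemma det_unitriangular:
  fixes B :: "complex mat" and r :: "nat \<Rightarrow> 'b::linorder"
  assumes B: "B \<in> carrier_mat n n" and diag: "\<And>i. i < n \<Longrightarrow> B $$ (i, i) = 1"
    and tri: "\<And>i j. i < n \<Longrightarrow> j < n \<Longrightarrow> i \<noteq> j \<Longrightarrow> B $$ (i, j) \<noteq> 0 \<Longrightarrow> r j < r i"
  shows "Determinant.det B = 1"
proof -
  have zero: "(\<Prod>i = 0..<n. B $$ (i, p i)) = 0" if p: "p permutes {0..<n}" "p \<noteq> id" for p
  proof (rule ccontr)
    assume "(\<Prod>i = 0..<n. B $$ (i, p i)) \<noteq> 0"
    then have nz: "B $$ (i, p i) \<noteq> 0" if "i < n" for i using that by auto
    define N where "N = {i. i < n \<and> p i \<noteq> i}"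
    have "N \<noteq> {}" using p permutes_not_in[OF p(1)] by (auto simp: N_def fun_eq_iff)
    moreover have fin: "finite N" by (simp add: N_def)
    ultimately have "Min (r ` N) \<in> r ` N" by (intro Min_in) auto
    then obtain i where i: "i \<in> N" "r i = Min (r ` N)" by auto
    have i_min: "r i \<le> r j" if "j \<in> N" for j
      unfolding i(2) using fin that by (intro Min_le) auto
    have "p i < n" using permutes_in_image[OF p(1), of i] i(1) by (simp add: N_def)
    moreover have "p (p i) \<noteq> p i" using permutes_inj[OF p(1)] i(1) by (auto simp: N_def inj_eq)
    ultimately have "p i \<in> N" by (simp add: N_def)
    moreover have "r (p i) < r i" using i(1) nz \<open>p i < n\<close> by (intro tri) (auto simp: N_def)
    ultimately show False using i_min[of "p i"] by simp
  qed
  have "Determinant.det B = (\<Sum>p\<in>{p. p permutes {0..<n}}. if p = id then 1 else 0)"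
    unfolding det_def'[OF B] by (rule sum.cong) (use zero diag in auto)
  also have "\<dots> = 1" using permutes_id[of "{0..<n}"] by (simp add: finite_permutations)
  finally show ?thesis .
qed

text \<open>Row and column operations with the coefficients of monic polynomials replace each monomial
  in a Hankel matrix by a polynomial of small norm.\<close>

lemma norm_hankel_det_le:
  fixes \<gamma> :: "'n::finite multiindex \<Rightarrow> complex" and e :: "nat \<Rightarrow> 'n multiindex"
  assumes bound: "\<And>S p M. finite S \<Longrightarrow> (\<And>w. w \<in> U \<Longrightarrow> cmod (\<Sum>k\<in>S. p k * mpow w k) \<le> M) \<Longrightarrow>
      cmod (\<Sum>k\<in>S. p k * \<gamma> k) \<le> C * M"
    and C: "C \<ge> 0" and e: "inj_on e {..<n}"
    and q: "\<And>\<alpha>. \<alpha> < n \<Longrightarrow> q \<alpha> \<in> monic_polys (e \<alpha>) \<and> (\<forall>w\<in>U. cmod (q \<alpha> w) \<le> t \<alpha>)"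
    and down: "\<And>\<alpha>. \<alpha> < n \<Longrightarrow> {l. monomial_key l < monomial_key (e \<alpha>)} \<subseteq> e ` {..<n} \<or> q \<alpha> = (\<lambda>z. mpow z (e \<alpha>))"
    and t: "\<And>\<alpha>. \<alpha> < n \<Longrightarrow> t \<alpha> \<ge> 0"
  shows "cmod (Determinant.det (Matrix.mat n n (\<lambda>(\<alpha>, \<beta>). \<gamma> (madd (e \<alpha>) (e \<beta>))))) \<le> fact n * C ^ n *
      (\<Prod>\<alpha><n. t \<alpha>)\<^sup>2"
proof -
  have "\<exists>b. (\<forall>z. q \<alpha> z = (\<Sum>\<beta><n. b \<beta> * mpow z (e \<beta>))) \<and> b \<alpha> = 1 \<and>
      (\<forall>\<beta><n. \<alpha> \<noteq> \<beta> \<longrightarrow> b \<beta> \<noteq> 0 \<longrightarrow> monomial_key (e \<beta>) < monomial_key (e \<alpha>))" if \<alpha>: "\<alpha> < n" for \<alpha>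
  proof -
    let ?L = "{l. monomial_key l < monomial_key (e \<alpha>)}"
    obtain c where c: "q \<alpha> = (\<lambda>z. mpow z (e \<alpha>) + (\<Sum>l\<in>?L. c l * mpow z l))"
      and c0: "?L \<subseteq> e ` {..<n} \<or> (\<forall>l. c l = 0)"
    proof (cases "q \<alpha> = (\<lambda>z. mpow z (e \<alpha>))")
      case True
      then show ?thesis using that[of "\<lambda>_. 0"] by simp
    next
      case False
      then have "?L \<subseteq> e ` {..<n}" using down[OF \<alpha>] by blast
      moreover obtain c where "q \<alpha> = (\<lambda>z. mpow z (e \<alpha>) + (\<Sum>l\<in>?L. c l * mpow z l))"
        using q[OF \<alpha>] unfolding monic_polys_def lower_polys_def by blast
      ultimately show ?thesis using that by blast
    qed
    define b where "b \<beta> = (if \<beta> = \<alpha> then 1 else if e \<beta> \<in> ?L then c (e \<beta>) else 0)" for \<beta>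
    have "q \<alpha> z = (\<Sum>\<beta><n. b \<beta> * mpow z (e \<beta>))" for z
    proof -
      let ?N = "{\<beta>. \<beta> < n \<and> e \<beta> \<in> ?L}"
      have "(\<Sum>l\<in>?L. c l * mpow z l) = (\<Sum>l\<in>e ` ?N. c l * mpow z l)"
        using c0 by (intro sum.mono_neutral_right) auto
      also have "\<dots> = (\<Sum>\<beta>\<in>?N. c (e \<beta>) * mpow z (e \<beta>))"
        by (subst sum.reindex) (auto intro: inj_on_subset[OF e])
      also have "\<dots> = (\<Sum>\<beta>\<in>{..<n} - {\<alpha>}. b \<beta> * mpow z (e \<beta>))"
        by (rule sum.mono_neutral_cong_left) (auto simp: b_def)
      finally have "q \<alpha> z = b \<alpha> * mpow z (e \<alpha>) + (\<Sum>\<beta>\<in>{..<n} - {\<alpha>}. b \<beta> * mpow z (e \<beta>))"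
        by (simp add: c b_def)
      then show ?thesis using \<alpha> by (simp add: sum.remove[of _ \<alpha>])
    qed
    then show ?thesis by (intro exI[of _ b]) (auto simp: b_def)
  qed
  then obtain b where b: "\<And>\<alpha> z. \<alpha> < n \<Longrightarrow> q \<alpha> z = (\<Sum>\<beta><n. b \<alpha> \<beta> * mpow z (e \<beta>))"
    and b1: "\<And>\<alpha>. \<alpha> < n \<Longrightarrow> b \<alpha> \<alpha> = 1"
    and b_tri: "\<And>\<alpha> \<beta>. \<alpha> < n \<Longrightarrow> \<beta> < n \<Longrightarrow> \<alpha> \<noteq> \<beta> \<Longrightarrow> b \<alpha> \<beta> \<noteq> 0 \<Longrightarrow> monomial_key (e \<beta>) < monomial_key (e \<alpha>)"
    by metis
  define B where "B = Matrix.mat n n (\<lambda>(\<alpha>, \<beta>). b \<alpha> \<beta>)"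
  define \<Gamma> where "\<Gamma> = Matrix.mat n n (\<lambda>(\<alpha>, \<beta>). \<gamma> (madd (e \<alpha>) (e \<beta>)))"
  have carrier: "B \<in> carrier_mat n n" "\<Gamma> \<in> carrier_mat n n" "transpose_mat B \<in> carrier_mat n n"
    by (auto simp: B_def \<Gamma>_def)
  have "Determinant.det B = 1"
    by (rule det_unitriangular[where n = n and r = "\<lambda>\<alpha>. monomial_key (e \<alpha>)"]) (auto simp: B_def b1 intro: b_tri)
  then have det_eq: "Determinant.det (B * \<Gamma> * transpose_mat B) = Determinant.det \<Gamma>"
    using carrier by (simp add: det_mult[of _ n] det_transpose[OF carrier(1)])
  have "cmod (Determinant.det (B * \<Gamma> * transpose_mat B)) \<le> fact n * ((\<Prod>\<alpha><n. C * t \<alpha>) * (\<Prod>\<beta><n. t \<beta>))"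
  proof (rule norm_det_le)
    show "B * \<Gamma> * transpose_mat B \<in> carrier_mat n n" using carrier by (intro mult_carrier_mat)
    fix \<alpha> \<beta> assume \<alpha>\<beta>: "\<alpha> < n" "\<beta> < n"
    define I where "I = {..<n} \<times> {..<n}"
    have "(B * \<Gamma> * transpose_mat B) $$ (\<alpha>, \<beta>) = (\<Sum>j<n. (\<Sum>i<n. b \<alpha> i * \<gamma> (madd (e i) (e j))) * b \<beta> j)"
      using \<alpha>\<beta> by (simp add: B_def \<Gamma>_def scalar_prod_def atLeast0LessThan)
    also have "\<dots> = (\<Sum>i<n. \<Sum>j<n. (b \<alpha> i * b \<beta> j) * \<gamma> (madd (e i) (e j)))"
      by (subst sum.swap) (simp add: sum_distrib_left sum_distrib_right mult_ac)
    also have "\<dots> = (\<Sum>x\<in>I. (b \<alpha> (fst x) * b \<beta> (snd x)) * \<gamma> (madd (e (fst x)) (e (snd x))))"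
      by (simp add: I_def sum.cartesian_product case_prod_unfold)
    finally have entry: "(B * \<Gamma> * transpose_mat B) $$ (\<alpha>, \<beta>) =
      (\<Sum>x\<in>I. (b \<alpha> (fst x) * b \<beta> (snd x)) * \<gamma> (madd (e (fst x)) (e (snd x))))" .
    have "cmod (\<Sum>x\<in>I. (b \<alpha> (fst x) * b \<beta> (snd x)) * \<gamma> (madd (e (fst x)) (e (snd x)))) \<le> C * (t \<alpha> * t \<beta>)"
    proof (rule functional_bound_family[where \<gamma> = \<gamma> and V = U, OF bound])
      show "finite I" by (simp add: I_def)
      fix w assume w: "w \<in> U"
      have "(\<Sum>x\<in>I. (b \<alpha> (fst x) * b \<beta> (snd x)) * mpow w (madd (e (fst x)) (e (snd x)))) = q \<alpha> w * q \<beta> w"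
        unfolding b[OF \<alpha>\<beta>(1)] b[OF \<alpha>\<beta>(2)] sum_product sum.cartesian_product I_def
        by (rule sum.cong) (auto simp: mpow_madd)
      then show "cmod (\<Sum>x\<in>I. (b \<alpha> (fst x) * b \<beta> (snd x)) * mpow w (madd (e (fst x)) (e (snd x)))) \<le> t \<alpha> * t \<beta>"
        using q[OF \<alpha>\<beta>(1)] q[OF \<alpha>\<beta>(2)] w t[OF \<alpha>\<beta>(1)] by (auto simp: norm_mult intro!: mult_mono)
    qed
    then show "cmod ((B * \<Gamma> * transpose_mat B) $$ (\<alpha>, \<beta>)) \<le> C * t \<alpha> * t \<beta>"
      by (simp add: entry mult.assoc)
  qed
  then show ?thesis
    unfolding det_eq by (simp add: \<Gamma>_def prod.distrib power2_eq_square mult.assoc)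
qed

section \<open>Averages over the monomials of a fixed degree\<close>

text \<open>The number of monomials of degree exactly \<open>q\<close>.\<close>

definition num_degree :: "'n::finite itself \<Rightarrow> nat \<Rightarrow> nat" where
  "num_degree _ q = card {k :: 'n multiindex. mdeg k = q}"

lemma num_degree_eq: "num_degree TYPE('n::finite) q = (q + CARD('n) - 1) choose q"
  by (simp add: num_degree_def card_mdeg_eq)

lemma num_degree_pos: "num_degree TYPE('n::finite) q > 0"
proof -
  have "CARD('n) > 0" by (rule finite_UNIV_card_ge_0) simp
  then have "q \<le> q + CARD('n) - 1" by linarith
  then show ?thesis by (simp add: num_degree_eq)
qed

lemma num_monomials_0: "num_monomials TYPE('n::finite) 0 = 1"
proof -
  have "{k :: 'n multiindex. mdeg k \<le> 0} = {\<lambda>_. 0}"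
    by (auto simp: mdeg_0_iff)
  then show ?thesis by (simp add: num_monomials_def)
qed

lemma num_monomials_Suc:
  "num_monomials TYPE('n::finite) (Suc q) = num_monomials TYPE('n) q + num_degree TYPE('n) (Suc q)"
proof -
  have "{k :: 'n multiindex. mdeg k \<le> Suc q} = {k. mdeg k \<le> q} \<union> {k. mdeg k = Suc q}" by auto
  moreover have "card ({k :: 'n multiindex. mdeg k \<le> q} \<union> {k. mdeg k = Suc q}) =
      card {k :: 'n multiindex. mdeg k \<le> q} + card {k :: 'n multiindex. mdeg k = Suc q}"
    by (rule card_Un_disjoint) (auto intro: finite_mdeg_le)
  ultimately show ?thesis by (simp add: num_monomials_def num_degree_def)
qed

lemma num_monomials_eq: "num_monomials TYPE('n::finite) q = (q + CARD('n)) choose q"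
proof (induction q)
  case (Suc q)
  then show ?case by (simp add: num_monomials_Suc num_degree_eq)
qed (simp add: num_monomials_0)

lemma num_degree_num_monomials:
  "(q + CARD('n)) * num_degree TYPE('n::finite) q = CARD('n) * num_monomials TYPE('n) q"
proof -
  obtain N where N: "CARD('n) = Suc N"
    using finite_UNIV_card_ge_0[where ?'a = 'n, OF finite_class.finite_UNIV] by (cases "CARD('n)") auto
  have "Suc (q + N) * ((q + N) choose N) = (Suc (q + N) choose Suc N) * Suc N"
    by (rule Suc_times_binomial_eq)
  then show ?thesis
    using binomial_symmetric[of q "q + N"] binomial_symmetric[of q "Suc (q + N)"]
    by (simp add: num_degree_eq num_monomials_eq N mult.commute)
qed

lemma total_degree_0: "total_degree TYPE('n::finite) 0 = 0"
  by (simp add: total_degree_def)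

lemma total_degree_Suc:
  "total_degree TYPE('n::finite) (Suc q) = total_degree TYPE('n) q + Suc q * num_degree TYPE('n) (Suc q)"
  by (simp add: total_degree_def num_monomials_Suc)

lemma total_degree_num_monomials:
  "(CARD('n) + 1) * total_degree TYPE('n::finite) q = CARD('n) * q * num_monomials TYPE('n) q"
proof (induction q)
  case (Suc q)
  let ?N = "CARD('n)" and ?h = "num_degree TYPE('n) (Suc q)" and ?m = "num_monomials TYPE('n) q"
  have eq: "Suc q * ?h = ?N * ?m"
    using num_degree_num_monomials[where ?'n = 'n, of "Suc q"]
    by (simp add: num_monomials_Suc algebra_simps)
  have "(?N + 1) * total_degree TYPE('n) (Suc q) = (?N + 1) * total_degree TYPE('n) q + (?N + 1) * (Suc q * ?h)"
    by (simp only: total_degree_Suc distrib_left)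
  also have "\<dots> = ?N * q * ?m + (?N + 1) * (?N * ?m)" by (simp only: Suc.IH eq)
  also have "\<dots> = ?N * (Suc q * ?m) + ?N * (?N * ?m)" by (simp add: algebra_simps)
  also have "\<dots> = ?N * (Suc q * ?m) + ?N * (Suc q * ?h)" by (simp only: eq)
  also have "\<dots> = ?N * Suc q * num_monomials TYPE('n) (Suc q)"
    by (simp add: num_monomials_Suc algebra_simps)
  finally show ?case .
qed (simp add: total_degree_0)

lemma num_monomials_le: "num_monomials TYPE('n::finite) q \<le> (q + 1) ^ CARD('n)"
proof -
  have "{k :: 'n multiindex. mdeg k \<le> q} \<subseteq> Pi\<^sub>E UNIV (\<lambda>_. {..q})"
    using mdeg_ge order_trans by (fastforce simp: PiE_UNIV_domain)
  then have "card {k :: 'n multiindex. mdeg k \<le> q} \<le> card (Pi\<^sub>E (UNIV :: 'n set) (\<lambda>_. {..q}))"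
    by (intro card_mono finite_PiE) auto
  then show ?thesis by (simp add: num_monomials_def card_PiE)
qed

text \<open>The mean of \<open>\<theta>\<close> over the monomials of degree \<open>q\<close>.\<close>

definition degree_average :: "('n::finite multiindex \<Rightarrow> real) \<Rightarrow> nat \<Rightarrow> real" where
  "degree_average \<theta> q = (\<Sum>k | mdeg k = q. \<theta> k) / real (num_degree TYPE('n) q)"

lemma sum_eq_degree_average:
  "(\<Sum>k | mdeg k = q. \<theta> k) = real (num_degree TYPE('n) q) * degree_average \<theta> q"
  for \<theta> :: "'n::finite multiindex \<Rightarrow> real"
  using num_degree_pos[where ?'n = 'n, of q] by (simp add: degree_average_def)

text \<open>If \<open>k\<close> is uniformly distributed among the multi-indices of degree \<open>p + q\<close> and split
  hypergeometrically into parts \<open>\<kappa>\<close> and \<open>l\<close> of degrees \<open>p\<close> and \<open>q\<close>, then \<open>\<kappa>\<close> and \<open>l\<close> are again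
  uniformly distributed.  The products of binomial coefficients below are the unnormalised
  probabilities.\<close>

lemma degree_average_subadditive:
  fixes \<theta> :: "'n::finite multiindex \<Rightarrow> real"
  assumes subadd: "\<And>k l. \<theta> (madd k l) \<le> \<theta> k + \<theta> l"
  shows "degree_average \<theta> (p + q) \<le> degree_average \<theta> p + degree_average \<theta> q"
proof -
  define w where "w \<kappa> l = (\<Prod>\<nu>\<in>UNIV. real ((\<kappa> \<nu> + l \<nu>) choose \<kappa> \<nu>))" for \<kappa> l :: "'n multiindex"
  define S where "S r = {k :: 'n multiindex. mdeg k = r}" for r
  have fin: "finite (S r)" for r by (simp add: S_def)
  have madd_apply: "madd \<kappa> l \<nu> = \<kappa> \<nu> + l \<nu>" for \<kappa> l :: "'n multiindex" and \<nu>
    by (simp add: madd_def)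
  have w_sym: "w \<kappa> l = w l \<kappa>" for \<kappa> l
  proof -
    have "(\<kappa> \<nu> + l \<nu>) choose \<kappa> \<nu> = (l \<nu> + \<kappa> \<nu>) choose l \<nu>" for \<nu>
      using binomial_symmetric[of "\<kappa> \<nu>" "\<kappa> \<nu> + l \<nu>"] by (simp add: add.commute)
    then show ?thesis by (simp add: w_def)
  qed
  have total: "(\<Sum>\<kappa>\<in>S p. \<Sum>l\<in>S q. w \<kappa> l * f (madd \<kappa> l)) = real ((p + q) choose p) * (\<Sum>k\<in>S (p + q). f k)"
    for f :: "'n multiindex \<Rightarrow> real"
  proof -
    let ?v = "\<lambda>(k, \<kappa>). (\<Prod>\<nu>\<in>UNIV. real (k \<nu> choose \<kappa> \<nu>)) * f k"
    have "(\<Sum>\<kappa>\<in>S p. \<Sum>l\<in>S q. w \<kappa> l * f (madd \<kappa> l)) = (\<Sum>(\<kappa>, l)\<in>S p \<times> S q. w \<kappa> l * f (madd \<kappa> l))"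
      by (simp add: sum.cartesian_product)
    also have "\<dots> = (\<Sum>x\<in>{(k, \<kappa>) \<in> S (p + q) \<times> S p. \<forall>\<nu>. \<kappa> \<nu> \<le> k \<nu>}. ?v x)"
    proof (rule sum.reindex_bij_witness[where j = "\<lambda>(\<kappa>, l). (madd \<kappa> l, \<kappa>)" and i =
        "\<lambda>(k, \<kappa>). (\<kappa>, \<lambda>\<nu>. k \<nu> - \<kappa> \<nu>)"], goal_cases)
      case (4 x)
      then show ?case
        by (auto simp: S_def mdeg_def sum_subtractf_nat)
    qed (auto simp: S_def mdeg_madd w_def madd_apply fun_eq_iff)
    also have "\<dots> = (\<Sum>x\<in>S (p + q) \<times> S p. ?v x)"
    proof (rule sum.mono_neutral_left)
      show "\<forall>x\<in>S (p + q) \<times> S p - {(k, \<kappa>) \<in> S (p + q) \<times> S p. \<forall>\<nu>. \<kappa> \<nu> \<le> k \<nu>}. ?v x = 0"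
        by (auto simp: not_le binomial_eq_0 intro!: prod_zero) (meson not_le)
    qed (auto simp: fin)
    also have "\<dots> = (\<Sum>k\<in>S (p + q). \<Sum>\<kappa>\<in>S p. (\<Prod>\<nu>\<in>UNIV. real (k \<nu> choose \<kappa> \<nu>)) * f k)"
      by (simp add: sum.cartesian_product)
    also have "\<dots> = (\<Sum>k\<in>S (p + q). real ((p + q) choose p) * f k)"
    proof (rule sum.cong[OF refl])
      fix k assume "k \<in> S (p + q)"
      then show "(\<Sum>\<kappa>\<in>S p. (\<Prod>\<nu>\<in>UNIV. real (k \<nu> choose \<kappa> \<nu>)) * f k) = real ((p + q) choose p) * f k"
        using sum_prod_choose_lower[of k p q] by (simp add: S_def flip: sum_distrib_right)
    qed
    finally show ?thesis by (simp add: sum_distrib_left)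
  qed
  have left: "(\<Sum>\<kappa>\<in>S p. \<Sum>l\<in>S q. w \<kappa> l * f \<kappa>) = real ((p + q + CARD('n) - 1) choose q) * (\<Sum>\<kappa>\<in>S p. f \<kappa>)"
    for p q and f :: "'n multiindex \<Rightarrow> real"
    using sum_prod_choose_upper[where ?'n = 'n, of _ p q]
    by (simp add: sum_distrib_left S_def w_def flip: sum_distrib_right)
  have right: "(\<Sum>\<kappa>\<in>S p. \<Sum>l\<in>S q. w \<kappa> l * f l) = real ((q + p + CARD('n) - 1) choose p) * (\<Sum>l\<in>S q. f l)"
    for f :: "'n multiindex \<Rightarrow> real"
  proof -
    have "(\<Sum>\<kappa>\<in>S p. \<Sum>l\<in>S q. w \<kappa> l * f l) = (\<Sum>l\<in>S q. \<Sum>\<kappa>\<in>S p. w l \<kappa> * f l)"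
      by (subst sum.swap, intro sum.cong refl) (metis w_sym)
    also have "\<dots> = real ((q + p + CARD('n) - 1) choose p) * (\<Sum>l\<in>S q. f l)"
      by (rule left)
    finally show ?thesis .
  qed
  define X where "X = real ((p + q) choose p) * real (card (S (p + q)))"
  have X1: "X = real ((p + q + CARD('n) - 1) choose q) * real (card (S p))"
    using total[of "\<lambda>_. 1"] left[where p = p and q = q and f = "\<lambda>_. 1"] by (simp add: X_def)
  have X2: "X = real ((q + p + CARD('n) - 1) choose p) * real (card (S q))"
    using total[of "\<lambda>_. 1"] right[of "\<lambda>_. 1"] by (simp add: X_def)
  have card_pos: "real (card (S r)) > 0" for r
    using num_degree_pos[where ?'n = 'n, of r] by (simp add: num_degree_def S_def)
  have X: "X > 0" unfolding X_def using card_pos[of "p + q"] by simp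
  have avg: "(\<Sum>k\<in>S r. \<theta> k) = real (card (S r)) * degree_average \<theta> r" for r
    using sum_eq_degree_average[of \<theta> r] by (simp add: S_def num_degree_def)
  have "X * degree_average \<theta> (p + q) = (\<Sum>\<kappa>\<in>S p. \<Sum>l\<in>S q. w \<kappa> l * \<theta> (madd \<kappa> l))"
    unfolding total avg X_def by simp
  also have "\<dots> \<le> (\<Sum>\<kappa>\<in>S p. \<Sum>l\<in>S q. w \<kappa> l * (\<theta> \<kappa> + \<theta> l))"
    by (intro sum_mono mult_left_mono subadd) (simp add: w_def prod_nonneg)
  also have "\<dots> = (\<Sum>\<kappa>\<in>S p. \<Sum>l\<in>S q. w \<kappa> l * \<theta> \<kappa>) + (\<Sum>\<kappa>\<in>S p. \<Sum>l\<in>S q. w \<kappa> l * \<theta> l)"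
    by (simp add: distrib_left sum.distrib)
  also have "\<dots> = X * (degree_average \<theta> p + degree_average \<theta> q)"
    by (simp only: left right avg distrib_left mult.assoc[symmetric] X1[symmetric] X2[symmetric])
  finally show ?thesis using X by simp
qed

text \<open>One half of the lemma of Fekete on subadditive sequences.\<close>

lemma degree_average_linear_bound:
  fixes \<theta> :: "'n::finite multiindex \<Rightarrow> real"
  assumes subadd: "\<And>k l. \<theta> (madd k l) \<le> \<theta> k + \<theta> l" and p: "p \<ge> 1"
    and upper: "\<And>k. \<theta> k \<le> real (mdeg k) * A" and A: "A \<ge> 0"
  obtains C where "C \<ge> 0" "\<And>q. degree_average \<theta> q \<le> real q * (degree_average \<theta> p / real p) + C"
proof
  let ?b = "degree_average \<theta>"
  let ?C = "real p * A + \<bar>?b p\<bar>"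
  show "?C \<ge> 0" using A by simp
  have b_le: "?b r \<le> real r * A" for r
  proof -
    have "(\<Sum>k | mdeg k = r. \<theta> k) \<le> (\<Sum>k\<in>{k :: 'n multiindex. mdeg k = r}. real r * A)"
      using upper by (intro sum_mono) auto
    then show ?thesis
      using num_degree_pos[where ?'n = 'n, of r]
      by (simp add: degree_average_def num_degree_def divide_le_eq mult.commute)
  qed
  have multiple: "?b (m * p + r) \<le> real m * ?b p + ?b r" for m r
  proof (induction m)
    case (Suc m)
    have "?b (Suc m * p + r) = ?b (p + (m * p + r))" by (simp add: algebra_simps)
    also have "\<dots> \<le> ?b p + ?b (m * p + r)" by (rule degree_average_subadditive[OF subadd])
    finally show ?case using Suc by (simp add: algebra_simps)
  qed simp
  fix q
  define m where "m = q div p"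
  define r where "r = q mod p"
  have q: "q = m * p + r" "r < p" using p by (auto simp: m_def r_def)
  have "?b q \<le> real m * ?b p + real r * A"
    using multiple[of m r] b_le[of r] q(1) by simp
  also have "real m * ?b p = real q * (?b p / real p) - real r / real p * ?b p"
    using p q(1) by (simp add: field_simps)
  also have "\<dots> \<le> real q * (?b p / real p) + \<bar>?b p\<bar>"
  proof -
    have "\<bar>real r / real p * ?b p\<bar> \<le> 1 * \<bar>?b p\<bar>"
      unfolding abs_mult using q p by (intro mult_right_mono) auto
    then show ?thesis by linarith
  qed
  also have "real r * A \<le> real p * A" using q A by (intro mult_right_mono) auto
  finally show "?b q \<le> real q * (?b p / real p) + ?C" by simp
qed

lemma sum_mdeg_le_linear_bound:
  fixes \<theta> :: "'n::finite multiindex \<Rightarrow> real"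
  assumes "\<And>q. degree_average \<theta> q \<le> real q * \<beta> + C"
  shows "(\<Sum>k | mdeg k \<le> \<sigma>. \<theta> k) \<le> \<beta> * real (total_degree TYPE('n) \<sigma>) + C * real (num_monomials TYPE('n) \<sigma>)"
proof -
  have "(\<Sum>k | mdeg k \<le> \<sigma>. \<theta> k) = (\<Sum>q\<le>\<sigma>. real (num_degree TYPE('n) q) * degree_average \<theta> q)"
    by (simp add: sum_mdeg_le sum_eq_degree_average)
  also have "\<dots> \<le> (\<Sum>q\<le>\<sigma>. real (num_degree TYPE('n) q) * (real q * \<beta> + C))"
    by (intro sum_mono mult_left_mono assms) auto
  also have "\<dots> = \<beta> * real (total_degree TYPE('n) \<sigma>) + C * real (num_monomials TYPE('n) \<sigma>)"
  proof (induction \<sigma>)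
    case 0
    have "num_degree TYPE('n) 0 = 1" by (simp add: num_degree_eq)
    then show ?case by (simp add: total_degree_0 num_monomials_0)
  next
    case (Suc \<sigma>)
    then show ?case by (simp add: total_degree_Suc num_monomials_Suc algebra_simps)
  qed
  finally show ?thesis .
qed

section \<open>The transfinite diameter\<close>

lemma prod_mdeg_le:
  fixes F :: "'n::finite multiindex \<Rightarrow> 'b::comm_monoid_mult"
  shows "(\<Prod>k | mdeg k \<le> J. F k) = (\<Prod>j\<le>J. \<Prod>k | mdeg k = j. F k)"
proof -
  have "(\<Prod>k | mdeg k \<le> J. F k) = (\<Prod>j\<in>{..J}. prod F {k \<in> {k. mdeg k \<le> J}. mdeg k = j})"
    by (rule prod.group[symmetric]) (auto intro: finite_mdeg_le)
  also have "\<dots> = (\<Prod>j\<le>J. \<Prod>k | mdeg k = j. F k)"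
    by (intro prod.cong) auto
  finally show ?thesis .
qed

text \<open>If in every positive degree the geometric mean of the Chebyshev constants, normalised by
  the degree, were at least \<open>d\<close>, then so would be the transfinite diameter.\<close>

lemma chebyshev_mean_less:
  fixes K :: "(complex ^ 'n::finite) set"
  assumes k: "graded_enumeration k" and K: "compact K" "K \<noteq> {}"
    and d: "transfinite_diameter k K < ereal d" "d > 0"
  shows "\<exists>p\<ge>1. (\<Prod>l | mdeg l = p. chebyshev_const K l) < d ^ (p * num_degree TYPE('n) p)"
proof (rule ccontr)
  assume no: "\<not> ?thesis"
  have ge: "d ^ (p * num_degree TYPE('n) p) \<le> (\<Prod>l | mdeg l = p. chebyshev_const K l)" if "p \<ge> 1" for p
    using no that by (meson not_le)
  have prod_ge: "d ^ total_degree TYPE('n) \<sigma> \<le> (\<Prod>l | mdeg l \<le> \<sigma>. chebyshev_const K l)" for \<sigma>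
  proof (induction \<sigma>)
    case 0
    have "{l :: 'n multiindex. mdeg l \<le> 0} = {\<lambda>_. 0}" by (auto simp: mdeg_0_iff)
    then show ?case using chebyshev_const_zero_index[OF K] by (simp add: total_degree_0)
  next
    case (Suc \<sigma>)
    have "d ^ total_degree TYPE('n) (Suc \<sigma>) = d ^ total_degree TYPE('n) \<sigma> *
        d ^ (Suc \<sigma> * num_degree TYPE('n) (Suc \<sigma>))"
      by (simp only: total_degree_Suc power_add)
    also have "\<dots> \<le> (\<Prod>l | mdeg l \<le> \<sigma>. chebyshev_const K l) * (\<Prod>l | mdeg l = Suc \<sigma>. chebyshev_const K l)"
      using d(2) by (intro mult_mono Suc ge prod_nonneg) (auto intro: chebyshev_const_nonneg[OF K])
    also have "\<dots> = (\<Prod>l | mdeg l \<le> Suc \<sigma>. chebyshev_const K l)"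
      by (simp add: prod_mdeg_le)
    finally show ?case .
  qed
  have "ereal d \<le> ereal (vandermonde_max k K (num_monomials TYPE('n) \<sigma>) powr
      (1 / real (total_degree TYPE('n) \<sigma>)))"
    if "\<sigma> \<ge> 1" for \<sigma>
  proof -
    have "total_degree TYPE('n) \<sigma> > 0"
      using that num_degree_pos[where ?'n = 'n, of \<sigma>] by (cases \<sigma>) (auto simp: total_degree_Suc)
    then have "d = (d ^ total_degree TYPE('n) \<sigma>) powr (1 / real (total_degree TYPE('n) \<sigma>))"
      using d(2) by (simp add: powr_realpow[symmetric] powr_powr)
    also have "\<dots> \<le> vandermonde_max k K (num_monomials TYPE('n) \<sigma>) powr (1 / real (total_degree TYPE('n) \<sigma>))"
      using d(2) prod_ge[of \<sigma>] vandermonde_max_ge[OF k K, of \<sigma>] by (intro powr_mono2) auto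
    finally show ?thesis by simp
  qed
  then have "ereal d \<le> transfinite_diameter k K"
    unfolding transfinite_diameter_def
    by (intro le_Limsup) (auto simp: eventually_sequentially intro!: exI[of _ 1])
  with d(1) show False by simp
qed

text \<open>The logarithm of the smallest norm on \<open>U\<close> of a monic polynomial, cut off from below by a
  linear function of the degree.  The cutoff keeps the infimum finite, without any lower bound for the
  norms of monic polynomials, and does not affect subadditivity.\<close>

definition log_norm :: "(complex ^ 'n::finite) set \<Rightarrow> real \<Rightarrow> 'n multiindex \<Rightarrow> real" where
  "log_norm U A k = Inf {t. - A * real (mdeg k) \<le> t \<and> (\<exists>q\<in>monic_polys k. \<forall>w\<in>U. cmod (q w) \<le> exp t)}"

lemma bdd_below_log_norm:
  "bdd_below {t. - A * real (mdeg k) \<le> t \<and> (\<exists>q\<in>monic_polys k. \<forall>w\<in>U. cmod (q w) \<le> exp t)}"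
  by (rule bdd_belowI[of _ "- A * real (mdeg k)"]) auto

lemma log_norm_le:
  assumes "- A * real (mdeg k) \<le> t" "q \<in> monic_polys k" "\<And>w. w \<in> U \<Longrightarrow> cmod (q w) \<le> exp t"
  shows "log_norm U A k \<le> t"
  unfolding log_norm_def using assms by (intro cInf_lower bdd_below_log_norm) auto

lemma monomial_norm_le_exp:
  assumes R: "R \<ge> 1" "\<And>w \<nu>. w \<in> U \<Longrightarrow> cmod (w $ \<nu>) \<le> R" and w: "w \<in> U"
  shows "cmod (mpow w k) \<le> exp (real (mdeg k) * ln R)"
proof -
  have "cmod (mpow w k) \<le> R ^ mdeg k" by (rule norm_mpow_le) (rule R(2)[OF w])
  also have "\<dots> = exp (real (mdeg k) * ln R)" using R(1) by (simp add: exp_of_nat_mult)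
  finally show ?thesis .
qed

lemma log_norm_upper:
  assumes A: "A \<ge> 0" and R: "R \<ge> 1" "\<And>w \<nu>. w \<in> U \<Longrightarrow> cmod (w $ \<nu>) \<le> R"
  shows "log_norm U A k \<le> real (mdeg k) * ln R"
proof (rule log_norm_le[OF _ mpow_monic])
  have "- A * real (mdeg k) \<le> 0" using A by simp
  also have "0 \<le> real (mdeg k) * ln R" using R(1) by simp
  finally show "- A * real (mdeg k) \<le> real (mdeg k) * ln R" .
qed (rule monomial_norm_le_exp[OF R])

lemma log_norm_lessD:
  assumes A: "A \<ge> 0" and R: "R \<ge> 1" "\<And>w \<nu>. w \<in> U \<Longrightarrow> cmod (w $ \<nu>) \<le> R" and less: "log_norm U A k < t"
  shows "\<exists>q\<in>monic_polys k. \<exists>s. - A * real (mdeg k) \<le> s \<and> s < t \<and> (\<forall>w\<in>U. cmod (q w) \<le> exp s)"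
proof -
  let ?T = "{t. - A * real (mdeg k) \<le> t \<and> (\<exists>q\<in>monic_polys k. \<forall>w\<in>U. cmod (q w) \<le> exp t)}"
  have "- A * real (mdeg k) \<le> 0" using A by simp
  also have "0 \<le> real (mdeg k) * ln R" using R(1) by simp
  finally have lower: "- A * real (mdeg k) \<le> real (mdeg k) * ln R" .
  have "cmod (mpow w k) \<le> exp (real (mdeg k) * ln R)" if "w \<in> U" for w
    by (rule monomial_norm_le_exp[OF R that])
  then have "real (mdeg k) * ln R \<in> ?T"
    by (intro CollectI conjI lower bexI[OF _ mpow_monic[of k]] ballI)
  then have "?T \<noteq> {}" by blast
  then obtain s where "s \<in> ?T" "s < t"
    using less cInf_lessD[of ?T t] unfolding log_norm_def by blast
  then show ?thesis by blast
qed

lemma log_norm_subadditive: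
  assumes A: "A \<ge> 0" and R: "R \<ge> 1" "\<And>w \<nu>. w \<in> U \<Longrightarrow> cmod (w $ \<nu>) \<le> R"
  shows "log_norm U A (madd k l) \<le> log_norm U A k + log_norm U A l"
proof (rule field_le_epsilon)
  fix e :: real assume e: "e > 0"
  have "log_norm U A k < log_norm U A k + e / 2" using e by simp
  from log_norm_lessD[OF A R this]
  obtain p s where p: "p \<in> monic_polys k" "- A * real (mdeg k) \<le> s" "s < log_norm U A k + e / 2"
    "\<forall>w\<in>U. cmod (p w) \<le> exp s"
    by blast
  have "log_norm U A l < log_norm U A l + e / 2" using e by simp
  from log_norm_lessD[OF A R this]
  obtain q t where q: "q \<in> monic_polys l" "- A * real (mdeg l) \<le> t" "t < log_norm U A l + e / 2"
    "\<forall>w\<in>U. cmod (q w) \<le> exp t"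
    by blast
  have "log_norm U A (madd k l) \<le> s + t"
  proof (rule log_norm_le[OF _ monic_polys_mult[OF p(1) q(1)]])
    show "- A * real (mdeg (madd k l)) \<le> s + t" using p(2) q(2) by (simp add: mdeg_madd algebra_simps)
    show "cmod (p w * q w) \<le> exp (s + t)" if "w \<in> U" for w
      using p(4) q(4) that by (simp add: norm_mult exp_add mult_mono)
  qed
  then show "log_norm U A (madd k l) \<le> log_norm U A k + log_norm U A l + e" using p(3) q(3) by simp
qed

text \<open>Near \<open>K\<close> the norms of monic polynomials are controlled by the Chebyshev constants of \<open>K\<close>
  of a single degree: this is where semicontinuity of the transfinite diameter from
  outside comes from.\<close>

lemma monic_polys_near:
  fixes K :: "(complex ^ 'n::finite) set"
  assumes K: "compact K" "K \<noteq> {}" and p: "p \<ge> 1" and d: "d > 0"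
    and less: "(\<Prod>l | mdeg l = p. chebyshev_const K l) < d ^ (p * num_degree TYPE('n) p)"
  obtains U R \<beta> C q t where "open U" "K \<subseteq> U" "R \<ge> 1" "C \<ge> 0" "\<beta> \<le> ln d"
    "\<And>w \<nu>. w \<in> U \<Longrightarrow> cmod (w $ \<nu>) \<le> R"
    "\<And>l. q l \<in> monic_polys l" "\<And>l w. w \<in> U \<Longrightarrow> cmod (q l w) \<le> exp (t l)"
    "\<And>\<sigma>. (\<Sum>l | mdeg l \<le> \<sigma>. t l) \<le> \<beta> * real (total_degree TYPE('n) \<sigma>) + C * real (num_monomials TYPE('n) \<sigma>)"
proof -
  let ?S = "{l :: 'n multiindex. mdeg l = p}"
  have "((\<lambda>\<eta>. \<Prod>l\<in>?S. chebyshev_const K l + \<eta>) \<longlongrightarrow> (\<Prod>l\<in>?S. chebyshev_const K l + 0)) (at_right 0)"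
    by (intro tendsto_intros)
  then have "eventually (\<lambda>\<eta>. (\<Prod>l\<in>?S. chebyshev_const K l + \<eta>) < d ^ (p * num_degree TYPE('n) p)) (at_right 0)"
    using less by (intro order_tendstoD) auto
  then have "eventually (\<lambda>\<eta>. \<eta> > 0 \<and> (\<Prod>l\<in>?S. chebyshev_const K l + \<eta>) < d ^ (p * num_degree TYPE('n) p))
      (at_right (0::real))"
    by (intro eventually_conj eventually_at_right_less)
  then obtain \<eta> where \<eta>: "\<eta> > 0" "(\<Prod>l\<in>?S. chebyshev_const K l + \<eta>) < d ^ (p * num_degree TYPE('n) p)"
    using eventually_happens'[of "at_right (0::real)"] by auto
  define \<tau> where "\<tau> l = chebyshev_const K l + \<eta>" for l
  have \<tau>: "\<tau> l > 0" for l using chebyshev_const_nonneg[OF K, of l] \<eta>(1) by (simp add: \<tau>_def)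
  have "\<exists>q\<in>monic_polys l. \<forall>z\<in>K. cmod (q z) < \<tau> l" for l
    by (rule chebyshev_const_lessD[OF K]) (simp add: \<tau>_def \<eta>(1))
  then obtain q0 where q0: "\<And>l. q0 l \<in> monic_polys l" "\<And>l z. z \<in> K \<Longrightarrow> cmod (q0 l z) < \<tau> l"
    by metis
  obtain R0 where R0: "R0 > 0" "K \<subseteq> ball 0 R0"
    using bounded_subset_ballD[OF compact_imp_bounded[OF K(1)], of 0] by blast
  define U where "U = ball 0 R0 \<inter> (\<Inter>l\<in>?S. {z. cmod (q0 l z) < \<tau> l})"
  have "open {z. cmod (q0 l z) < \<tau> l}" for l
    by (intro open_Collect_less continuous_intros continuous_on_monic[OF q0(1)])
  then have "open U" unfolding U_def by (intro open_Int open_INT) auto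
  have "K \<subseteq> U" using R0 q0(2) by (auto simp: U_def)
  define R where "R = max 1 R0"
  have R: "R \<ge> 1" "\<And>w \<nu>. w \<in> U \<Longrightarrow> cmod (w $ \<nu>) \<le> R"
  proof -
    fix w \<nu> assume "w \<in> U"
    then have "norm w < R0" by (simp add: U_def)
    then show "cmod (w $ \<nu>) \<le> R" using Finite_Cartesian_Product.norm_nth_le[of w \<nu>] by (simp add: R_def)
  qed (simp add: R_def)
  \<comment> \<open>With this \<open>A\<close> the cutoff lies below \<open>ln (\<tau> l)\<close> for all \<open>l\<close> of degree \<open>p\<close>.\<close>
  define A where "A = (\<Sum>l\<in>?S. \<bar>ln (\<tau> l)\<bar>)"
  have A: "A \<ge> 0" by (simp add: A_def sum_nonneg)
  define \<theta> where "\<theta> = log_norm U A"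
  have \<theta>_le: "\<theta> l \<le> ln (\<tau> l)" if l: "l \<in> ?S" for l
    unfolding \<theta>_def
  proof (rule log_norm_le[OF _ q0(1)])
    have "\<bar>ln (\<tau> l)\<bar> \<le> A" unfolding A_def using l by (intro member_le_sum) auto
    moreover have "A * 1 \<le> A * real (mdeg l)" using l p A by (intro mult_left_mono) auto
    ultimately show "- A * real (mdeg l) \<le> ln (\<tau> l)" by simp
    show "cmod (q0 l w) \<le> exp (ln (\<tau> l))" if "w \<in> U" for w
      using that l \<tau>[of l] by (auto simp: U_def less_imp_le)
  qed
  have subadd: "\<theta> (madd k l) \<le> \<theta> k + \<theta> l" for k l
    unfolding \<theta>_def by (rule log_norm_subadditive[OF A R])
  have upper: "\<theta> l \<le> real (mdeg l) * ln R" for l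
    unfolding \<theta>_def by (rule log_norm_upper[OF A R])
  have lnR: "ln R \<ge> 0" using R(1) by simp
  obtain C where C: "C \<ge> 0" "\<And>r. degree_average \<theta> r \<le> real r * (degree_average \<theta> p / real p) + C"
    using degree_average_linear_bound[OF subadd p upper lnR] by blast
  define \<beta> where "\<beta> = degree_average \<theta> p / real p"
  have "\<beta> \<le> ln d"
  proof -
    have "(\<Sum>l\<in>?S. \<theta> l) \<le> (\<Sum>l\<in>?S. ln (\<tau> l))" by (intro sum_mono \<theta>_le)
    also have "\<dots> = ln (\<Prod>l\<in>?S. \<tau> l)" using \<tau> by (subst ln_prod) (auto simp: less_imp_neq[symmetric])
    also have "\<dots> \<le> ln (d ^ (p * num_degree TYPE('n) p))"
      using \<eta>(2) \<tau> d by (intro ln_mono) (auto simp: \<tau>_def intro!: prod_pos)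
    also have "\<dots> = real p * real (num_degree TYPE('n) p) * ln d" using d by (simp add: ln_realpow)
    finally have "real (num_degree TYPE('n) p) * degree_average \<theta> p \<le> real (num_degree TYPE('n) p) *
        (real p * ln d)"
      by (simp add: sum_eq_degree_average mult_ac)
    then have "degree_average \<theta> p \<le> real p * ln d"
      using num_degree_pos[where ?'n = 'n, of p] by simp
    then show ?thesis using p by (simp add: \<beta>_def divide_le_eq mult.commute)
  qed
  have "\<exists>q\<in>monic_polys l. \<forall>w\<in>U. cmod (q w) \<le> exp (\<theta> l + 1)" for l
  proof -
    have "log_norm U A l < \<theta> l + 1" by (simp add: \<theta>_def)
    from log_norm_lessD[OF A R this]
    obtain q s where qs: "q \<in> monic_polys l" "s < \<theta> l + 1" "\<forall>w\<in>U. cmod (q w) \<le> exp s"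
      by blast
    have "cmod (q w) \<le> exp (\<theta> l + 1)" if "w \<in> U" for w
      using qs(2) bspec[OF qs(3) that] by (smt (verit) exp_le_cancel_iff)
    with qs(1) show ?thesis by blast
  qed
  then obtain q where q: "\<And>l. q l \<in> monic_polys l" "\<And>l w. w \<in> U \<Longrightarrow> cmod (q l w) \<le> exp (\<theta> l + 1)"
    by metis
  have "(\<Sum>l | mdeg l \<le> \<sigma>. \<theta> l + 1) \<le> \<beta> * real (total_degree TYPE('n) \<sigma>) + (C + 1) *
      real (num_monomials TYPE('n) \<sigma>)" for \<sigma>
    using sum_mdeg_le_linear_bound[of \<theta> \<beta> C \<sigma>] C(2)
    by (simp add: \<beta>_def sum.distrib num_monomials_def algebra_simps)
  then show ?thesis
    using that[of U R "C + 1" \<beta> q "\<lambda>l. \<theta> l + 1"] \<open>open U\<close> \<open>K \<subseteq> U\<close> R C(1) \<open>\<beta> \<le> ln d\<close> q by auto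
qed

section \<open>Growth of the Hankel determinants\<close>

lemma mdeg_enumeration_at_top:
  fixes k :: "nat \<Rightarrow> 'n::finite multiindex"
  assumes k: "graded_enumeration k"
  shows "filterlim (\<lambda>i. mdeg (k i)) at_top sequentially"
  unfolding filterlim_at_top
proof
  fix Z
  have inj: "inj_on k {1..}" using k by (auto simp: graded_enumeration_def bij_betw_def)
  have "Z \<le> mdeg (k i)" if i: "i > num_monomials TYPE('n) Z" for i
  proof (rule ccontr)
    assume "\<not> Z \<le> mdeg (k i)"
    then have "k i \<in> k ` {1..num_monomials TYPE('n) Z}"
      unfolding graded_enumeration_image[OF k] by simp
    then obtain j where "j \<in> {1..num_monomials TYPE('n) Z}" "k i = k j" by blast
    then show False using inj_onD[OF inj, of i j] i by auto
  qed
  then show "eventually (\<lambda>i. Z \<le> mdeg (k i)) sequentially"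
    unfolding eventually_sequentially by (intro exI[of _ "Suc (num_monomials TYPE('n) Z)"]) auto
qed

text \<open>The first \<open>i\<close> monomials contain all those of degree at most \<open>\<sigma>\<close>, for which the given monic
  polynomials are used, but only some of degree \<open>\<sigma> + 1\<close>, which are kept as they are; the latter
  are too few to matter.\<close>

lemma norm_hankel_det_growth:
  fixes k :: "nat \<Rightarrow> 'n::finite multiindex" and \<gamma> :: "'n multiindex \<Rightarrow> complex"
  assumes k: "graded_enumeration k"
    and bound: "\<And>S p M. finite S \<Longrightarrow> (\<And>w. w \<in> U \<Longrightarrow> cmod (\<Sum>k\<in>S. p k * mpow w k) \<le> M) \<Longrightarrow>
      cmod (\<Sum>k\<in>S. p k * \<gamma> k) \<le> C' * M"
    and C': "C' \<ge> 1"
    and R: "R \<ge> 1" "\<And>w \<nu>. w \<in> U \<Longrightarrow> cmod (w $ \<nu>) \<le> R" and C: "C \<ge> 0"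
    and q: "\<And>l. q l \<in> monic_polys l" "\<And>l w. w \<in> U \<Longrightarrow> cmod (q l w) \<le> exp (t l)"
    and t: "\<And>\<sigma>. (\<Sum>l | mdeg l \<le> \<sigma>. t l) \<le> \<beta> * real (total_degree TYPE('n) \<sigma>) + C *
        real (num_monomials TYPE('n) \<sigma>)"
    and i: "mdeg (k i) = Suc \<sigma>" "i \<ge> 1"
  defines "m \<equiv> real (num_monomials TYPE('n) (Suc \<sigma>))"
  shows "cmod (Determinant.det (Matrix.mat i i (\<lambda>(\<alpha>, \<beta>). \<gamma> (madd (k (\<alpha> + 1)) (k (\<beta> + 1)))))) \<le>
    exp (m * ln (m * C') + 2 * (\<beta> * real (total_degree TYPE('n) \<sigma>) + C * m +
      real (Suc \<sigma> * num_degree TYPE('n) (Suc \<sigma>)) * ln R))"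
proof -
  have bij: "bij_betw k {1..} UNIV" and mono: "mono_on {1..} (\<lambda>i. mdeg (k i))"
    using k by (auto simp: graded_enumeration_def)
  define e where "e \<alpha> = k (\<alpha> + 1)" for \<alpha>
  have inj_k: "inj_on k {1..}" using bij by (simp add: bij_betw_def)
  have inj: "inj_on e {..<i}"
    using inj_k by (auto simp: inj_on_def e_def)
  have deg_le: "mdeg (e \<alpha>) \<le> Suc \<sigma>" if "\<alpha> < i" for \<alpha>
    using mono_onD[OF mono, of "\<alpha> + 1" i] that i by (simp add: e_def)
  have lower_in: "l \<in> e ` {..<i}" if l: "mdeg l \<le> \<sigma>" for l
  proof -
    obtain j where j: "j \<ge> 1" "l = k j" using bij_betw_imp_surj_on[OF bij] by (metis UNIV_I atLeast_iff imageE)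
    have "j < i"
    proof (rule ccontr)
      assume "\<not> j < i"
      then have "mdeg (k i) \<le> mdeg (k j)" using mono_onD[OF mono, of i j] i(2) by simp
      then show False using l j i by simp
    qed
    then have "l = e (j - 1)" "j - 1 < i" using j by (auto simp: e_def)
    then show ?thesis by blast
  qed
  define q' where "q' \<alpha> = (if mdeg (e \<alpha>) \<le> \<sigma> then q (e \<alpha>) else (\<lambda>z. mpow z (e \<alpha>)))" for \<alpha>
  define t' where "t' l = (if mdeg l \<le> \<sigma> then t l else real (Suc \<sigma>) * ln R)" for l
  have "cmod (Determinant.det (Matrix.mat i i (\<lambda>(\<alpha>, \<beta>). \<gamma> (madd (e \<alpha>) (e \<beta>))))) \<le>
      fact i * C' ^ i * (\<Prod>\<alpha><i. exp (t' (e \<alpha>)))\<^sup>2"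
  proof (rule norm_hankel_det_le[where q = q' and U = U, OF bound])
    fix \<alpha> assume \<alpha>: "\<alpha> < i"
    show "q' \<alpha> \<in> monic_polys (e \<alpha>) \<and> (\<forall>w\<in>U. cmod (q' \<alpha> w) \<le> exp (t' (e \<alpha>)))"
    proof (cases "mdeg (e \<alpha>) \<le> \<sigma>")
      case True
      then show ?thesis using q by (simp add: q'_def t'_def)
    next
      case False
      then have "mdeg (e \<alpha>) = Suc \<sigma>" using deg_le[OF \<alpha>] by simp
      then show ?thesis
        using False monomial_norm_le_exp[OF R, where k = "e \<alpha>"] mpow_monic[of "e \<alpha>"]
            by (simp add: q'_def t'_def)
    qed
    show "{l. monomial_key l < monomial_key (e \<alpha>)} \<subseteq> e ` {..<i} \<or> q' \<alpha> = (\<lambda>z. mpow z (e \<alpha>))"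
    proof (cases "mdeg (e \<alpha>) \<le> \<sigma>")
      case True
      have "l \<in> e ` {..<i}" if "monomial_key l < monomial_key (e \<alpha>)" for l
        using mdeg_le_of_monomial_key_less[OF that] True by (intro lower_in) simp
      then show ?thesis by blast
    qed (simp add: q'_def)
  qed (use C' inj in auto)
  moreover have "(\<Sum>\<alpha><i. t' (e \<alpha>)) \<le> \<beta> * real (total_degree TYPE('n) \<sigma>) + C * m +
      real (Suc \<sigma> * num_degree TYPE('n) (Suc \<sigma>)) * ln R"
  proof -
    have "(\<Sum>\<alpha><i. t' (e \<alpha>)) = (\<Sum>l\<in>e ` {..<i}. t' l)"
      using sum.reindex[OF inj, of t'] by simp
    also have "e ` {..<i} = {l. mdeg l \<le> \<sigma>} \<union> {l \<in> e ` {..<i}. mdeg l = Suc \<sigma>}"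
      using lower_in deg_le by (force simp: le_Suc_eq)
    also have "(\<Sum>l\<in>{l. mdeg l \<le> \<sigma>} \<union> {l \<in> e ` {..<i}. mdeg l = Suc \<sigma>}. t' l) =
        (\<Sum>l | mdeg l \<le> \<sigma>. t' l) + (\<Sum>l\<in>{l \<in> e ` {..<i}. mdeg l = Suc \<sigma>}. t' l)"
      by (rule sum.union_disjoint) (auto intro: finite_mdeg_le)
    also have "(\<Sum>l | mdeg l \<le> \<sigma>. t' l) = (\<Sum>l | mdeg l \<le> \<sigma>. t l)"
      by (rule sum.cong) (auto simp: t'_def)
    finally have split: "(\<Sum>\<alpha><i. t' (e \<alpha>)) =
        (\<Sum>l | mdeg l \<le> \<sigma>. t l) + (\<Sum>l\<in>{l \<in> e ` {..<i}. mdeg l = Suc \<sigma>}. t' l)" .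
    have "(\<Sum>l\<in>{l \<in> e ` {..<i}. mdeg l = Suc \<sigma>}. t' l) =
        (\<Sum>l\<in>{l \<in> e ` {..<i}. mdeg l = Suc \<sigma>}. real (Suc \<sigma>) * ln R)"
      by (rule sum.cong) (auto simp: t'_def)
    also have "\<dots> \<le> (\<Sum>l :: 'n multiindex | mdeg l = Suc \<sigma>. real (Suc \<sigma>) * ln R)"
      using R(1) by (intro sum_mono2) auto
    also have "\<dots> = real (Suc \<sigma> * num_degree TYPE('n) (Suc \<sigma>)) * ln R"
      by (simp add: num_degree_def algebra_simps)
    finally have top: "(\<Sum>l\<in>{l \<in> e ` {..<i}. mdeg l = Suc \<sigma>}. t' l) \<le>
        real (Suc \<sigma> * num_degree TYPE('n) (Suc \<sigma>)) * ln R" .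
    have "real (num_monomials TYPE('n) \<sigma>) \<le> m" by (simp add: m_def num_monomials_Suc)
    then have "C * real (num_monomials TYPE('n) \<sigma>) \<le> C * m" using C by (rule mult_left_mono)
    then show ?thesis using t[of \<sigma>] split top by linarith
  qed
  moreover have "fact i * C' ^ i \<le> exp (m * ln (m * C'))"
  proof -
    have "i \<le> num_monomials TYPE('n) (Suc \<sigma>)"
    proof -
      have "e ` {..<i} \<subseteq> {l. mdeg l \<le> Suc \<sigma>}" using deg_le by auto
      then have "card (e ` {..<i}) \<le> num_monomials TYPE('n) (Suc \<sigma>)"
        unfolding num_monomials_def by (intro card_mono finite_mdeg_le)
      then show ?thesis by (simp add: card_image[OF inj])
    qed
    then have im: "real i \<le> m" "1 \<le> m" using i(2) by (auto simp: m_def)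
    have mC: "1 \<le> m * C'" using im C' mult_mono[of 1 m 1 C'] by simp
    have "fact i * C' ^ i \<le> real i ^ i * C' ^ i"
      using fact_le_power[of i, where ?'a = real] C' by (intro mult_right_mono) auto
    also have "\<dots> \<le> m ^ i * C' ^ i" using im C' by (intro mult_right_mono power_mono) auto
    also have "\<dots> = (m * C') ^ i" by (simp add: power_mult_distrib)
    also have "\<dots> = exp (real i * ln (m * C'))" using mC by (simp add: exp_of_nat_mult)
    also have "\<dots> \<le> exp (m * ln (m * C'))" using im mC by (simp add: mult_right_mono)
    finally show ?thesis .
  qed
  ultimately have "cmod (Determinant.det (Matrix.mat i i (\<lambda>(\<alpha>, \<beta>). \<gamma> (madd (e \<alpha>) (e \<beta>))))) \<le>
      exp (m * ln (m * C')) * (exp (\<beta> * real (total_degree TYPE('n) \<sigma>) + C * m +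
      real (Suc \<sigma> * num_degree TYPE('n) (Suc \<sigma>)) * ln R))\<^sup>2"
    by (elim order_trans, intro mult_mono power_mono) (auto simp: exp_sum[symmetric])
  also have "\<dots> = exp (m * ln (m * C') + 2 * (\<beta> * real (total_degree TYPE('n) \<sigma>) + C * m +
      real (Suc \<sigma> * num_degree TYPE('n) (Suc \<sigma>)) * ln R))"
    by (simp only: exp_add exp_double)
  finally show ?thesis by (simp add: e_def)
qed

text \<open>The normalised exponent in the preceding bound, after insertion of the values of the ratios
  of \<open>num_monomials\<close>, \<open>num_degree\<close> and \<open>total_degree\<close>; here \<open>N\<close> is the number of variables
  and \<open>s\<close> the degree.\<close>

definition growth_exponent :: "real \<Rightarrow> real \<Rightarrow> real \<Rightarrow> real \<Rightarrow> real \<Rightarrow> real \<Rightarrow> real" where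
  "growth_exponent N B \<beta> C A s = (N + 1) / (2 * N * s) * (N * ln (s + 1) + B) +
     \<beta> * (1 - (N + 1) / (s + N)) + C * (N + 1) / (N * s) + A * (N + 1) / (s + N)"

lemma growth_exponent_tendsto:
  assumes "N \<ge> 1"
  shows "((\<lambda>\<sigma>. growth_exponent N B \<beta> C A (real \<sigma>)) \<longlongrightarrow> \<beta>) at_top"
  unfolding growth_exponent_def using assms by real_asymp

lemma exponent_le:
  fixes \<sigma> :: nat
  assumes C': "C' \<ge> 1"
  defines "l \<equiv> real (total_degree TYPE('n::finite) (Suc \<sigma>))" and "m \<equiv> real (num_monomials TYPE('n) (Suc \<sigma>))"
  shows "l > 0" "(m * ln (m * C') + 2 * (\<beta> * real (total_degree TYPE('n) \<sigma>) + C * m +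
      real (Suc \<sigma> * num_degree TYPE('n) (Suc \<sigma>)) * A)) / (2 * l) \<le>
    growth_exponent (real CARD('n)) (ln C') \<beta> C A (real (Suc \<sigma>))"
proof -
  define N where "N = real CARD('n)"
  define s where "s = real (Suc \<sigma>)"
  define h where "h = real (num_degree TYPE('n) (Suc \<sigma>))"
  have "CARD('n) > 0" by (rule finite_UNIV_card_ge_0) simp
  then have N: "N \<ge> 1" by (simp add: N_def Suc_le_eq)
  have s: "s \<ge> 1" by (simp add: s_def)
  have h: "h > 0" using num_degree_pos[where ?'n = 'n] by (simp add: h_def)
  have m: "m \<ge> 1" using num_degree_pos[where ?'n = 'n, of "Suc \<sigma>"]
      by (simp add: m_def num_monomials_Suc Suc_le_eq)
  have l_eq: "(N + 1) * l = N * s * m"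
    using total_degree_num_monomials[where ?'n = 'n, of "Suc \<sigma>"]
    unfolding N_def l_def s_def m_def by (metis of_nat_1 of_nat_add of_nat_mult)
  have h_eq: "(s + N) * h = N * m"
    using num_degree_num_monomials[where ?'n = 'n, of "Suc \<sigma>"]
    unfolding N_def h_def s_def m_def by (metis of_nat_add of_nat_mult)
  have l_split: "real (total_degree TYPE('n) \<sigma>) = l - s * h"
    by (simp only: l_def s_def h_def total_degree_Suc of_nat_add of_nat_mult add_diff_cancel_right')
  have l_val: "l = N * s * m / (N + 1)" using l_eq N by (simp add: field_simps)
  show l: "l > 0" unfolding l_val using N s m by simp
  have ml: "m / l = (N + 1) / (N * s)" unfolding l_val using N s m by (simp add: field_simps)
  have "s * h * (s + N) = s * ((s + N) * h)" by (simp only: mult_ac)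
  also have "\<dots> = (N + 1) * l" unfolding h_eq l_eq by (simp only: mult_ac)
  finally have "s * h * (s + N) = (N + 1) * l" .
  moreover have "s + N \<noteq> 0" using N s by simp
  ultimately have hl: "s * h / l = (N + 1) / (s + N)"
    using l by (simp only: frac_eq_eq less_imp_neq[THEN not_sym] not_False_eq_True)
  have "ln (m * C') \<le> N * ln (s + 1) + ln C'"
  proof -
    have "m \<le> (s + 1) ^ CARD('n)"
      using of_nat_mono[OF num_monomials_le[where ?'n = 'n, of "Suc \<sigma>"], where ?'a = real]
          by (simp add: m_def s_def algebra_simps)
    then have "ln m \<le> ln ((s + 1) ^ CARD('n))" using m by (intro ln_mono) auto
    then show ?thesis using m C' s by (simp add: ln_mult ln_realpow N_def)
  qed
  then have "(m / l) / 2 * ln (m * C') \<le> (m / l) / 2 * (N * ln (s + 1) + ln C')"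
    using m l by (intro mult_left_mono) auto
  then have "(m / l) / 2 * ln (m * C') \<le> (N + 1) / (2 * N * s) * (N * ln (s + 1) + ln C')"
    by (simp add: ml mult_ac)
  moreover have "(m * ln (m * C') + 2 * (\<beta> * (l - s * h) + C * m + s * h * A)) / (2 * l) =
      (m / l) / 2 * ln (m * C') + \<beta> * (1 - s * h / l) + C * (m / l) + A * (s * h / l)"
    using l by (simp add: field_simps)
  moreover have "real (Suc \<sigma> * num_degree TYPE('n) (Suc \<sigma>)) = s * h"
    by (simp only: s_def h_def of_nat_mult)
  ultimately show "(m * ln (m * C') + 2 * (\<beta> * real (total_degree TYPE('n) \<sigma>) + C * m +
      real (Suc \<sigma> * num_degree TYPE('n) (Suc \<sigma>)) * A)) / (2 * l) \<le>
    growth_exponent (real CARD('n)) (ln C') \<beta> C A (real (Suc \<sigma>))"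
    unfolding growth_exponent_def N_def[symmetric] s_def[symmetric] l_split
    by (simp only: ml hl times_divide_eq_right add_le_cancel_right)
qed

section \<open>The estimate for weighted Hankel determinants\<close>

lemma limsup_hankel_le:
  fixes k :: "nat \<Rightarrow> 'n::finite multiindex" and \<gamma> :: "'n multiindex \<Rightarrow> complex"
  assumes k: "graded_enumeration k" and K: "compact K" "K \<noteq> {}"
    and bound: "\<And>U. open U \<Longrightarrow> K \<subseteq> U \<Longrightarrow> \<exists>C\<ge>0. \<forall>S p M. finite S \<longrightarrow>
      (\<forall>w\<in>U. cmod (\<Sum>k\<in>S. p k * mpow w k) \<le> M) \<longrightarrow> cmod (\<Sum>k\<in>S. p k * \<gamma> k) \<le> C * M"
  shows "limsup (\<lambda>i. ereal (cmod (Determinant.det (Matrix.mat i i (\<lambda>(\<alpha>, \<beta>). \<gamma> (madd (k (\<alpha> + 1)) (k (\<beta> + 1))))))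
      powr (1 / (2 * real (total_degree TYPE('n) (mdeg (k i))))))) \<le> transfinite_diameter k K"
    (is "limsup ?H \<le> _")
proof (rule ereal_le_real)
  fix d assume "transfinite_diameter k K \<le> ereal d"
  show "limsup ?H \<le> ereal d"
  proof (rule ereal_le_epsilon2)
    fix \<epsilon> :: real assume \<epsilon>: "\<epsilon> > 0"
    define D0 where "D0 = d + \<epsilon>"
    have "0 \<le> transfinite_diameter k K"
      unfolding transfinite_diameter_def by (intro le_Limsup) auto
    then have "0 \<le> ereal d" using \<open>transfinite_diameter k K \<le> ereal d\<close> by (rule order_trans)
    then have D0: "D0 > 0" using \<epsilon> by (simp add: D0_def)
    have "ereal d < ereal D0" using \<epsilon> by (simp add: D0_def)
    then have less: "transfinite_diameter k K < ereal D0"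
      using \<open>transfinite_diameter k K \<le> ereal d\<close> by (rule le_less_trans[rotated])
    obtain p where p: "p \<ge> (1 :: nat)" "(\<Prod>l | mdeg l = p. chebyshev_const K l) < D0 ^ (p *
        num_degree TYPE('n) p)"
      using chebyshev_mean_less[OF k K less D0] by blast
    show "limsup ?H \<le> ereal d + ereal \<epsilon>"
    proof (rule monic_polys_near[OF K p(1) D0 p(2)])
      fix U R C \<beta> q t
      assume U: "open U" "K \<subseteq> U" and R: "R \<ge> 1" and C: "C \<ge> 0" and \<beta>: "\<beta> \<le> ln D0"
        and UR: "\<And>w \<nu>. w \<in> U \<Longrightarrow> cmod (w $ \<nu>) \<le> R"
        and q: "\<And>l. q l \<in> monic_polys l" "\<And>l w. w \<in> U \<Longrightarrow> cmod (q l w) \<le> exp (t l)"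
        and t: "\<And>\<sigma>. (\<Sum>l | mdeg l \<le> \<sigma>. t l) \<le> \<beta> * real (total_degree TYPE('n) \<sigma>) + C *
            real (num_monomials TYPE('n) \<sigma>)"
      obtain C0 where C0: "C0 \<ge> 0" "\<forall>S p M. finite S \<longrightarrow>
          (\<forall>w\<in>U. cmod (\<Sum>k\<in>S. p k * mpow w k) \<le> M) \<longrightarrow> cmod (\<Sum>k\<in>S. p k * \<gamma> k) \<le> C0 * M"
        using bound[OF U] by blast
      define C' where "C' = max 1 C0"
      have C': "C' \<ge> 1" by (simp add: C'_def)
      have bound': "cmod (\<Sum>k\<in>S. p k * \<gamma> k) \<le> C' * M"
        if S: "finite S" and M: "\<And>w. w \<in> U \<Longrightarrow> cmod (\<Sum>k\<in>S. p k * mpow w k) \<le> M" for S p M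
      proof -
        obtain w where "w \<in> U" using U(2) K(2) by blast
        then have "0 \<le> M" using M norm_ge_zero order_trans by blast
        then have "C0 * M \<le> C' * M" by (intro mult_right_mono) (auto simp: C'_def)
        moreover have "cmod (\<Sum>k\<in>S. p k * \<gamma> k) \<le> C0 * M" using C0(2) S M by blast
        ultimately show ?thesis by linarith
      qed
      define E where "E = (\<lambda>\<sigma>. growth_exponent (real CARD('n)) (ln C') \<beta> C (ln R) (real \<sigma>))"
      have H_le: "?H i \<le> ereal (exp (E (mdeg (k i))))" if i: "i \<ge> 1" "mdeg (k i) \<ge> 1" for i
      proof -
        obtain \<sigma> where \<sigma>: "mdeg (k i) = Suc \<sigma>" using i(2) by (cases "mdeg (k i)") auto
        define l where "l = real (total_degree TYPE('n) (Suc \<sigma>))"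
        define m where "m = real (num_monomials TYPE('n) (Suc \<sigma>))"
        define X where "X = m * ln (m * C') + 2 * (\<beta> * real (total_degree TYPE('n) \<sigma>) + C * m +
          real (Suc \<sigma> * num_degree TYPE('n) (Suc \<sigma>)) * ln R)"
        define h where "h = cmod (Determinant.det (Matrix.mat i i (\<lambda>(\<alpha>, \<beta>). \<gamma> (madd (k (\<alpha> + 1)) (k (\<beta> + 1))))))"
        have "h \<le> exp X"
          unfolding h_def X_def m_def
          by (rule norm_hankel_det_growth[OF k bound' C' R UR C q t \<sigma> i(1)])
        then have "h powr (1 / (2 * l)) \<le> exp X powr (1 / (2 * l))"
          using exponent_le(1)[where ?'n = 'n, OF C', of \<sigma>] by (intro powr_mono2) (auto simp: h_def l_def)
        also have "\<dots> = exp (X / (2 * l))" by (simp add: powr_def)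
        also have "\<dots> \<le> exp (E (Suc \<sigma>))"
          using exponent_le(2)[where ?'n = 'n, OF C', of \<sigma> \<beta> C "ln R"]
          by (simp add: E_def X_def l_def m_def)
        finally show ?thesis by (simp add: h_def l_def \<sigma>)
      qed
      have deg: "filterlim (\<lambda>i. mdeg (k i)) at_top sequentially" by (rule mdeg_enumeration_at_top[OF k])
      have "(E \<longlongrightarrow> \<beta>) at_top"
        unfolding E_def
        by (rule growth_exponent_tendsto) (use finite_UNIV_card_ge_0[where ?'a = 'n] in \<open>simp add: Suc_le_eq\<close>)
      then have "((\<lambda>i. E (mdeg (k i))) \<longlongrightarrow> \<beta>) sequentially" by (rule filterlim_compose[OF _ deg])
      then have lim: "((\<lambda>i. ereal (exp (E (mdeg (k i))))) \<longlongrightarrow> ereal (exp \<beta>)) sequentially"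
        by (intro tendsto_intros)
      have "eventually (\<lambda>i. mdeg (k i) \<ge> 1) sequentially"
        using deg by (simp add: filterlim_at_top)
      then have "eventually (\<lambda>i. ?H i \<le> ereal (exp (E (mdeg (k i))))) sequentially"
        using eventually_ge_at_top[of 1] by eventually_elim (rule H_le)
      then have "limsup ?H \<le> limsup (\<lambda>i. ereal (exp (E (mdeg (k i)))))" by (rule Limsup_mono)
      also have "\<dots> = ereal (exp \<beta>)" by (rule lim_imp_Limsup[OF _ lim]) simp
      also have "\<dots> \<le> ereal D0"
      proof -
        have "exp \<beta> \<le> exp (ln D0)" using \<beta> by simp
        then show ?thesis using D0 by simp
      qed
      finally show ?thesis by (simp add: D0_def)
    qed
  qed
qed

theorem theorem2p4:
  fixes D :: "(complex ^ 'n::finite) set"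
    and a :: "complex ^ 'n"
    and f :: "complex ^ 'n \<Rightarrow> complex"
    and c :: "('n \<Rightarrow> nat) \<Rightarrow> complex"
    and k :: "nat \<Rightarrow> 'n \<Rightarrow> nat"
    and s :: nat
  assumes "graded_enumeration k"
    and "strictly_linearly_convex_domain D"
    and "a \<in> D"
    and "analytic_in f D"
    and "has_taylor_expansion f c a"
    and "s \<in> {1..CARD('n)}"
  shows "limsup (\<lambda>i. ereal (cmod (hankel_det k s c i)
             powr (1 / (2 * real (total_degree TYPE('n) (mdeg (k i)))))))
         \<le> transfinite_diameter k (conjugate_set ((\<lambda>z. z - a) ` D))"
proof -
  let ?K = "conjugate_set ((\<lambda>z. z - a) ` D)"
  have op: "open D" using assms(2) by (simp add: strictly_linearly_convex_domain_def)
  have K: "compact ?K" "?K \<noteq> {}"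
    using compact_conjugate_set[OF open_translation_subtract[OF op, of a]] assms(3) zero_in_conjugate_set
    by auto
  define g where "g = restrict0 D f"
  have gD: "g \<in> hol_space D" unfolding g_def by (rule restrict0_hol_space[OF op assms(4)])
  have coeff: "taylor_coeff g a = c"
    unfolding g_def by (intro taylor_coeffI has_taylor_expansion_restrict0 op assms(3,5))
  show ?thesis
    unfolding hankel_det_def
  proof (rule limsup_hankel_le[OF assms(1) K])
    fix U assume U: "open U" "?K \<subseteq> U"
    show "\<exists>C\<ge>0. \<forall>S p M. finite S \<longrightarrow> (\<forall>w\<in>U. cmod (\<Sum>k\<in>S. p k * mpow w k) \<le> M) \<longrightarrow>
        cmod (\<Sum>k\<in>S. p k * (c k / complex_of_real (fantappie_weight s k))) \<le> C * M"
    proof (rule weighted_taylor_functional_bound[OF assms(2,3) gD assms(6) U])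
      fix C :: real
      assume C: "C \<ge> 0" and bound: "\<And>S p M. finite S \<Longrightarrow>
        (\<And>w. w \<in> U \<Longrightarrow> cmod (\<Sum>k\<in>S. p k * mpow w k) \<le> M) \<Longrightarrow>
        cmod (\<Sum>k\<in>S. p k * (taylor_coeff g a k / complex_of_real (fantappie_weight s k))) \<le> C * M"
      show ?thesis
        using C bound unfolding coeff by blast
    qed
  qed
qed

end
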